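(* Let $X$ be a smooth complex surface, $D\subset X$ a divisor with normal crossings, and $z\in D$ a double point of $D$. Let $\pi:\tilde X_z\to X$ be the blow-up of $X$ at $z$, and $\tilde D=\pi^{-1}(D)$. Let $(w_1,w_2)$ be local coordinates centered at $z$ identifying a neighborhood $W$ of $z$ with $V_R\times V_R$, where $V_R=\{|w|<R\}\subset\mathbb C$, such that $D\cap W=\{w_1w_2=0\}$; let $0<r<R$, and let $Z$ be the space $\mathcal B^+_{\mathbb R}(X,D)$ with the circle action on its boundary modified over $\{|w_1|\le r,\,w_2=0\}\cup\{w_1=0,\,|w_2|\le r\}$ as described in the context. Then there exists a homeomorphism $h:\mathcal B^+_{\mathbb R}(\tilde X_z,\tilde D)\to Z$ which respects the circle actions on the boundaries.
   Context: A divisor with normal crossings $D$ in a smooth complex surface $X$ is a locally finite union of smooth curves intersecting transversally, with at most two through any point; points on exactly one local branch are ordinary (smooth) points, the others are double points. Real oriented blow-up. $\rho:\mathcal B^+_{\mathbb R}(X,D)\to X$ is the space over $X$ obtained by real (oriented, prime-end) blow-up of $D$; concretely it equals $X-D$ over $X-D$, and locally: if $(w_1,w_2)$ are local coordinates with $D=\{w_2=0\}$, it is the closure in $\{(w_1,w_2,\theta_2)\}$, $\theta_2\in\mathbb R/2\pi\mathbb Z$, of the set where $w_2\ne0$ and $e^{i\theta_2}=w_2/|w_2|$; if $D=\{w_1w_2=0\}$, it is the closure in $\{(w_1,w_2,\theta_1,\theta_2)\}$ of the set where $w_1w_2\neq0$, $e^{i\theta_1}=w_1/|w_1|$, $e^{i\theta_2}=w_2/|w_2|$.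 It is a 4-manifold with boundary $\mathcal B^+_{\mathbb R}(D)=\rho^{-1}(D)$. The fiber of $\rho$ over an ordinary point of $D$ is a circle, on which $\mathbb R/2\pi\mathbb Z$ acts canonically by rotating the polar angle of the local defining coordinate of $D$ (so, in the coordinates near a double point, $\Theta*(w_1,0,\theta_1,\theta_2)=(w_1,0,\theta_1,\theta_2+\Theta)$ for $w_1\ne0$ and $\Theta*(0,w_2,\theta_1,\theta_2)=(0,w_2,\theta_1+\Theta,\theta_2)$ for $w_2\neq 0$); over a double point the fiber is a torus. Thus there is a canonical circle action on the part of $\mathcal B^+_{\mathbb R}(D)$ over ordinary points. The space $Z$: as a space $Z=\mathcal B^+_{\mathbb R}(X,D)$; over $P=\{|w_1|\le r,\ w_2=0\}\cup\{w_1=0,\ |w_2|\le r\}$ the circle action is replaced by $$\Theta*(w_1,0,\theta_1,\theta_2)=(w_1e^{i\Theta},0,\theta_1+\Theta,\theta_2+\Theta),\qquad \Theta*(0,w_2,\theta_1,\theta_2)=(0,w_2e^{i\Theta},\theta_1+\Theta,\theta_2+\Theta),$$ and outside $P$ the canonical circle action is kept. On each of the two tori $\{|w_1|=r,w_2=0\}$ and $\{w_1=0,|w_2|=r\}$ there are thus two circle actions, one from each side. "Respects the circle actions" means that the restriction of $h$ to the boundaries carries the canonical circle action over ordinary points of $\tilde D$ to the circle action of $Z$. *)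

theory Defs
  imports "HOL-Analysis.Analysis"
begin

section \<open>Complex surfaces\<close>

text \<open>A chart is a domain together with a map to \<open>\<complex>\<^sup>2\<close>; only its values on the domain matter.\<close>

type_synonym 'a chart = "'a set \<times> ('a \<Rightarrow> complex \<times> complex)"

text \<open>Holomorphic in two variables: the real derivative exists and is complex-linear.\<close>

definition holomorphic2_on ::
    "(complex \<times> complex \<Rightarrow> complex \<times> complex) \<Rightarrow> (complex \<times> complex) set \<Rightarrow> bool"
  where "holomorphic2_on f S \<longleftrightarrow>
    (\<forall>p\<in>S. \<exists>f'. (f has_derivative f') (at p) \<and>
       (\<forall>c a b. f' (c * a, c * b) = (c * fst (f' (a, b)), c * snd (f' (a, b)))))"

fun chart_of :: "'a topology \<Rightarrow> 'a chart \<Rightarrow> bool"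
  where "chart_of X (U, \<phi>) \<longleftrightarrow> openin X U \<and> open (\<phi> ` U) \<and>
    homeomorphic_map (subtopology X U) (top_of_set (\<phi> ` U)) \<phi>"

fun holomorphic_transition :: "'a chart \<Rightarrow> 'a chart \<Rightarrow> bool"
  where "holomorphic_transition (U, \<phi>) (V, \<psi>) \<longleftrightarrow>
    holomorphic2_on (\<psi> \<circ> inv_into U \<phi>) (\<phi> ` (U \<inter> V))"

definition complex_surface :: "'a topology \<Rightarrow> 'a chart set \<Rightarrow> bool"
  where "complex_surface X A \<longleftrightarrow> Hausdorff_space X \<and> topspace X = (\<Union>c\<in>A. fst c) \<and>
    (\<forall>c\<in>A. chart_of X c) \<and> (\<forall>c\<in>A. \<forall>d\<in>A. holomorphic_transition c d)"

text \<open>Local holomorphic coordinates, i.e. the members of the maximal atlas containing \<open>A\<close>.\<close>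

definition hol_chart :: "'a topology \<Rightarrow> 'a chart set \<Rightarrow> 'a chart \<Rightarrow> bool"
  where "hol_chart X A c \<longleftrightarrow> chart_of X c \<and>
    (\<forall>d\<in>A. holomorphic_transition c d \<and> holomorphic_transition d c)"

definition biholomorphic ::
    "'a topology \<Rightarrow> 'a chart set \<Rightarrow> 'a set \<Rightarrow> 'b topology \<Rightarrow> 'b chart set \<Rightarrow> 'b set \<Rightarrow> ('a \<Rightarrow> 'b) \<Rightarrow> bool"
  where "biholomorphic X A S Y B T f \<longleftrightarrow>
    homeomorphic_map (subtopology X S) (subtopology Y T) f \<and>
    (\<forall>(U, \<phi>)\<in>A. \<forall>(V, \<psi>)\<in>B.
       holomorphic2_on (\<psi> \<circ> f \<circ> inv_into U \<phi>) (\<phi> ` {x \<in> U \<inter> S. f x \<in> V}) \<and>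
       holomorphic2_on (\<phi> \<circ> inv_into S f \<circ> inv_into V \<psi>) (\<psi> ` f ` {x \<in> U \<inter> S. f x \<in> V}))"


section \<open>Divisors with normal crossings\<close>

text \<open>Charts at \<open>x\<close> in which \<open>C\<close> is the coordinate axis \<open>w\<^sub>2 = 0\<close>.\<close>

definition curve_chart :: "'a topology \<Rightarrow> 'a chart set \<Rightarrow> 'a set \<Rightarrow> 'a \<Rightarrow> 'a chart \<Rightarrow> bool"
  where "curve_chart X A C x c \<longleftrightarrow> hol_chart X A c \<and> x \<in> fst c \<and>
    snd c ` (C \<inter> fst c) = {w \<in> snd c ` fst c. snd w = 0}"

definition smooth_curve_in :: "'a topology \<Rightarrow> 'a chart set \<Rightarrow> 'a set \<Rightarrow> 'a set \<Rightarrow> bool"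
  where "smooth_curve_in X A N C \<longleftrightarrow> closedin (subtopology X N) C \<and>
    (\<forall>x\<in>C. \<exists>c. curve_chart X A C x c)"

text \<open>In the coordinates \<open>\<phi>\<close> the tangent line of the first curve is spanned by \<open>(1, 0)\<close>;
  the derivative of \<open>\<psi> \<circ> \<phi>\<^sup>-\<^sup>1\<close> must not map it to the tangent line of the
  second curve, which in the coordinates \<open>\<psi>\<close> is \<open>w\<^sub>2 = 0\<close>.\<close>

definition transverse_at :: "'a topology \<Rightarrow> 'a chart set \<Rightarrow> 'a set \<Rightarrow> 'a set \<Rightarrow> 'a \<Rightarrow> bool"
  where "transverse_at X A C1 C2 x \<longleftrightarrow>
    (\<exists>U \<phi> V \<psi> f'. curve_chart X A C1 x (U, \<phi>) \<and> curve_chart X A C2 x (V, \<psi>) \<and>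
       (\<psi> \<circ> inv_into U \<phi> has_derivative f') (at (\<phi> x)) \<and> snd (f' (1, 0)) \<noteq> 0)"

text \<open>\<open>\<C>\<close> is the set of branches of \<open>D\<close> in the open set \<open>N\<close>.\<close>

definition nc_branches ::
    "'a topology \<Rightarrow> 'a chart set \<Rightarrow> 'a set \<Rightarrow> 'a set \<Rightarrow> 'a set set \<Rightarrow> bool"
  where "nc_branches X A D N \<C> \<longleftrightarrow> openin X N \<and> finite \<C> \<and> D \<inter> N = \<Union>\<C> \<and>
    (\<forall>C\<in>\<C>. smooth_curve_in X A N C) \<and>
    (\<forall>x\<in>N. card {C \<in> \<C>. x \<in> C} \<le> 2) \<and>
    (\<forall>C1\<in>\<C>. \<forall>C2\<in>\<C>. C1 \<noteq> C2 \<longrightarrow> (\<forall>x\<in>C1 \<inter> C2. transverse_at X A C1 C2 x))"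

text \<open>Only the local branches are required to be smooth, so a component of \<open>D\<close> may
  cross itself.\<close>

definition nc_divisor :: "'a topology \<Rightarrow> 'a chart set \<Rightarrow> 'a set \<Rightarrow> bool"
  where "nc_divisor X A D \<longleftrightarrow> D \<subseteq> topspace X \<and>
    (\<forall>x\<in>topspace X. \<exists>N \<C>. x \<in> N \<and> nc_branches X A D N \<C>)"

definition ordinary_point :: "'a topology \<Rightarrow> 'a chart set \<Rightarrow> 'a set \<Rightarrow> 'a \<Rightarrow> bool"
  where "ordinary_point X A D x \<longleftrightarrow>
    (\<exists>N \<C>. x \<in> N \<and> nc_branches X A D N \<C> \<and> card {C \<in> \<C>. x \<in> C} = 1)"

definition double_point :: "'a topology \<Rightarrow> 'a chart set \<Rightarrow> 'a set \<Rightarrow> 'a \<Rightarrow> bool"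
  where "double_point X A D x \<longleftrightarrow> x \<in> D \<and> \<not> ordinary_point X A D x"


section \<open>The blow-up of a point\<close>

text \<open>The projective line, as the set of complex lines through the origin of \<open>\<complex>\<^sup>2\<close>.\<close>

definition lines :: "(complex \<times> complex) set set"
  where "lines = {range (\<lambda>c. (c * a, c * b)) | a b. (a, b) \<noteq> (0, 0)}"

text \<open>\<open>\<pi>\<close> is biholomorphic away from \<open>z\<close>, and over the domain of some chart \<open>\<psi>\<close> centred at
  \<open>z\<close> it is the projection of the incidence variety \<open>{(v, l). v \<in> l}\<close>; the complex
  structure of the latter is that of its affine charts \<open>(v\<^sub>1, v\<^sub>2/v\<^sub>1)\<close> and
  \<open>(v\<^sub>1/v\<^sub>2, v\<^sub>2)\<close>, where the slopes are those of \<open>l\<close>.\<close>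

definition blow_up ::
    "'a topology \<Rightarrow> 'a chart set \<Rightarrow> 'a \<Rightarrow> 'b topology \<Rightarrow> 'b chart set \<Rightarrow> ('b \<Rightarrow> 'a) \<Rightarrow> bool"
  where "blow_up X A z X' A' \<pi> \<longleftrightarrow>
    complex_surface X' A' \<and> \<pi> ` topspace X' \<subseteq> topspace X \<and>
    biholomorphic X' A' {y \<in> topspace X'. \<pi> y \<noteq> z} X A (topspace X - {z}) \<pi> \<and>
    (\<exists>U \<psi> l. hol_chart X A (U, \<psi>) \<and> z \<in> U \<and> \<psi> z = (0, 0) \<and>
       bij_betw (\<lambda>y. (\<psi> (\<pi> y), l y)) {y \<in> topspace X'. \<pi> y \<in> U}
         {(v, k). v \<in> \<psi> ` U \<and> k \<in> lines \<and> v \<in> k} \<and>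
       hol_chart X' A' ({y \<in> topspace X'. \<pi> y \<in> U \<and> (\<exists>t. (1, t) \<in> l y)},
         \<lambda>y. (fst (\<psi> (\<pi> y)), THE t. (1, t) \<in> l y)) \<and>
       hol_chart X' A' ({y \<in> topspace X'. \<pi> y \<in> U \<and> (\<exists>s. (s, 1) \<in> l y)},
         \<lambda>y. (THE s. (s, 1) \<in> l y, snd (\<psi> (\<pi> y)))))"


section \<open>The real oriented blow-up\<close>

datatype position = Away | Smooth | Crossing

fun local_divisor :: "position \<Rightarrow> (complex \<times> complex) set"
  where
    "local_divisor Away = {}"
  | "local_divisor Smooth = {(w1, w2). w2 = 0}"
  | "local_divisor Crossing = {(w1, w2). w1 * w2 = 0}"

definition adapted_chart ::
    "'a topology \<Rightarrow> 'a chart set \<Rightarrow> 'a set \<Rightarrow> 'a chart \<Rightarrow> position \<Rightarrow> bool"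
  where "adapted_chart X A D c k \<longleftrightarrow> hol_chart X A c \<and>
    snd c ` (D \<inter> fst c) = local_divisor k \<inter> snd c ` fst c"

text \<open>An angle \<open>\<theta>\<close> in \<open>\<real>/2\<pi>\<int>\<close> is recorded as \<open>e\<^sup>i\<^sup>\<theta>\<close>, and \<open>sgn w = w/|w|\<close>. Angles of coordinates
  that are not blown up are absent in the local model; they are given the dummy value 1.\<close>

type_synonym polar_point = "(complex \<times> complex) \<times> (complex \<times> complex)"

fun polar :: "position \<Rightarrow> complex \<times> complex \<Rightarrow> polar_point"
  where
    "polar Away (w1, w2) = ((w1, w2), (1, 1))"
  | "polar Smooth (w1, w2) = ((w1, w2), (1, sgn w2))"
  | "polar Crossing (w1, w2) = ((w1, w2), (sgn w1, sgn w2))"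

text \<open>The local piece of the blow-up over the domain \<open>U\<close> of an adapted chart: the closure of the
  graph of the angles over \<open>U - D\<close>, within the part lying over \<open>\<phi> ` U\<close>.\<close>

fun polar_model :: "'a set \<Rightarrow> 'a chart \<Rightarrow> position \<Rightarrow> polar_point set"
  where "polar_model D (U, \<phi>) k =
    {m \<in> closure ((\<lambda>x. polar k (\<phi> x)) ` (U - D)). fst m \<in> \<phi> ` U}"

text \<open>The local pieces are glued along \<open>X - D\<close>. A point \<open>m\<close> of a local piece is represented,
  independently of the chart, by the trace on \<open>X - D\<close> of its neighbourhoods: points of
  two pieces are identified iff these filters agree.\<close>

fun prime_end :: "'a set \<Rightarrow> 'a chart \<Rightarrow> position \<Rightarrow> polar_point \<Rightarrow> 'a filter"
  where "prime_end D (U, \<phi>) k m =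
    inf (filtercomap (\<lambda>x. polar k (\<phi> x)) (nhds m)) (principal (U - D))"

definition prime_ends :: "'a topology \<Rightarrow> 'a chart set \<Rightarrow> 'a set \<Rightarrow> 'a filter set"
  where "prime_ends X A D =
    {prime_end D c k m | c k m. adapted_chart X A D c k \<and> m \<in> polar_model D c k}"

definition real_blow_up :: "'a topology \<Rightarrow> 'a chart set \<Rightarrow> 'a set \<Rightarrow> 'a filter topology"
  where "real_blow_up X A D = topology (\<lambda>G. G \<subseteq> prime_ends X A D \<and>
    (\<forall>c k. adapted_chart X A D c k \<longrightarrow>
       openin (top_of_set (polar_model D c k)) {m \<in> polar_model D c k. prime_end D c k m \<in> G}))"

lemma openin_real_blow_up:
  "openin (real_blow_up X A D) G \<longleftrightarrow> G \<subseteq> prime_ends X A D \<and>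
    (\<forall>c k. adapted_chart X A D c k \<longrightarrow>
       openin (top_of_set (polar_model D c k)) {m \<in> polar_model D c k. prime_end D c k m \<in> G})"
proof -
  let ?pre = "\<lambda>c k G. {m \<in> polar_model D c k. prime_end D c k m \<in> G}"
  have int: "?pre c k (S \<inter> T) = ?pre c k S \<inter> ?pre c k T" for c k S T
    by auto
  have un: "?pre c k (\<Union>\<K>) = \<Union>(?pre c k ` \<K>)" for c k \<K>
    by auto
  have "istopology (\<lambda>G. G \<subseteq> prime_ends X A D \<and>
    (\<forall>c k. adapted_chart X A D c k \<longrightarrow> openin (top_of_set (polar_model D c k)) (?pre c k G)))"
    unfolding istopology_def
  proof (intro conjI allI impI, goal_cases)
    case 1
    then show ?case by blast
  next
    case 2
    then show ?case unfolding int by (intro openin_Int; blast)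
  next
    case 3
    then show ?case by blast
  next
    case 4
    then show ?case unfolding un by (intro openin_Union; blast)
  qed
  then show ?thesis
    unfolding real_blow_up_def by (simp add: topology_inverse')
qed

lemma topspace_real_blow_up: "topspace (real_blow_up X A D) = prime_ends X A D"
proof -
  have "{m \<in> polar_model D c k. prime_end D c k m \<in> prime_ends X A D} = polar_model D c k"
    if "adapted_chart X A D c k" for c k
    using that unfolding prime_ends_def by blast
  then have "openin (real_blow_up X A D) (prime_ends X A D)"
    by (simp add: openin_real_blow_up)
  then show ?thesis
    by (meson openin_real_blow_up openin_subset openin_topspace subset_antisym)
qed

text \<open>The projection \<open>\<rho>\<close> of the real blow-up onto \<open>X\<close>.\<close>

definition foot :: "'a topology \<Rightarrow> 'a filter \<Rightarrow> 'a"
  where "foot X F = (THE x. limitin X (\<lambda>y. y) x F)"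

definition blow_up_boundary :: "'a topology \<Rightarrow> 'a chart set \<Rightarrow> 'a set \<Rightarrow> 'a filter set"
  where "blow_up_boundary X A D = {F \<in> prime_ends X A D. foot X F \<in> D}"


section \<open>Circle actions\<close>

definition ordinary_boundary :: "'a topology \<Rightarrow> 'a chart set \<Rightarrow> 'a set \<Rightarrow> 'a filter set"
  where "ordinary_boundary X A D = {F \<in> blow_up_boundary X A D. ordinary_point X A D (foot X F)}"

text \<open>The canonical action; meaningful on \<^const>\<open>ordinary_boundary\<close>, where the result
  does not depend on the chart.\<close>

definition canonical_rotation ::
    "'a topology \<Rightarrow> 'a chart set \<Rightarrow> 'a set \<Rightarrow> real \<Rightarrow> 'a filter \<Rightarrow> 'a filter"
  where "canonical_rotation X A D \<Theta> F = (THE G. \<exists>c w1 s.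
    adapted_chart X A D c Smooth \<and> ((w1, 0), (1, s)) \<in> polar_model D c Smooth \<and>
    F = prime_end D c Smooth ((w1, 0), (1, s)) \<and>
    G = prime_end D c Smooth ((w1, 0), (1, cis \<Theta> * s)))"

text \<open>The set \<open>P\<close>, for a chart \<open>c\<close> with coordinates \<open>(w\<^sub>1, w\<^sub>2)\<close>, and the two circles
  that bound it.\<close>

fun axes_part :: "'a chart \<Rightarrow> real \<Rightarrow> 'a set"
  where "axes_part (U, w) r =
    {x \<in> U. (cmod (fst (w x)) \<le> r \<and> snd (w x) = 0) \<or> (fst (w x) = 0 \<and> cmod (snd (w x)) \<le> r)}"

fun axes_circles :: "'a chart \<Rightarrow> real \<Rightarrow> 'a set"
  where "axes_circles (U, w) r =
    {x \<in> U. (cmod (fst (w x)) = r \<and> snd (w x) = 0) \<or> (fst (w x) = 0 \<and> cmod (snd (w x)) = r)}"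

text \<open>The modified action over \<open>P\<close>. The coordinate that vanishes is unaffected by the factor, so
  a single formula covers both axes.\<close>

definition crossing_rotation ::
    "'a set \<Rightarrow> 'a chart \<Rightarrow> real \<Rightarrow> 'a filter \<Rightarrow> 'a filter"
  where "crossing_rotation D c \<Theta> F = (THE G. \<exists>w1 w2 s1 s2.
    ((w1, w2), (s1, s2)) \<in> polar_model D c Crossing \<and>
    F = prime_end D c Crossing ((w1, w2), (s1, s2)) \<and>
    G = prime_end D c Crossing
          ((cis \<Theta> * w1, cis \<Theta> * w2), (cis \<Theta> * s1, cis \<Theta> * s2)))"

definition Z_rotation ::
    "'a topology \<Rightarrow> 'a chart set \<Rightarrow> 'a set \<Rightarrow> 'a chart \<Rightarrow> real \<Rightarrow> real \<Rightarrow> 'a filter \<Rightarrow> 'a filter"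
  where "Z_rotation X A D c r \<Theta> F =
    (if foot X F \<in> axes_part c r then crossing_rotation D c \<Theta> F
     else canonical_rotation X A D \<Theta> F)"

text \<open>The part of the boundary of \<open>Z\<close> that carries exactly one circle action. Over
  \<^const>\<open>axes_circles\<close> there are two, one from each side; like the tori over double points
  of a divisor, these tori are excluded.\<close>

definition Z_regular_boundary ::
    "'a topology \<Rightarrow> 'a chart set \<Rightarrow> 'a set \<Rightarrow> 'a chart \<Rightarrow> real \<Rightarrow> 'a filter set"
  where "Z_regular_boundary X A D c r =
    {F \<in> blow_up_boundary X A D. foot X F \<notin> axes_circles c r \<and>
       (foot X F \<in> axes_part c r \<or> ordinary_point X A D (foot X F))}"

definition respects_circle_actions ::
    "'b topology \<Rightarrow> 'b chart set \<Rightarrow> 'b set \<Rightarrow> 'a topology \<Rightarrow> 'a chart set \<Rightarrow> 'a set \<Rightarrow>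
     'a chart \<Rightarrow> real \<Rightarrow> ('b filter \<Rightarrow> 'a filter) \<Rightarrow> bool"
  where "respects_circle_actions X' A' D' X A D c r h \<longleftrightarrow>
    h ` blow_up_boundary X' A' D' = blow_up_boundary X A D \<and>
    h ` ordinary_boundary X' A' D' = Z_regular_boundary X A D c r \<and>
    (\<forall>F\<in>ordinary_boundary X' A' D'. \<forall>\<Theta>.
       h (canonical_rotation X' A' D' \<Theta> F) = Z_rotation X A D c r \<Theta> (h F))"

end

(* By definition a point of the real blow-up is the trace on X - D of its neighbourhood filter, so
   the real blow-up carries the topology of a strict extension of X - D: it depends only on the set
   of these filters. Hence a bijection X' - D' -> X - D which, together with its inverse, maps each
   of these filters into another one induces a homeomorphism of the real blow-ups.

   Outside W the bijection is \<pi>. In W it is \<pi> followed by the map that keeps both angles and,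
   where |w2| <= |w1|, keeps |w2| and replaces |w1| by |w1| + r (1 - |w2|/|w1|) (1 - |w1|/R1), if
   |w1| <= R1, for some R1 strictly between r and R (symmetrically where |w1| <= |w2|). The modulus of
   the slope w2/w1 along the exceptional curve runs through the segment [0, \<infinity>], which this map
   bends onto the L-shaped set of the (|w1|, |w2|) with one entry zero and the other at most r. In
   the affine chart (w1, w2/w1) rotating the angle of the equation w1 of the exceptional curve rotates
   the angles of w1 and w2 simultaneously, which is the circle action of Z over P. *)
theory Submission
  imports Defs "HOL-Complex_Analysis.Complex_Analysis"
begin

section \<open>Complex differentiability in two variables\<close>

text \<open>Two independences of coordinates carry the weight. A trace filter is named by one
  adapted chart, so its angles must converge in every other: the branches of \<open>D\<close>
  through a point are the same in both, and the quotient of two equations of one branch has a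
  nonzero limit, so the angles differ by a constant factor. And the blow-up comes with slopes for
  one unspecified centred chart, whereas the action of \<open>Z\<close> is written in
  \<open>w\<close>; the change of coordinates is lifted to the exceptional curve, where quotients
  extend holomorphically by Osgood's lemma. No proper filter lies below two distinct trace filters,
  so inequalities for the map and for its inverse already give equality. The factor 1 - |w2|/|w1|
  depends on the slope alone and so survives on the exceptional curve; the factor with R1 switches
  the deformation off. Only the larger modulus moves, so the inverse solves one quadratic equation
  with the smaller modulus as a parameter. With R1 < R the closed box of radius R1 is compact, hence
  closed in the surface, and the map is the identity near every point outside
  \<open>W\<close>.\<close>

definition cdiff2 :: "(complex \<times> complex \<Rightarrow> complex) \<Rightarrow> complex \<times> complex \<Rightarrow> bool"
  where "cdiff2 G p \<longleftrightarrow> (\<exists>\<alpha> \<beta>. (G has_derivative (\<lambda>v. \<alpha> * fst v + \<beta> * snd v)) (at p))"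

lemma cdiff2_isCont: "cdiff2 G p \<Longrightarrow> isCont G p"
  unfolding cdiff2_def using has_derivative_continuous by blast

section \<open>Partial derivatives and Osgood's lemma\<close>

lemma has_derivative_partial_snd:
  assumes "(G has_derivative (\<lambda>v. \<alpha> * fst v + \<beta> * snd v)) (at (a, b))"
  shows "((\<lambda>y. G (a, y)) has_field_derivative \<beta>) (at b)"
proof -
  have "((\<lambda>y. (a, y)) has_derivative (\<lambda>y. (0, y))) (at b)"
    by (auto intro!: derivative_eq_intros)
  from has_derivative_compose[OF this, of G] assms
  show ?thesis unfolding has_field_derivative_def by fastforce
qed

lemma has_derivative_partial_fst:
  assumes "(G has_derivative (\<lambda>v. \<alpha> * fst v + \<beta> * snd v)) (at (a, b))"
  shows "((\<lambda>x. G (x, b)) has_field_derivative \<alpha>) (at a)"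
proof -
  have "((\<lambda>x. (x, b)) has_derivative (\<lambda>x. (x, 0))) (at a)"
    by (auto intro!: derivative_eq_intros)
  from has_derivative_compose[OF this, of G] assms
  show ?thesis unfolding has_field_derivative_def by fastforce
qed

text \<open>Cauchy's inequality of order one for \<open>f - g\<close>: closeness on a disc of radius
  \<open>e\<close> controls the derivatives at its centre.\<close>

lemma deriv_diff_le:
  assumes "f holomorphic_on S" "g holomorphic_on S" "open S" "cball b e \<subseteq> S" "0 < e"
    and "\<And>y. y \<in> cball b e \<Longrightarrow> norm (f y - g y) \<le> M"
  shows "norm (deriv f b - deriv g b) \<le> M / e"
proof -
  have b: "b \<in> S" "ball b e \<subseteq> S" using assms(4,5) by auto
  have hol: "(\<lambda>y. f y - g y) holomorphic_on S" using assms(1,2) by (intro holomorphic_intros)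
  have "norm ((deriv ^^ 1) (\<lambda>y. f y - g y) b) \<le> fact 1 * M / e ^ 1"
  proof (rule Cauchy_inequality)
    show "(\<lambda>y. f y - g y) holomorphic_on ball b e" using hol b(2) holomorphic_on_subset by blast
    show "continuous_on (cball b e) (\<lambda>y. f y - g y)"
      using hol assms(4) holomorphic_on_imp_continuous_on holomorphic_on_subset by blast
    show "norm (f y - g y) \<le> M" if "norm (b - y) = e" for y
      using that assms(6) by (simp add: dist_norm)
  qed (fact assms)
  moreover have "deriv (\<lambda>y. f y - g y) b = deriv f b - deriv g b"
    using assms(1-3) b(1) by (intro deriv_diff) (auto intro: holomorphic_on_imp_differentiable_at)
  ultimately show ?thesis by simp
qed

lemma open_Times_cball:
  assumes "open S" "(a, b) \<in> S"
  obtains e where "0 < e" "cball a e \<times> cball b e \<subseteq> S"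
proof -
  obtain A B where "open A" "open B" "a \<in> A" "b \<in> B" "A \<times> B \<subseteq> S"
    using assms open_prod_elim by (metis mem_Sigma_iff)
  moreover obtain e1 where "0 < e1" "cball a e1 \<subseteq> A"
    using \<open>open A\<close> \<open>a \<in> A\<close> open_contains_cball by blast
  moreover obtain e2 where "0 < e2" "cball b e2 \<subseteq> B"
    using \<open>open B\<close> \<open>b \<in> B\<close> open_contains_cball by blast
  ultimately have "cball a (min e1 e2) \<times> cball b (min e1 e2) \<subseteq> S" by fastforce
  then show thesis using that[of "min e1 e2"] \<open>0 < e1\<close> \<open>0 < e2\<close> by simp
qed

text \<open>Near \<open>a\<close> the functions \<open>G (x, _)\<close> are uniformly close to
  \<open>G (a, _)\<close>, since \<open>G\<close> is uniformly continuous on a compact bidisc, and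
  Cauchy's inequality passes this on to the derivatives. What remains is the continuity of the
  derivative of the single function \<open>G (a, _)\<close>.\<close>

lemma isCont_partial_snd:
  fixes G :: "complex \<times> complex \<Rightarrow> complex"
  assumes S: "open S" "p \<in> S" and cont: "continuous_on S G"
    and diff: "\<And>a b. (a, b) \<in> S \<Longrightarrow> (\<lambda>y. G (a, y)) field_differentiable (at b)"
  shows "isCont (\<lambda>q. deriv (\<lambda>y. G (fst q, y)) (snd q)) p"
proof -
  obtain a b where p: "p = (a, b)" by fastforce
  obtain d where d: "0 < d" "cball a d \<times> cball b d \<subseteq> S"
    using open_Times_cball S p by metis
  define e where "e = d / 2"
  have e: "0 < e" "e < d" using d by (auto simp: e_def)
  let ?K = "cball a e \<times> cball b d"
  have K: "?K \<subseteq> S" using d e by force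
  have uc: "uniformly_continuous_on ?K G"
    using cont K by (intro compact_uniformly_continuous continuous_on_subset[OF cont])
      (auto intro: compact_Times)
  have hol: "(\<lambda>y. G (x, y)) holomorphic_on ball b d" if "x \<in> cball a e" for x
    unfolding holomorphic_on_def
    using diff K that by (meson ball_subset_cball field_differentiable_at_within mem_Sigma_iff subsetD)
  let ?D = "\<lambda>x y. deriv (\<lambda>y. G (x, y)) y"
  have contd: "isCont (?D a) b"
  proof -
    have "a \<in> cball a e" using e by simp
    from holomorphic_deriv[OF hol[OF this]]
    show ?thesis using d(1) holomorphic_on_imp_continuous_on continuous_on_interior
      by (metis centre_in_ball interior_ball open_ball)
  qed
  show ?thesis unfolding p isCont_def LIM_def
  proof (intro allI impI)
    fix r :: real assume r: "0 < r"
    \<comment> \<open>The tolerance \<open>r * e / 2\<close> becomes \<open>r / 2\<close> after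
      Cauchy's inequality divides it by \<open>e\<close>.\<close>
    obtain d1 where d1: "0 < d1" "\<And>q q'. q \<in> ?K \<Longrightarrow> q' \<in> ?K \<Longrightarrow> dist q' q < d1 \<Longrightarrow> dist (G q') (G q) < r * e / 2"
      using uc r e unfolding uniformly_continuous_on_def by (metis half_gt_zero mult_pos_pos)
    obtain d2 where d2: "0 < d2" "\<And>y. dist y b < d2 \<Longrightarrow> dist (?D a y) (?D a b) < r / 2"
      using contd r unfolding isCont_def LIM_def by (metis dist_self half_gt_zero)
    define s where "s = min e (min d1 d2)"
    show "\<exists>s>0. \<forall>x. x \<noteq> (a, b) \<and> dist x (a, b) < s \<longrightarrow>
          dist (?D (fst x) (snd x)) (?D (fst (a, b)) (snd (a, b))) < r"
    proof (intro exI conjI allI impI)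
      show "0 < s" using e d1 d2 by (simp add: s_def)
      fix x :: "complex \<times> complex" assume x: "x \<noteq> (a, b) \<and> dist x (a, b) < s"
      obtain x1 x2 where xx: "x = (x1, x2)" by fastforce
      have x1: "dist x1 a < s" and x2: "dist x2 b < s"
        using x dist_fst_le[of x "(a,b)"] dist_snd_le[of x "(a,b)"] by (auto simp: xx)
      have sub: "cball x2 e \<subseteq> ball b d"
      proof
        fix y assume "y \<in> cball x2 e"
        then have "dist x2 y \<le> e" by simp
        with x2 have "dist b y < e + e" using dist_triangle[of b y x2]
          by (simp add: dist_commute s_def)
        then show "y \<in> ball b d" by (simp add: e_def)
      qed
      have x1e: "x1 \<in> cball a e" using x1 by (simp add: s_def dist_commute)
      have "norm (?D x1 x2 - ?D a x2) \<le> (r * e / 2) / e"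
      proof (rule deriv_diff_le[OF hol hol open_ball sub])
        fix y assume "y \<in> cball x2 e"
        then have "y \<in> cball b d" using sub by auto
        moreover have "dist (x1, y) (a, y) < d1" using x1 by (simp add: dist_Pair_Pair s_def)
        ultimately show "norm (G (x1, y) - G (a, y)) \<le> r * e / 2"
          using d1(2)[of "(a, y)" "(x1, y)"] x1e e by (simp add: dist_norm)
      qed (use x1e e in auto)
      then have "dist (?D x1 x2) (?D a x2) \<le> r / 2" using e by (simp add: dist_norm)
      moreover have "dist (?D a x2) (?D a b) < r / 2" using d2 x2 by (simp add: s_def)
      ultimately show "dist (?D (fst x) (snd x)) (?D (fst (a, b)) (snd (a, b))) < r"
        unfolding xx using dist_triangle[of "?D x1 x2" "?D a b" "?D a x2"] by simp
    qed
  qed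
qed

text \<open>Total differentiability follows from the two partial derivatives and the continuity of
  one of them, which is \<open>isCont_partial_snd\<close>. The derivative is complex-linear because
  both partials are multiplications by complex numbers.\<close>

lemma osgood:
  fixes G :: "complex \<times> complex \<Rightarrow> complex"
  assumes S: "open S" "p \<in> S" and cont: "continuous_on S G"
    and diff2: "\<And>a b. (a, b) \<in> S \<Longrightarrow> (\<lambda>y. G (a, y)) field_differentiable (at b)"
    and diff1: "\<And>a b. (a, b) \<in> S \<Longrightarrow> (\<lambda>x. G (x, b)) field_differentiable (at a)"
  shows "cdiff2 G p"
proof -
  obtain a b where p: "p = (a, b)" by fastforce
  obtain e where e: "0 < e" "cball a e \<times> cball b e \<subseteq> S"
    using open_Times_cball S p by metis
  let ?A = "ball a e" and ?B = "ball b e"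
  have AB: "?A \<times> ?B \<subseteq> S" "(a, b) \<in> ?A \<times> ?B" "open (?A \<times> ?B)" using e by (auto intro: open_Times)
  define D where "D x y = deriv (\<lambda>y. G (x, y)) y" for x y
  define bl where "bl c = blinfun_mult_right (c :: complex)" for c
  have "((\<lambda>(x, y). G (x, y)) has_derivative
      (\<lambda>(tx, ty). deriv (\<lambda>x. G (x, b)) a * tx + blinfun_apply (bl (D a b)) ty))
      (at (a, b) within ?A \<times> ?B)"
  proof (rule has_derivative_partialsI[where f = "\<lambda>x y. G (x, y)" and fy = "\<lambda>x y. bl (D x y)"])
    show "((\<lambda>x. G (x, b)) has_derivative (*) (deriv (\<lambda>x. G (x, b)) a)) (at a within ?A)"
      using diff1[of a b] AB DERIV_deriv_iff_field_differentiable
      by (meson has_derivative_at_withinI has_field_derivative_def subsetD)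
    show "((\<lambda>y. G (x, y)) has_derivative blinfun_apply (bl (D x y))) (at y within ?B)"
      if "x \<in> ?A" "y \<in> ?B" for x y
    proof -
      have "((\<lambda>y. G (x, y)) has_derivative (*) (D x y)) (at y within ?B)"
        using diff2[of x y] AB that DERIV_deriv_iff_field_differentiable unfolding D_def
        by (meson has_derivative_at_withinI has_field_derivative_def mem_Sigma_iff subsetD)
      then show ?thesis by (simp add: bl_def blinfun_mult_right.rep_eq)
    qed
    have "isCont (\<lambda>q. D (fst q) (snd q)) (a, b)"
      unfolding D_def using isCont_partial_snd[OF S cont diff2] p by simp
    then have "isCont (\<lambda>q. bl (D (fst q) (snd q))) (a, b)"
      unfolding bl_def by (rule bounded_linear.isCont[OF bounded_linear_blinfun_mult_right])
    then show "continuous (at (a, b) within ?A \<times> ?B) (\<lambda>(x, y). bl (D x y))"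
      unfolding case_prod_beta by (rule continuous_at_imp_continuous_at_within)
  qed (use e in auto)
  then have "(G has_derivative (\<lambda>v. deriv (\<lambda>x. G (x, b)) a * fst v + D a b * snd v)) (at (a, b))"
    using at_within_open[OF AB(2,3)] by (simp add: case_prod_beta' bl_def blinfun_mult_right.rep_eq)
  then show ?thesis unfolding cdiff2_def p by blast
qed

section \<open>Pointwise holomorphic maps of two variables\<close>

lemma isCont_tendsto_nhds: "isCont f p \<Longrightarrow> (f \<longlongrightarrow> f p) (nhds p)"
  unfolding isCont_def tendsto_at_iff_tendsto_nhds[of f p, symmetric] .

text \<open>The condition of \<open>holomorphic2_on\<close> at a single point, so that it combines
  with \<open>eventually\<close> and is not tied to a set.\<close>

definition cholo2 :: "(complex \<times> complex \<Rightarrow> complex \<times> complex) \<Rightarrow> complex \<times> complex \<Rightarrow> bool"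
  where "cholo2 f p \<longleftrightarrow> (\<exists>f'. (f has_derivative f') (at p) \<and>
       (\<forall>c a b. f' (c * a, c * b) = (c * fst (f' (a, b)), c * snd (f' (a, b)))))"

lemma holomorphic2_on_iff: "holomorphic2_on f S \<longleftrightarrow> (\<forall>p\<in>S. cholo2 f p)"
  unfolding holomorphic2_on_def cholo2_def ..

text \<open>Complex homogeneity and real additivity make the derivative complex-linear, and the
  complex-linear forms on C^2 are \<open>\<alpha> * fst v + \<beta> * snd v\<close>.\<close>

lemma cdiff2_iff:
  "cdiff2 G p \<longleftrightarrow> (\<exists>f'. (G has_derivative f') (at p) \<and> (\<forall>c a b. f' (c * a, c * b) = c * f' (a, b)))"
proof
  assume "cdiff2 G p"
  then obtain \<alpha> \<beta> where "(G has_derivative (\<lambda>v. \<alpha> * fst v + \<beta> * snd v)) (at p)"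
    unfolding cdiff2_def by blast
  then show "\<exists>f'. (G has_derivative f') (at p) \<and> (\<forall>c a b. f' (c * a, c * b) = c * f' (a, b))"
    by (intro exI[of _ "\<lambda>v. \<alpha> * fst v + \<beta> * snd v"]) (simp add: algebra_simps)
next
  assume "\<exists>f'. (G has_derivative f') (at p) \<and> (\<forall>c a b. f' (c * a, c * b) = c * f' (a, b))"
  then obtain f' where f': "(G has_derivative f') (at p)" "\<And>c a b. f' (c * a, c * b) = c * f' (a, b)"
    by blast
  have lin: "linear f'" using f'(1) has_derivative_linear by blast
  have "f' v = f' (1, 0) * fst v + f' (0, 1) * snd v" for v
  proof -
    have "f' v = f' ((fst v * 1, fst v * 0) + (snd v * 0, snd v * 1))" by simp
    also have "\<dots> = f' (fst v * 1, fst v * 0) + f' (snd v * 0, snd v * 1)" by (rule linear_add[OF lin])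
    also have "\<dots> = f' (1, 0) * fst v + f' (0, 1) * snd v" 
      unfolding f'(2) by (simp only: mult.commute)
    finally show ?thesis .
  qed
  then have "f' = (\<lambda>v. f' (1, 0) * fst v + f' (0, 1) * snd v)" by blast
  with f'(1) show "cdiff2 G p" unfolding cdiff2_def by metis
qed

lemma cholo2_iff: "cholo2 f p \<longleftrightarrow> cdiff2 (\<lambda>q. fst (f q)) p \<and> cdiff2 (\<lambda>q. snd (f q)) p"
proof
  assume "cholo2 f p"
  then obtain f' where f': "(f has_derivative f') (at p)"
    "\<And>c a b. f' (c * a, c * b) = (c * fst (f' (a, b)), c * snd (f' (a, b)))"
    unfolding cholo2_def by blast
  then show "cdiff2 (\<lambda>q. fst (f q)) p \<and> cdiff2 (\<lambda>q. snd (f q)) p"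
    unfolding cdiff2_iff
    by (intro conjI exI[of _ "\<lambda>v. fst (f' v)"] exI[of _ "\<lambda>v. snd (f' v)"])
      (auto intro: has_derivative_fst has_derivative_snd)
next
  assume "cdiff2 (\<lambda>q. fst (f q)) p \<and> cdiff2 (\<lambda>q. snd (f q)) p"
  then obtain f1 f2 where f: "((\<lambda>q. fst (f q)) has_derivative f1) (at p)"
    "((\<lambda>q. snd (f q)) has_derivative f2) (at p)"
    "\<And>c a b. f1 (c * a, c * b) = c * f1 (a, b)" "\<And>c a b. f2 (c * a, c * b) = c * f2 (a, b)"
    unfolding cdiff2_iff by blast
  have "((\<lambda>q. (fst (f q), snd (f q))) has_derivative (\<lambda>v. (f1 v, f2 v))) (at p)"
    using f(1,2) by (rule has_derivative_Pair)
  then show "cholo2 f p" unfolding cholo2_def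
    by (intro exI[of _ "\<lambda>v. (f1 v, f2 v)"]) (simp add: f(3,4))
qed

lemma cholo2_isCont: "cholo2 f p \<Longrightarrow> isCont f p"
  unfolding cholo2_def using has_derivative_continuous by blast

lemma cdiff2_compose:
  assumes "cdiff2 G (f p)" "cholo2 f p"
  shows "cdiff2 (\<lambda>q. G (f q)) p"
proof -
  obtain g' where g': "(G has_derivative g') (at (f p))" "\<And>c a b. g' (c * a, c * b) = c * g' (a, b)"
    using assms(1) unfolding cdiff2_iff by blast
  obtain f' where f': "(f has_derivative f') (at p)"
    "\<And>c a b. f' (c * a, c * b) = (c * fst (f' (a, b)), c * snd (f' (a, b)))"
    using assms(2) unfolding cholo2_def by blast
  have "((\<lambda>q. G (f q)) has_derivative (\<lambda>v. g' (f' v))) (at p)"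
    using has_derivative_compose[OF f'(1) g'(1)] .
  then show ?thesis unfolding cdiff2_iff
    by (intro exI[of _ "\<lambda>v. g' (f' v)"]) (simp add: f'(2) g'(2))
qed

lemma cholo2_compose:
  assumes "cholo2 g (f p)" "cholo2 f p"
  shows "cholo2 (\<lambda>q. g (f q)) p"
  using assms cdiff2_compose unfolding cholo2_iff[of g] cholo2_iff[of "\<lambda>q. g (f q)"] by fast

lemma cholo2_cong:
  assumes "eventually (\<lambda>q. f q = g q) (nhds p)"
  shows "cholo2 f p \<longleftrightarrow> cholo2 g p"
proof -
  have "(f has_derivative f') (at p) \<longleftrightarrow> (g has_derivative f') (at p)" for f'
  proof -
    have "eventually (\<lambda>q. f q = g q) (at p)" "eventually (\<lambda>q. g q = f q) (at p)"
      using assms by (auto simp: eventually_at_filter elim: eventually_mono)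
    then show ?thesis
      using has_derivative_transform_eventually[of f f' p UNIV g]
        has_derivative_transform_eventually[of g f' p UNIV f] eventually_nhds_x_imp_x[OF assms] by auto
  qed
  then show ?thesis unfolding cholo2_def by simp
qed

lemma cdiff2_cong:
  assumes "eventually (\<lambda>q. f q = g q) (nhds p)"
  shows "cdiff2 f p \<longleftrightarrow> cdiff2 g p"
proof -
  have "(f has_derivative f') (at p) \<longleftrightarrow> (g has_derivative f') (at p)" for f'
  proof -
    have "eventually (\<lambda>q. f q = g q) (at p)" "eventually (\<lambda>q. g q = f q) (at p)"
      using assms by (auto simp: eventually_at_filter elim: eventually_mono)
    then show ?thesis
      using has_derivative_transform_eventually[of f f' p UNIV g]
        has_derivative_transform_eventually[of g f' p UNIV f] eventually_nhds_x_imp_x[OF assms] by auto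
  qed
  then show ?thesis unfolding cdiff2_def by simp
qed

lemma cholo2_swap: "cholo2 prod.swap p"
  unfolding cholo2_def by (intro exI[of _ prod.swap]) (auto intro!: derivative_eq_intros simp: prod.swap_def[abs_def])

lemma cdiff2_mult:
  assumes "cdiff2 F p" "cdiff2 G p"
  shows "cdiff2 (\<lambda>q. F q * G q) p"
proof -
  obtain a b c d where "(F has_derivative (\<lambda>v. a * fst v + b * snd v)) (at p)"
    "(G has_derivative (\<lambda>v. c * fst v + d * snd v)) (at p)"
    using assms unfolding cdiff2_def by blast
  from has_derivative_mult[OF this]
  show ?thesis unfolding cdiff2_iff
    by (rule_tac exI, rule_tac conjI, assumption) (simp add: algebra_simps)
qed

lemma cdiff2_divide:
  assumes "cdiff2 F p" "cdiff2 G p" "G p \<noteq> 0"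
  shows "cdiff2 (\<lambda>q. F q / G q) p"
proof -
  obtain a b c d where "(F has_derivative (\<lambda>v. a * fst v + b * snd v)) (at p)"
    "(G has_derivative (\<lambda>v. c * fst v + d * snd v)) (at p)"
    using assms unfolding cdiff2_def by blast
  from has_derivative_divide[OF this assms(3)]
  show ?thesis unfolding cdiff2_iff
    by (rule_tac exI, rule_tac conjI, assumption) (simp add: algebra_simps)
qed

lemma cdiff2_fst: "cdiff2 fst p" and cdiff2_snd: "cdiff2 snd p"
  unfolding cdiff2_iff
  by (rule exI[of _ fst], auto intro!: derivative_eq_intros)

section \<open>Continuity of partial derivatives, division by a coordinate, local inverses\<close>

lemma cdiff2_partials:
  assumes "cdiff2 G (a, b)"
  shows "(\<lambda>y. G (a, y)) field_differentiable (at b)" "(\<lambda>x. G (x, b)) field_differentiable (at a)"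
  using assms has_derivative_partial_snd has_derivative_partial_fst
  unfolding cdiff2_def field_differentiable_def by blast+

lemma cdiff2_has_derivative:
  assumes "cdiff2 G (a, b)"
  shows "(G has_derivative (\<lambda>v. deriv (\<lambda>x. G (x, b)) a * fst v + deriv (\<lambda>y. G (a, y)) b * snd v)) (at (a, b))"
  using assms has_derivative_partial_snd has_derivative_partial_fst DERIV_imp_deriv
  unfolding cdiff2_def by metis

lemma cdiff2_isCont_partial_snd:
  assumes "eventually (cdiff2 G) (nhds p)"
  shows "isCont (\<lambda>q. deriv (\<lambda>y. G (fst q, y)) (snd q)) p"
proof -
  obtain S where S: "open S" "p \<in> S" "\<And>q. q \<in> S \<Longrightarrow> cdiff2 G q"
    using assms unfolding eventually_nhds by blast
  show ?thesis
  proof (rule isCont_partial_snd[OF S(1,2)])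
    show "continuous_on S G"
      using S cdiff2_isCont by (meson continuous_at_imp_continuous_on)
  qed (use S cdiff2_partials in blast)
qed

lemma cdiff2_isCont_partial_fst:
  assumes "eventually (cdiff2 G) (nhds p)"
  shows "isCont (\<lambda>q. deriv (\<lambda>x. G (x, snd q)) (fst q)) p"
proof -
  have ts: "filterlim prod.swap (nhds (prod.swap q)) (nhds q)" for q :: "complex \<times> complex"
    using cholo2_isCont[OF cholo2_swap, of q] by (rule isCont_tendsto_nhds)
  have "eventually (\<lambda>q. cdiff2 G (prod.swap q)) (nhds (prod.swap p))"
    using ts[of "prod.swap p"] assms by (simp add: filterlim_iff)
  then have "eventually (cdiff2 (\<lambda>q. G (prod.swap q))) (nhds (prod.swap p))"
    by (rule eventually_mono) (rule cdiff2_compose[OF _ cholo2_swap])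
  from cdiff2_isCont_partial_snd[OF this]
  have "isCont (\<lambda>q. deriv (\<lambda>y. G (y, fst q)) (snd q)) (prod.swap p)" by simp
  moreover have "isCont prod.swap p" using cholo2_isCont[OF cholo2_swap] .
  ultimately show ?thesis using isCont_o2[of p prod.swap] by fastforce
qed

text \<open>On the vertical line through \<open>x\<close> the function
  \<open>G (x, t) - ?d * t\<close> vanishes at \<open>t = 0\<close> and has a derivative of modulus
  at most \<open>r / 2\<close>, so the mean value inequality bounds it by \<open>r / 2\<close> times
  the modulus of \<open>t\<close>. The limit is joint in both variables, as convergence along a
  filter requires.\<close>

lemma tendsto_divide_snd:
  assumes diff: "eventually (cdiff2 G) (nhds (a, 0))"
    and zero: "eventually (\<lambda>q. snd q = 0 \<longrightarrow> G q = 0) (nhds (a, 0))"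
  shows "((\<lambda>q. G q / snd q) \<longlongrightarrow> deriv (\<lambda>y. G (a, y)) 0) (inf (nhds (a, 0)) (principal {q. snd q \<noteq> 0}))"
proof (rule tendstoI)
  fix r :: real assume r: "0 < r"
  let ?D = "\<lambda>q. deriv (\<lambda>y. G (fst q, y)) (snd q)"
  let ?d = "deriv (\<lambda>y. G (a, y)) 0"
  have "(?D \<longlongrightarrow> ?D (a, 0)) (nhds (a, 0))"
    using isCont_tendsto_nhds[OF cdiff2_isCont_partial_snd[OF diff]] .
  then have "eventually (\<lambda>q. dist (?D q) (?D (a, 0)) < r / 2) (nhds (a, 0))"
    using r by (intro tendstoD) auto
  then have "eventually (\<lambda>q. cdiff2 G q \<and> (snd q = 0 \<longrightarrow> G q = 0) \<and> dist (?D q) ?d < r / 2) (nhds (a, 0))"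
    using diff zero by eventually_elim auto
  then obtain S where S: "open S" "(a, 0) \<in> S"
    "\<And>q. q \<in> S \<Longrightarrow> cdiff2 G q \<and> (snd q = 0 \<longrightarrow> G q = 0) \<and> dist (?D q) ?d < r / 2"
    unfolding eventually_nhds by blast
  obtain e where e: "0 < e" "cball a e \<times> cball 0 e \<subseteq> S"
    using open_Times_cball S by metis
  have key: "dist (G (x, y) / y) ?d < r" if xy: "x \<in> ball a e" "y \<in> ball 0 e" "y \<noteq> 0" for x y
  proof -
    have in_S: "(x, t) \<in> S" if "t \<in> ball 0 e" for t
      using e xy that by force
    let ?f = "\<lambda>t. G (x, t) - ?d * t"
    have "norm (?f y - ?f 0) \<le> r / 2 * norm (y - 0)"
    proof (rule field_differentiable_bound[where S = "ball 0 e" and f' = "\<lambda>t. ?D (x, t) - ?d"])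
      fix t :: complex assume t: "t \<in> ball 0 e"
      have "((\<lambda>t. G (x, t)) has_field_derivative ?D (x, t)) (at t)"
        using DERIV_deriv_iff_field_differentiable[THEN iffD2, OF cdiff2_partials(1)] S(3)[OF in_S[OF t]]
        unfolding fst_conv snd_conv by blast
      then show "(?f has_field_derivative ?D (x, t) - ?d) (at t within ball 0 e)"
        by (intro has_field_derivative_at_within[OF DERIV_diff] DERIV_cmult_Id)
      show "norm (?D (x, t) - ?d) \<le> r / 2"
        using S(3)[OF in_S[OF t]] by (simp add: dist_norm)
    qed (use e xy in auto)
    moreover have "G (x, 0) = 0" using S(3)[OF in_S[of 0]] e by simp
    ultimately have "norm (G (x, y) - ?d * y) \<le> r / 2 * norm y" by simp
    moreover have "G (x, y) / y - ?d = (G (x, y) - ?d * y) / y" using xy by (simp add: field_simps)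
    ultimately have "norm (G (x, y) / y - ?d) \<le> r / 2"
      using xy by (simp add: norm_divide field_simps)
    then show ?thesis using r by (simp add: dist_norm)
  qed
  have "eventually (\<lambda>q. q \<in> ball a e \<times> ball 0 e) (nhds (a, 0))"
    using e by (intro eventually_nhds_in_open) (auto intro: open_Times)
  then show "eventually (\<lambda>q. dist (G q / snd q) ?d < r) (inf (nhds (a, 0)) (principal {q. snd q \<noteq> 0}))"
    unfolding eventually_inf_principal
    by (rule eventually_mono) (use key in auto)
qed

text \<open>Where \<open>g\<close> is nonzero, \<open>f\<close> vanishes; that set is open, so once
  it is nonempty the identity theorem spreads the zeros over the connected set
  \<open>S\<close>.\<close>

lemma holomorphic_mult_eq_zero:
  fixes f g :: "complex \<Rightarrow> complex"
  assumes f: "f holomorphic_on S" and g: "g holomorphic_on S" and S: "open S" "connected S"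
    and 0: "\<And>x. x \<in> S \<Longrightarrow> f x * g x = 0"
  shows "(\<forall>x\<in>S. f x = 0) \<or> (\<forall>x\<in>S. g x = 0)"
proof (rule disjCI)
  assume "\<not> (\<forall>x\<in>S. g x = 0)"
  then obtain a where a: "a \<in> S" "g a \<noteq> 0" by blast
  have "open (S \<inter> g -` (- {0}))"
    using continuous_open_preimage[OF holomorphic_on_imp_continuous_on[OF g] S(1)] by blast
  then show "\<forall>x\<in>S. f x = 0"
    using analytic_continuation_open[OF _ S(1) _ S(2), of "S \<inter> g -` (- {0})" f "\<lambda>_. 0"] a 0 f
    by (auto simp: mult_eq_0_iff)
qed


text \<open>The real inverse function theorem applies because the entries of the derivative, the
  partial derivatives, are continuous; the inverse is holomorphic because the inverse of a
  complex-linear map is complex-linear.\<close>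

lemma cholo2_local_inverse:
  assumes H: "eventually (cholo2 H) (nhds p)"
    and der: "(H has_derivative H') (at p)" "\<And>v. H' v = 0 \<Longrightarrow> v = 0"
    and S: "open S" "p \<in> S"
  obtains U V K where "open U" "U \<subseteq> S" "p \<in> U" "open V" "homeomorphism U V H K"
    "\<And>q. q \<in> U \<Longrightarrow> cholo2 H q" "\<And>q. q \<in> V \<Longrightarrow> cholo2 K q"
proof -
  obtain T0 where T0: "open T0" "p \<in> T0" "\<And>q. q \<in> T0 \<Longrightarrow> cholo2 H q"
    using H unfolding eventually_nhds by blast
  define T where "T = T0 \<inter> S"
  have T: "open T" "p \<in> T" "\<And>q. q \<in> T \<Longrightarrow> cholo2 H q" "T \<subseteq> S" using T0 S by (auto simp: T_def)
  define c where "c = (\<lambda>(G :: complex \<times> complex \<Rightarrow> complex) q. deriv (\<lambda>x. G (x, snd q)) (fst q))"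
  define d where "d = (\<lambda>(G :: complex \<times> complex \<Rightarrow> complex) q. deriv (\<lambda>y. G (fst q, y)) (snd q))"
  let ?G1 = "\<lambda>q. fst (H q)" and ?G2 = "\<lambda>q. snd (H q)"
  \<comment> \<open>The derivative is assembled from its rows as a bounded linear map, since the
    inverse function theorem asks for continuous dependence on the point in operator norm.\<close>
  define row where "row = (\<lambda>G q. (blinfun_mult_right (c G q) o\<^sub>L fst_blinfun) + (blinfun_mult_right (d G q) o\<^sub>L snd_blinfun))"
  define inl :: "complex \<Rightarrow>\<^sub>L (complex \<times> complex)" where "inl = Blinfun (\<lambda>x. (x, 0))"
  define inr :: "complex \<Rightarrow>\<^sub>L (complex \<times> complex)" where "inr = Blinfun (\<lambda>x. (0, x))"
  have inl: "blinfun_apply inl x = (x, 0)" and inr: "blinfun_apply inr x = (0, x)" for x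
    unfolding inl_def inr_def
    by (subst bounded_linear_Blinfun_apply; simp add: bounded_linear_Pair bounded_linear_ident bounded_linear_zero)+
  define f' where "f' = (\<lambda>q. (inl o\<^sub>L row ?G1 q) + (inr o\<^sub>L row ?G2 q))"
  have f': "blinfun_apply (f' q) v =
      (c ?G1 q * fst v + d ?G1 q * snd v, c ?G2 q * fst v + d ?G2 q * snd v)" for q v
    by (simp add: f'_def row_def inl inr plus_blinfun.rep_eq)
  have comp: "cdiff2 ?G1 q" "cdiff2 ?G2 q" if "q \<in> T" for q
    using T(3)[OF that] unfolding cholo2_iff by auto
  have derf: "(H has_derivative blinfun_apply (f' q)) (at q)" if "q \<in> T" for q
  proof -
    have "(?G1 has_derivative (\<lambda>v. c ?G1 q * fst v + d ?G1 q * snd v)) (at q)"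
      "(?G2 has_derivative (\<lambda>v. c ?G2 q * fst v + d ?G2 q * snd v)) (at q)"
      using cdiff2_has_derivative[of ?G1 "fst q" "snd q"] cdiff2_has_derivative[of ?G2 "fst q" "snd q"]
        comp[OF that] by (simp_all add: c_def d_def)
    from has_derivative_Pair[OF this] show ?thesis by (simp add: f'[abs_def])
  qed
  have evT: "eventually (cdiff2 ?G1) (nhds q)" "eventually (cdiff2 ?G2) (nhds q)" if "q \<in> T" for q
    using eventually_nhds_in_open[OF T(1) that] comp by (auto elim: eventually_mono)
  have cont: "continuous_on T (c ?G1)" "continuous_on T (d ?G1)" "continuous_on T (c ?G2)" "continuous_on T (d ?G2)"
    unfolding c_def d_def
    by (rule continuous_at_imp_continuous_on, intro ballI,
        rule cdiff2_isCont_partial_fst cdiff2_isCont_partial_snd, erule evT)+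
  have bl: "continuous_on T (\<lambda>q. blinfun_mult_right (u q))" if "continuous_on T u" for u :: "complex \<times> complex \<Rightarrow> complex"
    by (rule bounded_linear.continuous_on[OF bounded_linear_blinfun_mult_right that])
  have contf: "continuous_on T f'"
    unfolding f'_def row_def
    by (intro continuous_on_add bounded_bilinear.continuous_on[OF bounded_bilinear_blinfun_compose]
        continuous_on_const bl cont)
  have eqp: "blinfun_apply (f' p) = H'"
    using has_derivative_unique[OF derf[OF T(2)] der(1)] .
  have lin: "linear H'" using der(1) has_derivative_linear by blast
  have "inj H'" using lin der(2) linear_injective_0 by blast
  then obtain g0 where g0: "linear g0" "g0 \<circ> H' = id"
    using linear_injective_left_inverse[OF lin] by blast
  have invf: "Blinfun g0 o\<^sub>L f' p = id_blinfun"
  proof (rule blinfun_eqI)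
    fix v
    have "bounded_linear g0" using g0(1) by (simp add: linear_conv_bounded_linear)
    moreover have "g0 (H' v) = v" using g0(2) by (metis comp_apply id_apply)
    ultimately show "blinfun_apply (Blinfun g0 o\<^sub>L f' p) v = blinfun_apply id_blinfun v"
      by (simp add: bounded_linear_Blinfun_apply eqp)
  qed
  obtain U V g g' where U: "open U" "U \<subseteq> T" "p \<in> U" and V: "open V" "H p \<in> V" and hom: "homeomorphism U V H g"
    and g: "\<And>y. y \<in> V \<Longrightarrow> (g has_derivative (g' y)) (at y)"
      "\<And>y. y \<in> V \<Longrightarrow> g' y = inv (blinfun_apply (f' (g y)))"
      "\<And>y. y \<in> V \<Longrightarrow> bij (blinfun_apply (f' (g y)))"
  proof (rule inverse_function_theorem[OF T(1) derf contf T(2) invf])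
    fix U V g g'
    assume "open U" "U \<subseteq> T" "p \<in> U" "open V" "H p \<in> V" "homeomorphism U V H g"
      "\<And>y. y \<in> V \<Longrightarrow> (g has_derivative (g' y)) (at y)"
      "\<And>y. y \<in> V \<Longrightarrow> g' y = inv (blinfun_apply (f' (g y)))"
      "\<And>y. y \<in> V \<Longrightarrow> bij (blinfun_apply (f' (g y)))"
    then show thesis by (rule that)
  qed
  have "cholo2 g y" if y: "y \<in> V" for y
    unfolding cholo2_def
  proof (intro exI[of _ "g' y"] conjI g(1)[OF y] allI)
    fix k a b
    let ?A = "blinfun_apply (f' (g y))"
    have A: "?A (g' y v) = v" for v
      using g(2,3)[OF y] by (simp add: bij_is_surj surj_f_inv_f)
    have "?A (k * fst (g' y (a, b)), k * snd (g' y (a, b))) = (k * fst (?A (g' y (a, b))), k * snd (?A (g' y (a, b))))"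
      by (simp add: f' algebra_simps)
    also have "\<dots> = ?A (g' y (k * a, k * b))" by (simp add: A)
    finally show "g' y (k * a, k * b) = (k * fst (g' y (a, b)), k * snd (g' y (a, b)))"
      using g(3)[OF y] by (metis bij_is_inj injD)
  qed
  then show thesis using that[OF U(1) _ U(3) V(1) hom] U(2) T by blast
qed

section \<open>Charts\<close>

lemma eventually_nhdsin_openin: "openin X S \<Longrightarrow> x \<in> S \<Longrightarrow> eventually (\<lambda>y. y \<in> S) (nhdsin X x)"
  unfolding eventually_nhdsin by blast


text \<open>Homeomorphy of a chart as two convergence statements at each point. In this form a chart
  and its inverse compose directly with the limits along filters by which boundary points are
  handled.\<close>

lemma chart_of_iff:
  "chart_of X c \<longleftrightarrow> openin X (fst c) \<and> open (snd c ` fst c) \<and> inj_on (snd c) (fst c) \<and>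
    (\<forall>x\<in>fst c. filterlim (snd c) (nhds (snd c x)) (nhdsin X x) \<and>
      filterlim (inv_into (fst c) (snd c)) (nhdsin X x) (nhds (snd c x)))"
proof -
  obtain U \<phi> where c: "c = (U, \<phi>)" by fastforce
  show ?thesis
  proof
    assume "chart_of X c"
    then have U: "openin X U" "open (\<phi> ` U)" and hom: "homeomorphic_map (subtopology X U) (top_of_set (\<phi> ` U)) \<phi>"
      by (auto simp: c)
    have top: "topspace (subtopology X U) = U" using openin_subset[OF U(1)] by (rule topspace_subtopology_subset)
    have inj: "inj_on \<phi> U" using homeomorphic_imp_injective_map[OF hom] top by simp
    have "filterlim \<phi> (nhds (\<phi> x)) (nhdsin X x)" if x: "x \<in> U" for x
      unfolding filterlim_iff
    proof (intro allI impI)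
      fix P assume "eventually P (nhds (\<phi> x))"
      then obtain T where T: "open T" "\<phi> x \<in> T" "\<forall>y\<in>T. P y" unfolding eventually_nhds by blast
      have "openin (top_of_set (\<phi> ` U)) (\<phi> ` U \<inter> T)" using T(1) by blast
      then have "openin (subtopology X U) {y \<in> U. \<phi> y \<in> \<phi> ` U \<inter> T}"
        using homeomorphic_imp_continuous_map[OF hom] top openin_continuous_map_preimage by fastforce
      then have "openin X {y \<in> U. \<phi> y \<in> \<phi> ` U \<inter> T}" using U(1) by (simp add: openin_open_subtopology)
      then have "eventually (\<lambda>y. y \<in> {y \<in> U. \<phi> y \<in> \<phi> ` U \<inter> T}) (nhdsin X x)"
        using T(2) x by (intro eventually_nhdsin_openin) auto
      then show "eventually (\<lambda>y. P (\<phi> y)) (nhdsin X x)"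
        by (rule eventually_mono) (use T(3) in blast)
    qed
    moreover have "filterlim (inv_into U \<phi>) (nhdsin X x) (nhds (\<phi> x))" if x: "x \<in> U" for x
      unfolding filterlim_iff
    proof (intro allI impI)
      fix P assume "eventually P (nhdsin X x)"
      then obtain S where S: "openin X S" "x \<in> S" "\<forall>y\<in>S. P y"
        unfolding eventually_nhdsin using x U(1) openin_subset by blast
      have "openin (subtopology X U) (S \<inter> U)" using S(1) openin_subtopology by blast
      then have "openin (top_of_set (\<phi> ` U)) (\<phi> ` (S \<inter> U))"
        using homeomorphic_imp_open_map[OF hom] unfolding open_map_def by blast
      then have "open (\<phi> ` (S \<inter> U))" using U(2) openin_open_trans by blast
      then have "eventually (\<lambda>q. q \<in> \<phi> ` (S \<inter> U)) (nhds (\<phi> x))"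
        using x S(2) by (intro eventually_nhds_in_open) auto
      then show "eventually (\<lambda>q. P (inv_into U \<phi> q)) (nhds (\<phi> x))"
        by (rule eventually_mono) (use S(3) inj in auto)
    qed
    ultimately show "openin X (fst c) \<and> open (snd c ` fst c) \<and> inj_on (snd c) (fst c) \<and>
      (\<forall>x\<in>fst c. filterlim (snd c) (nhds (snd c x)) (nhdsin X x) \<and>
        filterlim (inv_into (fst c) (snd c)) (nhdsin X x) (nhds (snd c x)))"
      using U inj by (simp add: c)
  next
    assume "openin X (fst c) \<and> open (snd c ` fst c) \<and> inj_on (snd c) (fst c) \<and>
      (\<forall>x\<in>fst c. filterlim (snd c) (nhds (snd c x)) (nhdsin X x) \<and>
        filterlim (inv_into (fst c) (snd c)) (nhdsin X x) (nhds (snd c x)))"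
    then have U: "openin X U" "open (\<phi> ` U)" and inj: "inj_on \<phi> U"
      and lim: "\<And>x. x \<in> U \<Longrightarrow> filterlim \<phi> (nhds (\<phi> x)) (nhdsin X x)"
        "\<And>x. x \<in> U \<Longrightarrow> filterlim (inv_into U \<phi>) (nhdsin X x) (nhds (\<phi> x))"
      by (auto simp: c)
    have top: "topspace (subtopology X U) = U" using openin_subset[OF U(1)] by (rule topspace_subtopology_subset)
    have topX: "U \<subseteq> topspace X" using U(1) openin_subset by blast
    have "continuous_map (subtopology X U) (top_of_set (\<phi> ` U)) \<phi>"
      unfolding continuous_map_def top
    proof (intro conjI allI impI)
      fix T assume "openin (top_of_set (\<phi> ` U)) T"
      then have T: "open T" using U(2) openin_open_trans by blast
      have "\<exists>S. openin X S \<and> x \<in> S \<and> S \<subseteq> {y \<in> U. \<phi> y \<in> T}" if x: "x \<in> U" "\<phi> x \<in> T" for x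
      proof -
        have "eventually (\<lambda>y. \<phi> y \<in> T) (nhdsin X x)"
          using lim(1)[OF x(1)] eventually_nhds_in_open[OF T x(2)] unfolding filterlim_iff by blast
        then obtain S where "openin X S" "x \<in> S" "\<forall>y\<in>S. \<phi> y \<in> T"
          unfolding eventually_nhdsin using x topX by blast
        then show ?thesis using x U(1) by (intro exI[of _ "S \<inter> U"]) auto
      qed
      then have "openin X {y \<in> U. \<phi> y \<in> T}" by (subst openin_subopen) auto
      then show "openin (subtopology X U) {y \<in> U. \<phi> y \<in> T}" using U(1) by (simp add: openin_open_subtopology)
    qed (auto simp: top)
    moreover have "open_map (subtopology X U) (top_of_set (\<phi> ` U)) \<phi>"
      unfolding open_map_def
    proof (intro allI impI)
      fix S assume "openin (subtopology X U) S"
      then have S: "openin X S" "S \<subseteq> U" using U(1) by (simp_all add: openin_open_subtopology)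
      have "open (\<phi> ` S)"
        unfolding open_subopen[of "\<phi> ` S"]
      proof
        fix q assume "q \<in> \<phi> ` S"
        then obtain x where x: "x \<in> S" "q = \<phi> x" by blast
        have "eventually (\<lambda>y. y \<in> S) (nhdsin X x)" unfolding eventually_nhdsin using S(1) x by blast
        then have "eventually (\<lambda>q. inv_into U \<phi> q \<in> S) (nhds (\<phi> x))"
          using lim(2) x S(2) unfolding filterlim_iff by blast
        then obtain T where T: "open T" "\<phi> x \<in> T" "\<forall>q\<in>T. inv_into U \<phi> q \<in> S"
          unfolding eventually_nhds by blast
        have "T \<inter> \<phi> ` U \<subseteq> \<phi> ` S"
        proof
          fix q assume q: "q \<in> T \<inter> \<phi> ` U"
          then have "\<phi> (inv_into U \<phi> q) = q" by (simp add: f_inv_into_f)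
          moreover have "inv_into U \<phi> q \<in> S" using q T(3) by blast
          ultimately show "q \<in> \<phi> ` S" by (metis imageI)
        qed
        then show "\<exists>T. open T \<and> q \<in> T \<and> T \<subseteq> \<phi> ` S"
          using T U(2) x S(2) by (intro exI[of _ "T \<inter> \<phi> ` U"]) auto
      qed
      then show "openin (top_of_set (\<phi> ` U)) (\<phi> ` S)" using S(2) by (intro open_subset) auto
    qed
    ultimately have "homeomorphic_map (subtopology X U) (top_of_set (\<phi> ` U)) \<phi>"
      by (intro bijective_open_imp_homeomorphic_map) (use inj top in auto)
    then show "chart_of X c" using U by (simp add: c)
  qed
qed

text \<open>Compatibility of two charts at one point. Being pointwise, the relation is transitive
  without any bookkeeping of the domains on which three charts meet.\<close>

definition tr :: "'a chart \<Rightarrow> 'a chart \<Rightarrow> 'a \<Rightarrow> bool"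
  where "tr c d x \<longleftrightarrow> cholo2 (\<lambda>q. snd d (inv_into (fst c) (snd c) q)) (snd c x)"

lemma holomorphic_transition_iff:
  "holomorphic_transition c d \<longleftrightarrow> (\<forall>x\<in>fst c \<inter> fst d. tr c d x)"
  by (cases c; cases d) (auto simp: holomorphic2_on_iff tr_def comp_def)

lemma hol_chart_iff:
  "hol_chart X A c \<longleftrightarrow> chart_of X c \<and> (\<forall>d\<in>A. \<forall>x\<in>fst c \<inter> fst d. tr c d x \<and> tr d c x)"
  unfolding hol_chart_def holomorphic_transition_iff by blast

lemma chart_ofD:
  assumes "chart_of X c"
  shows "openin X (fst c)" "open (snd c ` fst c)" "inj_on (snd c) (fst c)"
    "\<And>x. x \<in> fst c \<Longrightarrow> filterlim (snd c) (nhds (snd c x)) (nhdsin X x)"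
    "\<And>x. x \<in> fst c \<Longrightarrow> filterlim (inv_into (fst c) (snd c)) (nhdsin X x) (nhds (snd c x))"
    "\<And>x. x \<in> fst c \<Longrightarrow> x \<in> topspace X"
    "\<And>x. x \<in> fst c \<Longrightarrow> inv_into (fst c) (snd c) (snd c x) = x"
  using assms unfolding chart_of_iff by (auto dest: openin_subset)

lemma chart_inv_eventually:
  assumes "chart_of X c" "x \<in> fst c" "eventually P (nhdsin X x)"
  shows "eventually (\<lambda>q. P (inv_into (fst c) (snd c) q)) (nhds (snd c x))"
  using chart_ofD(5)[OF assms(1,2)] assms(3) unfolding filterlim_iff by blast

lemma tr_trans:
  assumes c: "chart_of X c" and d: "chart_of X d" and e: "chart_of X e"
    and x: "x \<in> fst c" "x \<in> fst d" "x \<in> fst e" and "tr c d x" "tr d e x"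
  shows "tr c e x"
proof -
  let ?ic = "inv_into (fst c) (snd c)" and ?id = "inv_into (fst d) (snd d)"
  have "eventually (\<lambda>y. y \<in> fst d) (nhdsin X x)"
    using chart_ofD(1)[OF d] x by (intro eventually_nhdsin_openin)
  then have "eventually (\<lambda>q. ?ic q \<in> fst d) (nhds (snd c x))"
    using chart_inv_eventually[OF c] x by blast
  then have "eventually (\<lambda>q. snd e (?id (snd d (?ic q))) = snd e (?ic q)) (nhds (snd c x))"
    by (rule eventually_mono) (simp add: chart_ofD(7)[OF d])
  moreover have "cholo2 (\<lambda>q. snd e (?id (snd d (?ic q)))) (snd c x)"
    using cholo2_compose[of "\<lambda>q. snd e (?id q)" "\<lambda>q. snd d (?ic q)" "snd c x"] assms(7,8)
    unfolding tr_def by (simp add: chart_ofD(7)[OF c] x)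
  ultimately show ?thesis unfolding tr_def
    by (subst cholo2_cong[symmetric, where f = "\<lambda>q. snd e (?id (snd d (?ic q)))"])
qed

lemma hol_chart_chart_of: "hol_chart X A c \<Longrightarrow> chart_of X c"
  unfolding hol_chart_def by blast

section \<open>Charts of the maximal atlas\<close>

locale cx_surface =
  fixes X :: "'a topology" and A :: "'a chart set"
  assumes surface: "complex_surface X A"
begin

lemma Hausdorff: "Hausdorff_space X"
  using surface unfolding complex_surface_def by blast

lemma atlas_chart:
  assumes "x \<in> topspace X"
  obtains a where "a \<in> A" "x \<in> fst a" "chart_of X a"
  using surface assms unfolding complex_surface_def by blast

lemma atlas_hol_chart: "a \<in> A \<Longrightarrow> hol_chart X A a"
  using surface unfolding complex_surface_def hol_chart_def by blast

lemma hol_chart_tr: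
  assumes "hol_chart X A c" "hol_chart X A d" "x \<in> fst c" "x \<in> fst d"
  shows "tr c d x"
proof -
  have "x \<in> topspace X" using chart_ofD(6)[OF hol_chart_chart_of[OF assms(1)] assms(3)] .
  then obtain a where a: "a \<in> A" "x \<in> fst a" "chart_of X a" using atlas_chart by blast
  have "tr c a x" "tr a d x" using assms a unfolding hol_chart_iff by auto
  then show ?thesis using tr_trans[of X c a d x] assms a hol_chart_chart_of by blast
qed

text \<open>Compatibility with the atlas is checked at each point and \<open>tr\<close> is
  transitive, so one compatible chart of the maximal atlas near each point suffices.\<close>

lemma hol_chartI:
  assumes c: "chart_of X c"
    and near: "\<And>x. x \<in> fst c \<Longrightarrow> \<exists>d. hol_chart X A d \<and> x \<in> fst d \<and> tr c d x \<and> tr d c x"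
  shows "hol_chart X A c"
  unfolding hol_chart_iff
proof (intro conjI ballI c)
  fix a x assume a: "a \<in> A" and x: "x \<in> fst c \<inter> fst a"
  obtain d where d: "hol_chart X A d" "x \<in> fst d" "tr c d x" "tr d c x" using near x by blast
  have "tr d a x" "tr a d x" using d(1,2) a x unfolding hol_chart_iff by auto
  then show "tr c a x" "tr a c x"
    using tr_trans[of X c d a x] tr_trans[of X a d c x] c d x atlas_hol_chart[OF a] hol_chart_chart_of by blast+
qed

lemma hol_chart_restrict:
  assumes c: "hol_chart X A c" and S: "openin X S"
  shows "hol_chart X A (fst c \<inter> S, snd c)"
proof -
  let ?c = "(fst c \<inter> S, snd c)"
  note ch = chart_ofD[OF hol_chart_chart_of[OF c]]
  have inv: "inv_into (fst c \<inter> S) (snd c) q = inv_into (fst c) (snd c) q" if "q \<in> snd c ` (fst c \<inter> S)" for q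
    using that ch(3) by (auto simp: inj_on_Int)
  have op: "open (snd c ` (fst c \<inter> S))"
    unfolding open_subopen[of "snd c ` (fst c \<inter> S)"]
  proof
    fix q assume "q \<in> snd c ` (fst c \<inter> S)"
    then obtain x where x: "x \<in> fst c" "x \<in> S" "q = snd c x" by blast
    have "eventually (\<lambda>q. inv_into (fst c) (snd c) q \<in> S) (nhds (snd c x))"
      using chart_inv_eventually[OF hol_chart_chart_of[OF c] x(1)] eventually_nhdsin_openin[OF S x(2)] by blast
    then obtain T where T: "open T" "snd c x \<in> T" "\<forall>q\<in>T. inv_into (fst c) (snd c) q \<in> S"
      unfolding eventually_nhds by blast
    have "T \<inter> snd c ` fst c \<subseteq> snd c ` (fst c \<inter> S)"
      using T(3) ch(7) by force
    then show "\<exists>T. open T \<and> q \<in> T \<and> T \<subseteq> snd c ` (fst c \<inter> S)"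
      using T ch(2) x by (intro exI[of _ "T \<inter> snd c ` fst c"]) auto
  qed
  have ev: "eventually (\<lambda>q. inv_into (fst c) (snd c) q = inv_into (fst c \<inter> S) (snd c) q) (nhds (snd c x))"
    if "x \<in> fst c \<inter> S" for x
    by (rule eventually_mono[OF eventually_nhds_in_open[OF op imageI[OF that]]]) (simp only: inv)
  have chc: "chart_of X ?c"
    unfolding chart_of_iff
  proof (intro conjI ballI)
    show "filterlim (inv_into (fst ?c) (snd ?c)) (nhdsin X x) (nhds (snd ?c x))" if "x \<in> fst ?c" for x
      using filterlim_cong[THEN iffD1, OF refl refl ev ch(5)] that by simp
  qed (use ch S op in \<open>auto simp: inj_on_Int\<close>)
  show ?thesis
  proof (rule hol_chartI[OF chc])
    fix x assume x: "x \<in> fst ?c"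
    have "tr c c x" using hol_chart_tr[OF c c] x by simp
    moreover have "eventually (\<lambda>q. snd c (inv_into (fst c) (snd c) q) = snd c (inv_into (fst c \<inter> S) (snd c) q)) (nhds (snd c x))"
      by (rule eventually_mono[OF ev]) (use x in auto)
    ultimately have "tr ?c c x" unfolding tr_def using cholo2_cong by simp
    moreover have "tr c ?c x" using \<open>tr c c x\<close> unfolding tr_def by simp
    ultimately show "\<exists>d. hol_chart X A d \<and> x \<in> fst d \<and> tr ?c d x \<and> tr d ?c x"
      using c x by (intro exI[of _ c]) simp
  qed
qed

lemma hol_chart_compose:
  assumes c: "hol_chart X A c"
    and hom: "homeomorphism (snd c ` fst c) V H K" and V: "open V"
    and H: "\<And>q. q \<in> snd c ` fst c \<Longrightarrow> cholo2 H q" and K: "\<And>q. q \<in> V \<Longrightarrow> cholo2 K q"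
  shows "hol_chart X A (fst c, \<lambda>x. H (snd c x))"
proof -
  let ?c = "(fst c, \<lambda>x. H (snd c x))"
  note ch = chart_ofD[OF hol_chart_chart_of[OF c]]
  have KH: "\<And>q. q \<in> snd c ` fst c \<Longrightarrow> K (H q) = q" and HK: "\<And>q. q \<in> V \<Longrightarrow> H (K q) = q"
    and HV: "H ` (snd c ` fst c) = V" and KV: "K ` V = snd c ` fst c"
    using hom unfolding homeomorphism_def by auto
  have inj: "inj_on (\<lambda>x. H (snd c x)) (fst c)"
  proof (rule inj_onI)
    fix x y assume xy: "x \<in> fst c" "y \<in> fst c" "H (snd c x) = H (snd c y)"
    then have "K (H (snd c x)) = K (H (snd c y))" by simp
    then have "snd c x = snd c y" using KH[OF imageI[OF xy(1)]] KH[OF imageI[OF xy(2)]] by simp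
    then show "x = y" using xy ch(3) by (simp add: inj_on_eq_iff)
  qed
  have inv: "inv_into (fst c) (\<lambda>x. H (snd c x)) q = inv_into (fst c) (snd c) (K q)" if "q \<in> V" for q
  proof -
    have "q \<in> H ` snd c ` fst c" using HV that by simp
    then obtain x where x: "x \<in> fst c" "q = H (snd c x)" by blast
    then show ?thesis using inv_into_f_f[OF inj x(1)] ch(7)[OF x(1)] KH by simp
  qed
  have evV: "eventually (\<lambda>q. q \<in> V) (nhds (H (snd c x)))" if "x \<in> fst c" for x
    using eventually_nhds_in_open[OF V] HV that by blast
  have ev: "eventually (\<lambda>q. inv_into (fst c) (snd c) (K q) = inv_into (fst c) (\<lambda>x. H (snd c x)) q) (nhds (H (snd c x)))"
    if "x \<in> fst c" for x
    using evV[OF that] by (rule eventually_mono) (simp add: inv)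
  have limH: "filterlim H (nhds (H (snd c x))) (nhds (snd c x))" if "x \<in> fst c" for x
    using isCont_tendsto_nhds[OF cholo2_isCont[OF H]] that by blast
  have limK: "filterlim K (nhds (snd c x)) (nhds (H (snd c x)))" if "x \<in> fst c" for x
  proof -
    have "H (snd c x) \<in> V" using HV that by auto
    from isCont_tendsto_nhds[OF cholo2_isCont[OF K[OF this]]] show ?thesis
      using KH[OF imageI[OF that]] by simp
  qed
  have chc: "chart_of X ?c"
    unfolding chart_of_iff
  proof (intro conjI ballI)
    fix x assume x: "x \<in> fst ?c"
    show "filterlim (snd ?c) (nhds (snd ?c x)) (nhdsin X x)"
      using filterlim_compose[OF limH ch(4)] x by simp
    show "filterlim (inv_into (fst ?c) (snd ?c)) (nhdsin X x) (nhds (snd ?c x))"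
      using filterlim_cong[THEN iffD1, OF refl refl ev filterlim_compose[OF ch(5) limK]] x by simp
  next
    have "snd ?c ` fst ?c = V" using HV by (simp add: image_image)
    then show "open (snd ?c ` fst ?c)" using V by simp
  qed (use ch(1) inj in simp_all)
  show ?thesis
  proof (rule hol_chartI[OF chc])
    fix x assume "x \<in> fst ?c"
    then have x: "x \<in> fst c" by simp
    have "eventually (\<lambda>q. q \<in> snd c ` fst c) (nhds (snd c x))"
      using eventually_nhds_in_open[OF ch(2)] x by blast
    then have e1: "eventually (\<lambda>q. H q = H (snd c (inv_into (fst c) (snd c) q))) (nhds (snd c x))"
      by (rule eventually_mono) (simp add: f_inv_into_f)
    have "tr c ?c x" unfolding tr_def
      using cholo2_cong[OF e1] H x by simp
    moreover have "eventually (\<lambda>q. K q = snd c (inv_into (fst c) (\<lambda>x. H (snd c x)) q)) (nhds (H (snd c x)))"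
    proof (rule eventually_mono[OF evV[OF x]])
      fix q assume q: "q \<in> V"
      then have "K q \<in> snd c ` fst c" using KV by blast
      then show "K q = snd c (inv_into (fst c) (\<lambda>x. H (snd c x)) q)"
        unfolding inv[OF q] by (simp add: f_inv_into_f)
    qed
    then have "tr ?c c x" unfolding tr_def
      using cholo2_cong[of K "\<lambda>q. snd c (inv_into (fst c) (\<lambda>x. H (snd c x)) q)" "H (snd c x)"] K[of "H (snd c x)"]
        x HV by auto
    ultimately show "\<exists>d. hol_chart X A d \<and> x \<in> fst d \<and> tr ?c d x \<and> tr d ?c x"
      using c x by (intro exI[of _ c]) simp
  qed
qed

lemma hol_chart_swap:
  assumes c: "hol_chart X A c"
  shows "hol_chart X A (fst c, \<lambda>x. prod.swap (snd c x))"
proof -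
  have cont: "continuous_on S prod.swap" for S :: "(complex \<times> complex) set"
    using cholo2_isCont[OF cholo2_swap] continuous_at_imp_continuous_on by blast
  have im: "prod.swap ` S = prod.swap -` S" for S :: "(complex \<times> complex) set"
  proof (intro equalityI subsetI)
    fix q assume "q \<in> prod.swap -` S"
    then have "prod.swap (prod.swap q) \<in> prod.swap ` S" by blast
    then show "q \<in> prod.swap ` S" by simp
  qed auto
  have vv: "prod.swap -` (prod.swap -` S) = S" for S :: "(complex \<times> complex) set" by auto
  have hom: "homeomorphism (snd c ` fst c) (prod.swap -` (snd c ` fst c)) prod.swap prod.swap"
    unfolding homeomorphism_def by (intro conjI ballI cont) (simp_all only: im vv swap_swap)
  have op: "open (prod.swap -` (snd c ` fst c))"
    using chart_ofD(2)[OF hol_chart_chart_of[OF c]] cont[of UNIV] by (simp add: open_vimage)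
  show ?thesis using hol_chart_compose[OF c hom op cholo2_swap cholo2_swap] .
qed

text \<open>The source of new charts: by the inverse function theorem, a holomorphic change of
  coordinates with injective derivative is a chart after the domain is shrunk.\<close>

lemma hol_chart_local_inverse:
  assumes c: "hol_chart X A c" and x: "x \<in> fst c"
    and H: "eventually (cholo2 H) (nhds (snd c x))"
    and der: "(H has_derivative H') (at (snd c x))" "\<And>v. H' v = 0 \<Longrightarrow> v = 0"
    and N: "openin X N" "x \<in> N"
  obtains S where "openin X S" "x \<in> S" "S \<subseteq> fst c \<inter> N" "hol_chart X A (S, \<lambda>x. H (snd c x))"
proof -
  let ?c0 = "(fst c \<inter> N, snd c)"
  have c0: "hol_chart X A ?c0" using hol_chart_restrict[OF c N(1)] .
  note ch0 = chart_ofD[OF hol_chart_chart_of[OF c0]]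
  obtain U V K where U: "open U" "U \<subseteq> snd c ` (fst c \<inter> N)" "snd c x \<in> U" "open V" "homeomorphism U V H K"
    "\<And>q. q \<in> U \<Longrightarrow> cholo2 H q" "\<And>q. q \<in> V \<Longrightarrow> cholo2 K q"
    using cholo2_local_inverse[OF H der, of "snd c ` (fst c \<inter> N)"] ch0(2) x N(2) by auto
  define S where "S = {y \<in> fst c \<inter> N. snd c y \<in> U}"
  have "openin X S"
  proof (subst openin_subopen, intro ballI)
    fix y assume y: "y \<in> S"
    have "eventually (\<lambda>y. snd c y \<in> U) (nhdsin X y)"
      using ch0(4)[of y] eventually_nhds_in_open[OF U(1), of "snd c y"] y unfolding S_def filterlim_iff by auto
    then obtain T where "openin X T" "y \<in> T" "\<forall>y\<in>T. snd c y \<in> U"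
      unfolding eventually_nhdsin using y ch0(6) unfolding S_def by auto
    then show "\<exists>T. openin X T \<and> y \<in> T \<and> T \<subseteq> S"
      using ch0(1) y by (intro exI[of _ "T \<inter> (fst c \<inter> N)"]) (auto simp: S_def)
  qed
  moreover have "x \<in> S" using x N U(3) by (simp add: S_def)
  moreover have S: "S \<subseteq> fst c \<inter> N" by (auto simp: S_def)
  moreover have "hol_chart X A (S, \<lambda>x. H (snd c x))"
  proof -
    have "hol_chart X A (fst c \<inter> S, snd c)" by (rule hol_chart_restrict[OF c]) fact
    then have cS: "hol_chart X A (S, snd c)" using S by (simp add: inf.absorb2)
    have "snd c ` S = U" using U(2) unfolding S_def by auto
    then show ?thesis using hol_chart_compose[OF cS _ U(4), of H K] U by simp
  qed
  ultimately show thesis using that by blast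
qed

end

section \<open>Adapted charts\<close>

lemma chart_eventually:
  assumes "chart_of X c" "x \<in> fst c" "eventually P (nhds (snd c x))"
  shows "eventually (\<lambda>y. P (snd c y)) (nhdsin X x)"
  using chart_ofD(4)[OF assms(1,2)] assms(3) unfolding filterlim_iff by blast

lemma chart_inv_in:
  assumes "chart_of X c" "x \<in> fst c"
  shows "eventually (\<lambda>q. inv_into (fst c) (snd c) q \<in> fst c \<and> snd c (inv_into (fst c) (snd c) q) = q) (nhds (snd c x))"
proof (rule eventually_mono)
  show "eventually (\<lambda>q. q \<in> snd c ` fst c) (nhds (snd c x))"
    using eventually_nhds_in_open[OF chart_ofD(2)[OF assms(1)]] assms(2) by blast
qed (simp add: f_inv_into_f inv_into_into)

lemma eventually_nhds_Pair_fst: "eventually P (nhds (a, b)) \<Longrightarrow> eventually (\<lambda>x. P (x, b)) (nhds a)"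
  using filterlim_iff[of "\<lambda>x. (x, b)" "nhds (a, b)" "nhds a"] tendsto_Pair[OF filterlim_ident tendsto_const, of b a]
  by (auto simp: filterlim_def)

lemma eventually_nhds_Pair_snd: "eventually P (nhds (a, b)) \<Longrightarrow> eventually (\<lambda>y. P (a, y)) (nhds b)"
  using filterlim_iff[of "\<lambda>y. (a, y)" "nhds (a, b)" "nhds b"] tendsto_Pair[OF tendsto_const filterlim_ident, of a b]
  by (auto simp: filterlim_def)

lemma has_field_derivative_eventually_0:
  assumes "(g has_field_derivative D) (at a)" "eventually (\<lambda>x. g x = 0) (nhds a)"
  shows "D = 0"
proof -
  have "((\<lambda>x. 0) has_field_derivative D) (at a)"
    using DERIV_cong_ev[OF refl assms(2) refl] assms(1) by simp
  then show ?thesis using DERIV_unique DERIV_const by blast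
qed

section \<open>Local equations of the branches of the divisor\<close>

context cx_surface
begin

text \<open>Functions that serve as a coordinate near \<open>x\<close>, such as the local equations
  of the branches of \<open>D\<close>. The second coordinate stands for both, since charts can be
  swapped.\<close>

definition coord :: "'a \<Rightarrow> ('a \<Rightarrow> complex) \<Rightarrow> bool"
  where "coord x f \<longleftrightarrow> (\<exists>c. hol_chart X A c \<and> x \<in> fst c \<and> f = (\<lambda>y. snd (snd c y)))"

lemma coord_snd: "hol_chart X A c \<Longrightarrow> x \<in> fst c \<Longrightarrow> coord x (\<lambda>y. snd (snd c y))"
  unfolding coord_def by blast

lemma coord_fst:
  assumes "hol_chart X A c" "x \<in> fst c"
  shows "coord x (\<lambda>y. fst (snd c y))"
  using coord_snd[OF hol_chart_swap[OF assms(1)], of x] assms(2) by simp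

lemma coord_tendsto:
  assumes "coord x f"
  shows "(f \<longlongrightarrow> f x) (nhdsin X x)"
proof -
  obtain c where c: "hol_chart X A c" "x \<in> fst c" "f = (\<lambda>y. snd (snd c y))"
    using assms unfolding coord_def by blast
  from tendsto_snd[OF chart_ofD(4)[OF hol_chart_chart_of[OF c(1)] c(2)]]
  show ?thesis unfolding c(3) .
qed

lemma coord_cdiff2:
  assumes f: "coord x f" and c: "hol_chart X A c" "x \<in> fst c"
  shows "eventually (cdiff2 (\<lambda>q. f (inv_into (fst c) (snd c) q))) (nhds (snd c x))"
proof -
  obtain d where d: "hol_chart X A d" "x \<in> fst d" "f = (\<lambda>y. snd (snd d y))"
    using f unfolding coord_def by blast
  note chc = hol_chart_chart_of[OF c(1)] and chd = hol_chart_chart_of[OF d(1)]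
  have "eventually (\<lambda>y. y \<in> fst d) (nhdsin X x)"
    using eventually_nhdsin_openin[OF chart_ofD(1)[OF chd] d(2)] .
  from eventually_conj[OF chart_inv_eventually[OF chc c(2) this] chart_inv_in[OF chc c(2)]]
  show ?thesis
  proof (rule eventually_mono)
    fix q
    let ?y = "inv_into (fst c) (snd c) q"
    assume q: "?y \<in> fst d \<and> ?y \<in> fst c \<and> snd c ?y = q"
    then have "tr c d ?y" using hol_chart_tr[OF c(1) d(1)] by blast
    then show "cdiff2 (\<lambda>q. f (inv_into (fst c) (snd c) q)) q"
      using q unfolding tr_def cholo2_iff d(3) by simp
  qed
qed

text \<open>In the chart where \<open>f\<close> is the second coordinate, its differential is
  \<open>snd\<close>. By the chain rule the differential in any other chart, composed with that of
  the transition, gives \<open>snd\<close> and hence is nonzero.\<close>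

lemma coord_has_derivative:
  assumes f: "coord x f" and c: "hol_chart X A c" "x \<in> fst c"
  obtains \<alpha> \<beta> where
    "((\<lambda>q. f (inv_into (fst c) (snd c) q)) has_derivative (\<lambda>v. \<alpha> * fst v + \<beta> * snd v)) (at (snd c x))"
    "\<alpha> \<noteq> 0 \<or> \<beta> \<noteq> 0"
proof -
  let ?G = "\<lambda>q. f (inv_into (fst c) (snd c) q)"
  obtain \<alpha> \<beta> where G: "(?G has_derivative (\<lambda>v. \<alpha> * fst v + \<beta> * snd v)) (at (snd c x))"
    using eventually_nhds_x_imp_x[OF coord_cdiff2[OF f c]] unfolding cdiff2_def by blast
  obtain d where d: "hol_chart X A d" "x \<in> fst d" "f = (\<lambda>y. snd (snd d y))"
    using f unfolding coord_def by blast
  note chc = hol_chart_chart_of[OF c(1)] and chd = hol_chart_chart_of[OF d(1)]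
  let ?k = "\<lambda>q. snd c (inv_into (fst d) (snd d) q)"
  obtain k' where k: "(?k has_derivative k') (at (snd d x))"
    using hol_chart_tr[OF d(1) c(1) d(2) c(2)] unfolding tr_def cholo2_def by blast
  have kx: "?k (snd d x) = snd c x" using chart_ofD(7)[OF chd d(2)] by simp
  have Gk: "((\<lambda>q. ?G (?k q)) has_derivative (\<lambda>v. \<alpha> * fst (k' v) + \<beta> * snd (k' v))) (at (snd d x))"
    using has_derivative_compose[OF k, of ?G] G kx by simp
  have "eventually (\<lambda>y. y \<in> fst c) (nhdsin X x)"
    using eventually_nhdsin_openin[OF chart_ofD(1)[OF chc] c(2)] .
  from eventually_conj[OF chart_inv_eventually[OF chd d(2) this] chart_inv_in[OF chd d(2)]]
  have ev: "eventually (\<lambda>q. ?G (?k q) = snd q) (nhds (snd d x))"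
    by (rule eventually_mono) (simp add: chart_ofD(7)[OF chc] d(3))
  have "((\<lambda>q. snd q) has_derivative (\<lambda>v. \<alpha> * fst (k' v) + \<beta> * snd (k' v))) (at (snd d x))"
    by (rule has_derivative_transform_eventually[OF Gk])
      (use ev eventually_nhds_x_imp_x[OF ev] in \<open>auto simp: eventually_at_filter elim: eventually_mono\<close>)
  moreover have "((\<lambda>q. snd q) has_derivative snd) (at (snd d x))" by (auto intro!: derivative_eq_intros)
  ultimately have "(\<lambda>v. \<alpha> * fst (k' v) + \<beta> * snd (k' v)) = snd" by (rule has_derivative_unique)
  from fun_cong[OF this, of "(0, 1)"] have "\<alpha> \<noteq> 0 \<or> \<beta> \<noteq> 0" by auto
  with G show thesis by (rule that)
qed

text \<open>Two equations of one smooth branch differ by a unit. In a chart with second coordinate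
  \<open>e\<close> the function \<open>f\<close> vanishes on the axis, so its first partial is zero;
  the second, which is the limit of \<open>f / e\<close>, is therefore not.\<close>

lemma coord_divide_tendsto:
  assumes f: "coord x f" and e: "coord x e" and ex: "e x = 0"
    and fe: "eventually (\<lambda>y. e y = 0 \<longrightarrow> f y = 0) (nhdsin X x)"
  obtains u where "u \<noteq> 0" "((\<lambda>y. f y / e y) \<longlongrightarrow> u) (inf (nhdsin X x) (principal {y. e y \<noteq> 0}))"
proof -
  obtain d where d: "hol_chart X A d" "x \<in> fst d" "e = (\<lambda>y. snd (snd d y))"
    using e unfolding coord_def by blast
  note chd = hol_chart_chart_of[OF d(1)]
  let ?G = "\<lambda>q. f (inv_into (fst d) (snd d) q)"
  obtain a where a: "snd d x = (a, 0)" using ex d(3) by (metis prod.collapse)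
  obtain \<alpha> \<beta> where G: "(?G has_derivative (\<lambda>v. \<alpha> * fst v + \<beta> * snd v)) (at (a, 0))"
    and nz: "\<alpha> \<noteq> 0 \<or> \<beta> \<noteq> 0"
    using coord_has_derivative[OF f d(1,2)] a by metis
  have zero: "eventually (\<lambda>q. snd q = 0 \<longrightarrow> ?G q = 0) (nhds (a, 0))"
    using eventually_conj[OF chart_inv_eventually[OF chd d(2) fe] chart_inv_in[OF chd d(2)]] unfolding a
    by (rule eventually_mono) (auto simp: d(3))
  have "eventually (\<lambda>x. ?G (x, 0) = 0) (nhds a)"
    using eventually_nhds_Pair_fst[OF zero] by simp
  then have "\<alpha> = 0" using has_field_derivative_eventually_0[OF has_derivative_partial_fst[OF G]] by blast
  then have "\<beta> \<noteq> 0" using nz by simp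
  moreover have "((\<lambda>q. ?G q / snd q) \<longlongrightarrow> \<beta>) (inf (nhds (a, 0)) (principal {q. snd q \<noteq> 0}))"
    using tendsto_divide_snd[OF _ zero] coord_cdiff2[OF f d(1,2)] DERIV_imp_deriv[OF has_derivative_partial_snd[OF G]]
    unfolding a by simp
  moreover have "filterlim (snd d) (inf (nhds (a, 0)) (principal {q. snd q \<noteq> 0})) (inf (nhdsin X x) (principal {y. e y \<noteq> 0}))"
    unfolding filterlim_inf
  proof
    show "filterlim (snd d) (nhds (a, 0)) (inf (nhdsin X x) (principal {y. e y \<noteq> 0}))"
      using filterlim_mono[OF chart_ofD(4)[OF chd d(2)] order_refl inf_le1] unfolding a .
    show "filterlim (snd d) (principal {q. snd q \<noteq> 0}) (inf (nhdsin X x) (principal {y. e y \<noteq> 0}))"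
      unfolding filterlim_principal by (simp add: d(3) eventually_inf_principal)
  qed
  ultimately have lim: "((\<lambda>y. ?G (snd d y) / snd (snd d y)) \<longlongrightarrow> \<beta>) (inf (nhdsin X x) (principal {y. e y \<noteq> 0}))"
    using filterlim_compose by blast
  have "eventually (\<lambda>y. y \<in> fst d) (nhdsin X x)"
    using eventually_nhdsin_openin[OF chart_ofD(1)[OF chd] d(2)] .
  then have "eventually (\<lambda>y. ?G (snd d y) / snd (snd d y) = f y / e y) (inf (nhdsin X x) (principal {y. e y \<noteq> 0}))"
    unfolding eventually_inf_principal by (rule eventually_mono) (simp add: chart_ofD(7)[OF chd] d(3))
  then have "((\<lambda>y. f y / e y) \<longlongrightarrow> \<beta>) (inf (nhdsin X x) (principal {y. e y \<noteq> 0}))"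
    by (rule Lim_transform_eventually[OF lim])
  with \<open>\<beta> \<noteq> 0\<close> show thesis by (rule that)
qed

text \<open>Vanishing on both axes makes both partial derivatives at the origin zero, which the
  nonzero differential of a coordinate forbids. This is what distinguishes a crossing from a smooth
  point of the divisor.\<close>

lemma coord_not_vanish_on_axes:
  assumes e: "coord x e" and c: "hol_chart X A c" "x \<in> fst c" "snd c x = (0, 0)"
    and ev: "eventually (\<lambda>y. fst (snd c y) = 0 \<or> snd (snd c y) = 0 \<longrightarrow> e y = 0) (nhdsin X x)"
  shows False
proof -
  note chc = hol_chart_chart_of[OF c(1)]
  let ?G = "\<lambda>q. e (inv_into (fst c) (snd c) q)"
  obtain \<alpha> \<beta> where G: "(?G has_derivative (\<lambda>v. \<alpha> * fst v + \<beta> * snd v)) (at (0, 0))"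
    and nz: "\<alpha> \<noteq> 0 \<or> \<beta> \<noteq> 0"
    using coord_has_derivative[OF e c(1,2)] c(3) by metis
  have zero: "eventually (\<lambda>q. fst q = 0 \<or> snd q = 0 \<longrightarrow> ?G q = 0) (nhds (0, 0))"
    using eventually_conj[OF chart_inv_eventually[OF chc c(2) ev] chart_inv_in[OF chc c(2)]] unfolding c(3)
    by (rule eventually_mono) auto
  have "eventually (\<lambda>x. ?G (x, 0) = 0) (nhds 0)" "eventually (\<lambda>x. ?G (0, x) = 0) (nhds 0)"
    using eventually_nhds_Pair_fst[OF zero] eventually_nhds_Pair_snd[OF zero] by simp_all
  then have "\<alpha> = 0" "\<beta> = 0"
    using has_field_derivative_eventually_0[OF has_derivative_partial_fst[OF G]]
      has_field_derivative_eventually_0[OF has_derivative_partial_snd[OF G]] by blast+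
  with nz show False by simp
qed

text \<open>A smooth branch is irreducible: restricted to \<open>e = 0\<close>, the functions
  \<open>f\<close> and \<open>g\<close> are holomorphic in one variable with product zero, so one of
  them vanishes identically near \<open>x\<close>.\<close>

lemma coord_mult_vanish:
  assumes e: "coord x e" "e x = 0" and f: "coord x f" and g: "coord x g"
    and ev: "eventually (\<lambda>y. e y = 0 \<longrightarrow> f y = 0 \<or> g y = 0) (nhdsin X x)"
  shows "eventually (\<lambda>y. e y = 0 \<longrightarrow> f y = 0) (nhdsin X x) \<or> eventually (\<lambda>y. e y = 0 \<longrightarrow> g y = 0) (nhdsin X x)"
proof -
  obtain d where d: "hol_chart X A d" "x \<in> fst d" "e = (\<lambda>y. snd (snd d y))"
    using e unfolding coord_def by blast
  note chd = hol_chart_chart_of[OF d(1)]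
  obtain a where a: "snd d x = (a, 0)" using e(2) d(3) by (metis prod.collapse)
  let ?F = "\<lambda>q. f (inv_into (fst d) (snd d) q)" and ?G = "\<lambda>q. g (inv_into (fst d) (snd d) q)"
  have "eventually (\<lambda>q. cdiff2 ?F q \<and> cdiff2 ?G q \<and> (snd q = 0 \<longrightarrow> ?F q = 0 \<or> ?G q = 0)) (nhds (a, 0))"
    using coord_cdiff2[OF f d(1,2)] coord_cdiff2[OF g d(1,2)]
      chart_inv_eventually[OF chd d(2) ev] chart_inv_in[OF chd d(2)] unfolding a
    by eventually_elim (auto simp: d(3))
  then have "eventually (\<lambda>t. cdiff2 ?F (t, 0) \<and> cdiff2 ?G (t, 0) \<and> (?F (t, 0) = 0 \<or> ?G (t, 0) = 0)) (nhds a)"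
    using eventually_nhds_Pair_fst by fastforce
  then obtain r where r: "0 < r"
    "\<And>t. t \<in> ball a r \<Longrightarrow> cdiff2 ?F (t, 0) \<and> cdiff2 ?G (t, 0) \<and> (?F (t, 0) = 0 \<or> ?G (t, 0) = 0)"
    unfolding eventually_nhds_metric by (auto simp: dist_commute)
  have "(\<forall>t\<in>ball a r. ?F (t, 0) = 0) \<or> (\<forall>t\<in>ball a r. ?G (t, 0) = 0)"
  proof (rule holomorphic_mult_eq_zero)
    show "(\<lambda>t. ?F (t, 0)) holomorphic_on ball a r" "(\<lambda>t. ?G (t, 0)) holomorphic_on ball a r"
      unfolding holomorphic_on_def
      using r(2) cdiff2_partials(2) field_differentiable_at_within by blast+
  qed (use r in auto)
  moreover have "eventually (\<lambda>y. e y = 0 \<longrightarrow> h y = 0) (nhdsin X x)"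
    if "\<forall>t\<in>ball a r. h (inv_into (fst d) (snd d) (t, 0)) = 0" for h :: "'a \<Rightarrow> complex"
  proof -
    have "eventually (\<lambda>q. fst q \<in> ball a r) (nhds (snd d x))"
      unfolding a using r(1) by (intro eventually_compose_filterlim[OF eventually_nhds_in_open tendsto_fst[OF filterlim_ident], of _ "(a, 0)", simplified]) auto
    from eventually_conj[OF chart_eventually[OF chd d(2) this] eventually_nhdsin_openin[OF chart_ofD(1)[OF chd] d(2)]]
    show ?thesis
    proof (rule eventually_mono, intro impI)
      fix y assume y: "fst (snd d y) \<in> ball a r \<and> y \<in> fst d" "e y = 0"
      then have "snd d y = (fst (snd d y), 0)" using d(3) by (simp add: prod_eq_iff)
      then have "inv_into (fst d) (snd d) (fst (snd d y), 0) = y" using chart_ofD(7)[OF chd, of y] y by simp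
      then show "h y = 0" using that y by force
    qed
  qed
  ultimately show ?thesis by blast
qed

text \<open>The local equations of the branches of \<open>D\<close> in the chart; their angles are
  the ones that \<open>polar\<close> records.\<close>

fun blown :: "position \<Rightarrow> 'a chart \<Rightarrow> ('a \<Rightarrow> complex) set"
  where
    "blown Away c = {}"
  | "blown Smooth c = {\<lambda>y. snd (snd c y)}"
  | "blown Crossing c = {\<lambda>y. fst (snd c y), \<lambda>y. snd (snd c y)}"

lemma blown_coord: "hol_chart X A c \<Longrightarrow> x \<in> fst c \<Longrightarrow> f \<in> blown k c \<Longrightarrow> coord x f"
  using coord_fst[of c x] coord_snd[of c x] by (cases k) auto

lemma adapted_hol: "adapted_chart X A D c k \<Longrightarrow> hol_chart X A c"
  unfolding adapted_chart_def by blast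

lemma adapted_in_D_iff:
  assumes "adapted_chart X A D c k" "x \<in> fst c"
  shows "x \<in> D \<longleftrightarrow> snd c x \<in> local_divisor k"
proof -
  have inj: "inj_on (snd c) (fst c)" using assms(1) adapted_hol hol_chart_chart_of chart_ofD(3) by blast
  have "snd c ` (D \<inter> fst c) = local_divisor k \<inter> snd c ` fst c"
    using assms(1) unfolding adapted_chart_def by blast
  then have "snd c x \<in> local_divisor k \<longleftrightarrow> snd c x \<in> snd c ` (D \<inter> fst c)" using assms(2) by auto
  also have "\<dots> \<longleftrightarrow> x \<in> D" using inj_on_image_mem_iff[OF inj assms(2), of "D \<inter> fst c"] assms(2) by auto
  finally show ?thesis by simp
qed

lemma adapted_blown:
  assumes "adapted_chart X A D c k" "x \<in> fst c"
  shows "x \<in> D \<longleftrightarrow> (\<exists>f\<in>blown k c. f x = 0)"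
  unfolding adapted_in_D_iff[OF assms] by (cases k; cases "snd c x") auto

text \<open>An equation that is nonzero at \<open>x\<close> stays nonzero nearby, so only the
  branches through \<open>x\<close> itself describe \<open>D\<close> near \<open>x\<close>. Charts
  of different types can be compared in this form.\<close>

lemma adapted_near:
  assumes c: "adapted_chart X A D c k" and x: "x \<in> fst c"
  shows "eventually (\<lambda>y. y \<in> D \<longleftrightarrow> (\<exists>f\<in>blown k c. f x = 0 \<and> f y = 0)) (nhdsin X x)"
proof -
  have ev: "eventually (\<lambda>y. f x = 0 \<or> f y \<noteq> 0) (nhdsin X x)" if "f \<in> blown k c" for f
  proof (cases "f x = 0")
    case False
    then show ?thesis
      using tendsto_imp_eventually_ne[OF coord_tendsto[OF blown_coord[OF adapted_hol[OF c] x that]] False]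
      by (auto elim: eventually_mono)
  qed simp
  have "finite (blown k c)" by (cases k) auto
  then have "eventually (\<lambda>y. \<forall>f\<in>blown k c. f x = 0 \<or> f y \<noteq> 0) (nhdsin X x)"
    using ev by (simp add: eventually_ball_finite)
  with eventually_nhdsin_openin[OF chart_ofD(1)[OF hol_chart_chart_of[OF adapted_hol[OF c]]] x]
  show ?thesis
  proof eventually_elim
    case (elim y)
    then show ?case using adapted_blown[OF c, of y] by blast
  qed
qed

text \<open>The local branches of \<open>D\<close> do not depend on the adapted chart. If
  \<open>f = 0\<close> is the only branch at \<open>x\<close>, any branch of \<open>d\<close> lies
  in it. If there are two, irreducibility puts each branch of \<open>d\<close> into
  \<open>f = 0\<close> or \<open>g = 0\<close>; were \<open>d\<close> to have one branch only, or
  were both its branches in \<open>g = 0\<close>, some coordinate function would vanish on two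
  crossing axes.\<close>

lemma adapted_branch:
  assumes c: "adapted_chart X A D c k" "x \<in> fst c" and d: "adapted_chart X A D d j" "x \<in> fst d"
    and f: "f \<in> blown k c" "f x = 0"
  obtains e where "e \<in> blown j d" "e x = 0" "eventually (\<lambda>y. e y = 0 \<longrightarrow> f y = 0) (nhdsin X x)"
proof -
  note hc = adapted_hol[OF c(1)] and hd = adapted_hol[OF d(1)]
  note nc = adapted_near[OF c] and nd = adapted_near[OF d]
  have "x \<in> D" using adapted_blown[OF c] f by blast
  then obtain e where e: "e \<in> blown j d" "e x = 0" using adapted_blown[OF d] by blast
  note ce = blown_coord[OF hd d(2) e(1)] and cf = blown_coord[OF hc c(2) f(1)]
  show thesis
  proof (cases "\<forall>g\<in>blown k c. g x = 0 \<longrightarrow> g = f")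
    case True
    from nc nd have "eventually (\<lambda>y. e y = 0 \<longrightarrow> f y = 0) (nhdsin X x)"
      by eventually_elim (use True e in blast)
    then show thesis using that e by blast
  next
    case False
    then obtain g where g: "g \<in> blown k c" "g x = 0" "g \<noteq> f" by blast
    note cg = blown_coord[OF hc c(2) g(1)]
    have k: "k = Crossing" using f g by (cases k) auto
    have fg: "blown k c = {f, g}" using f g unfolding k by auto
    have c0: "snd c x = (0, 0)" using f g unfolding k by (cases "snd c x") auto
    have axes: "fst (snd c y) = 0 \<or> snd (snd c y) = 0 \<longleftrightarrow> f y = 0 \<or> g y = 0" for y
      using f(1) g unfolding k by auto
    from nc nd have e_fg: "eventually (\<lambda>y. e' y = 0 \<longrightarrow> f y = 0 \<or> g y = 0) (nhdsin X x)"
      if "e' \<in> blown j d" "e' x = 0" for e'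
    proof eventually_elim
      case (elim y)
      then show ?case using that unfolding fg by blast
    qed
    show thesis
    proof (cases "\<forall>e'\<in>blown j d. e' x = 0 \<longrightarrow> e' = e")
      case True
      \<comment> \<open>A single branch \<open>e = 0\<close> of \<open>d\<close> would contain both
        axes of \<open>c\<close>.\<close>
      from nc nd have "eventually (\<lambda>y. f y = 0 \<or> g y = 0 \<longrightarrow> e y = 0) (nhdsin X x)"
        by eventually_elim (use True f g in blast)
      then show thesis using coord_not_vanish_on_axes[OF ce hc c(2) c0] unfolding axes by blast
    next
      case False
      then obtain e' where e': "e' \<in> blown j d" "e' x = 0" "e' \<noteq> e" by blast
      note ce' = blown_coord[OF hd d(2) e'(1)]
      have j: "j = Crossing" using e e' by (cases j) auto
      have d0: "snd d x = (0, 0)" using e e' unfolding j by (cases "snd d x") auto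
      have axes': "fst (snd d y) = 0 \<or> snd (snd d y) = 0 \<longleftrightarrow> e y = 0 \<or> e' y = 0" for y
        using e(1) e' unfolding j by auto
      show thesis
      proof (rule ccontr)
        assume no: "\<not> thesis"
        have "eventually (\<lambda>y. e y = 0 \<longrightarrow> g y = 0) (nhdsin X x)"
          using coord_mult_vanish[OF ce e(2) cf cg e_fg[OF e]] that[OF e] no by blast
        moreover have "eventually (\<lambda>y. e' y = 0 \<longrightarrow> g y = 0) (nhdsin X x)"
          using coord_mult_vanish[OF ce' e'(2) cf cg e_fg[OF e'(1,2)]] that[OF e'(1,2)] no by blast
        ultimately have "eventually (\<lambda>y. e y = 0 \<or> e' y = 0 \<longrightarrow> g y = 0) (nhdsin X x)"
          by eventually_elim blast
        then show False using coord_not_vanish_on_axes[OF cg hd d(2) d0] unfolding axes' by blast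
      qed
    qed
  qed
qed

lemma crossing_point_unique:
  assumes c: "adapted_chart X A D c Crossing" "x \<in> fst c" "snd c x = (0, 0)"
    and d: "adapted_chart X A D d Smooth" "x \<in> fst d"
  shows False
proof -
  let ?e = "\<lambda>y. snd (snd d y)"
  have "x \<in> D" using adapted_blown[OF c(1,2)] c(3) by simp
  then have e: "?e x = 0" using adapted_blown[OF d] by simp
  from adapted_near[OF c(1,2)] adapted_near[OF d]
  have "eventually (\<lambda>y. fst (snd c y) = 0 \<or> snd (snd c y) = 0 \<longrightarrow> ?e y = 0) (nhdsin X x)"
    by eventually_elim (use e c(3) in auto)
  then show False
    using coord_not_vanish_on_axes[OF coord_snd[OF adapted_hol[OF d(1)] d(2)] adapted_hol[OF c(1)] c(2,3)] by blast
qed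

end

section \<open>The real blow-up as a strict extension of the complement\<close>

lemma polar_eq:
  "polar k p = (p, (if k = Crossing then sgn (fst p) else 1, if k = Away then 1 else sgn (snd p)))"
  by (cases k; cases p) auto

lemma prime_end_eq:
  "prime_end D c k m = inf (filtercomap (\<lambda>x. polar k (snd c x)) (nhds m)) (principal (fst c - D))"
  by (cases c) simp

lemma polar_model_eq:
  "polar_model D c k = {m \<in> closure ((\<lambda>x. polar k (snd c x)) ` (fst c - D)). fst m \<in> snd c ` fst c}"
  by (cases c) simp

text \<open>Pulled-back and principal filters have universal properties, so every inequality with a
  trace filter on the right becomes the computation of a limit.\<close>

lemma le_prime_end_iff:
  "F \<le> prime_end D c k m \<longleftrightarrow>
    ((\<lambda>x. polar k (snd c x)) \<longlongrightarrow> m) F \<and> eventually (\<lambda>x. x \<in> fst c - D) F"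
  unfolding prime_end_eq le_inf_iff filterlim_def filtermap_le_iff_le_filtercomap le_principal ..

lemma prime_end_tendsto: "((\<lambda>x. polar k (snd c x)) \<longlongrightarrow> m) (prime_end D c k m)"
  and prime_end_eventually: "eventually (\<lambda>x. x \<in> fst c - D) (prime_end D c k m)"
  using le_prime_end_iff[THEN iffD1, OF order_refl] by (rule conjunct1, rule conjunct2)

lemma prime_end_not_bot:
  assumes "m \<in> polar_model D c k"
  shows "prime_end D c k m \<noteq> bot"
proof
  assume "prime_end D c k m = bot"
  then have "eventually (\<lambda>x. False) (prime_end D c k m)" by simp
  then have "eventually (\<lambda>x. x \<notin> fst c - D) (filtercomap (\<lambda>x. polar k (snd c x)) (nhds m))"
    unfolding prime_end_eq eventually_inf_principal by simp
  then obtain Q where Q: "eventually Q (nhds m)" "\<And>x. Q (polar k (snd c x)) \<Longrightarrow> x \<notin> fst c - D"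
    unfolding eventually_filtercomap by blast
  obtain T where T: "open T" "m \<in> T" "\<forall>x\<in>T. Q x" using Q(1) unfolding eventually_nhds by blast
  have "m \<in> closure ((\<lambda>x. polar k (snd c x)) ` (fst c - D))" using assms unfolding polar_model_eq by blast
  then obtain x where "x \<in> fst c - D" "polar k (snd c x) \<in> T"
    using T(1,2) unfolding closure_iff_nhds_not_empty by (metis (no_types, lifting) IntE all_not_in_conv imageE subset_refl)
  then show False using Q(2) T(3) by blast
qed

text \<open>Limits of polar coordinates along a proper filter are unique.\<close>

lemma prime_end_unique:
  assumes "F \<noteq> bot" "F \<le> prime_end D c k m" "F \<le> prime_end D c k m'"
  shows "m = m'"
  using tendsto_unique[OF assms(1) conjunct1 conjunct1] assms(2,3) unfolding le_prime_end_iff by blast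

lemma prime_end_tendsto_components:
  assumes "F \<le> prime_end D c k m"
  shows "(snd c \<longlongrightarrow> fst m) F"
    and "k = Crossing \<Longrightarrow> ((\<lambda>x. sgn (fst (snd c x))) \<longlongrightarrow> fst (snd m)) F"
    and "k \<noteq> Away \<Longrightarrow> ((\<lambda>x. sgn (snd (snd c x))) \<longlongrightarrow> snd (snd m)) F"
proof -
  have lim: "((\<lambda>x. polar k (snd c x)) \<longlongrightarrow> m) F" using assms unfolding le_prime_end_iff by blast
  show "(snd c \<longlongrightarrow> fst m) F" using tendsto_fst[OF lim] by (simp add: polar_eq)
  show "k = Crossing \<Longrightarrow> ((\<lambda>x. sgn (fst (snd c x))) \<longlongrightarrow> fst (snd m)) F"
    using tendsto_fst[OF tendsto_snd[OF lim]] by (simp add: polar_eq)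
  show "k \<noteq> Away \<Longrightarrow> ((\<lambda>x. sgn (snd (snd c x))) \<longlongrightarrow> snd (snd m)) F"
    using tendsto_snd[OF tendsto_snd[OF lim]] by (simp add: polar_eq)
qed

lemma prime_ends_iff: "F \<in> prime_ends X A D \<longleftrightarrow>
    (\<exists>c k m. adapted_chart X A D c k \<and> m \<in> polar_model D c k \<and> F = prime_end D c k m)"
  unfolding prime_ends_def by blast

section \<open>Feet of trace filters, change of charts, and the topology\<close>

context cx_surface
begin

lemma limitin_self_iff: "limitin X (\<lambda>y. y) x F \<longleftrightarrow> x \<in> topspace X \<and> F \<le> nhdsin X x"
proof -
  have "F \<le> nhdsin X x \<longleftrightarrow> (\<forall>U. openin X U \<and> x \<in> U \<longrightarrow> eventually (\<lambda>y. y \<in> U) F)" if x: "x \<in> topspace X"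
  proof
    assume "F \<le> nhdsin X x"
    then show "\<forall>U. openin X U \<and> x \<in> U \<longrightarrow> eventually (\<lambda>y. y \<in> U) F"
      by (blast intro: filter_leD eventually_nhdsin_openin)
  next
    assume *: "\<forall>U. openin X U \<and> x \<in> U \<longrightarrow> eventually (\<lambda>y. y \<in> U) F"
    show "F \<le> nhdsin X x"
    proof (rule filter_leI)
      fix P assume "eventually P (nhdsin X x)"
      then obtain S where "openin X S" "x \<in> S" "\<forall>y\<in>S. P y"
        using x by (auto simp: eventually_nhdsin)
      then have "eventually (\<lambda>y. y \<in> S) F" using * by blast
      then show "eventually P F" by (rule eventually_mono) (use \<open>\<forall>y\<in>S. P y\<close> in blast)
    qed
  qed
  then show ?thesis unfolding limitin_def by blast
qed

lemma foot_eqI: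
  assumes "F \<noteq> bot" "x \<in> topspace X" "F \<le> nhdsin X x"
  shows "foot X F = x"
  unfolding foot_def
proof (rule the_equality)
  show "limitin X (\<lambda>y. y) x F" using assms limitin_self_iff by blast
  show "y = x" if "limitin X (\<lambda>y. y) y F" for y
    using limitin_Hausdorff_unique[OF that _ _ Hausdorff] assms limitin_self_iff by blast
qed

lemma model_foot:
  assumes c: "adapted_chart X A D c k" and m: "m \<in> polar_model D c k"
  obtains x where "x \<in> fst c" "snd c x = fst m" "prime_end D c k m \<le> nhdsin X x"
    "foot X (prime_end D c k m) = x"
proof -
  note chc = hol_chart_chart_of[OF adapted_hol[OF c]]
  obtain x where x: "x \<in> fst c" "snd c x = fst m" using m unfolding polar_model_eq by force
  let ?F = "prime_end D c k m"
  have "(snd c \<longlongrightarrow> snd c x) ?F" using prime_end_tendsto_components(1)[OF order_refl] x(2) by metis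
  from filterlim_compose[OF chart_ofD(5)[OF chc x(1)] this]
  have "filterlim (\<lambda>y. inv_into (fst c) (snd c) (snd c y)) (nhdsin X x) ?F" .
  moreover have "eventually (\<lambda>y. inv_into (fst c) (snd c) (snd c y) = y) ?F"
    using prime_end_eventually by (rule eventually_mono) (simp add: chart_ofD(7)[OF chc])
  ultimately have "filterlim (\<lambda>y. y) (nhdsin X x) ?F" using filterlim_cong[OF refl refl] by fast
  then have le: "?F \<le> nhdsin X x" by (simp add: filterlim_def)
  then have "foot X ?F = x" using foot_eqI prime_end_not_bot[OF m] chart_ofD(6)[OF chc x(1)] by blast
  with x le show thesis by (rule that)
qed

text \<open>Only the angles have to be examined: the coordinates converge because
  \<open>F \<le> nhdsin X x\<close>, and the limit lies in the closure because it is a limit. Angles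
  that are not blown up take the dummy value 1.\<close>

lemma le_prime_endI:
  assumes F: "F \<noteq> bot" "F \<le> nhdsin X x" and D: "eventually (\<lambda>y. y \<notin> D) F"
    and c: "adapted_chart X A D c k" "x \<in> fst c"
    and 1: "k = Crossing \<Longrightarrow> ((\<lambda>y. sgn (fst (snd c y))) \<longlongrightarrow> s1) F" "k \<noteq> Crossing \<Longrightarrow> s1 = 1"
    and 2: "k \<noteq> Away \<Longrightarrow> ((\<lambda>y. sgn (snd (snd c y))) \<longlongrightarrow> s2) F" "k = Away \<Longrightarrow> s2 = 1"
  shows "(snd c x, (s1, s2)) \<in> polar_model D c k" "F \<le> prime_end D c k (snd c x, (s1, s2))"
proof -
  note chc = hol_chart_chart_of[OF adapted_hol[OF c(1)]]
  have "(snd c \<longlongrightarrow> snd c x) F" using filterlim_mono[OF chart_ofD(4)[OF chc c(2)] order_refl F(2)] .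
  then have lim: "((\<lambda>y. polar k (snd c y)) \<longlongrightarrow> (snd c x, (s1, s2))) F"
    unfolding polar_eq using 1 2 by (intro tendsto_Pair) (cases k; simp)+
  have ev: "eventually (\<lambda>y. y \<in> fst c - D) F"
    using filter_leD[OF F(2) eventually_nhdsin_openin[OF chart_ofD(1)[OF chc] c(2)]] D
    by eventually_elim blast
  show "F \<le> prime_end D c k (snd c x, (s1, s2))" unfolding le_prime_end_iff using lim ev by blast
  have "(snd c x, (s1, s2)) \<in> closure ((\<lambda>x. polar k (snd c x)) ` (fst c - D))"
  proof (rule Lim_in_closed_set[OF closed_closure _ F(1) lim])
    show "eventually (\<lambda>y. polar k (snd c y) \<in> closure ((\<lambda>x. polar k (snd c x)) ` (fst c - D))) F"
      using ev by (rule eventually_mono) (metis (no_types, lifting) closure_subset imageI subsetD)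
  qed
  then show "(snd c x, (s1, s2)) \<in> polar_model D c k" unfolding polar_model_eq using c(2) by simp
qed

lemma prime_end_sgn_blown:
  assumes "F \<le> prime_end D c k m" "f \<in> blown k c"
  obtains s where "((\<lambda>y. sgn (f y)) \<longlongrightarrow> s) F"
  using prime_end_tendsto_components(2,3)[OF assms(1)] assms(2) by (cases k) auto

text \<open>If \<open>f x \<noteq> 0\<close>, the angle converges by continuity. Otherwise
  \<open>d\<close> has an equation \<open>e\<close> of the same branch, the quotient
  \<open>f / e\<close> tends to some \<open>u \<noteq> 0\<close>, and
  \<open>sgn f = sgn (f / e) * sgn e\<close> off \<open>D\<close>.\<close>

lemma prime_end_sgn_tendsto:
  assumes d: "adapted_chart X A D d j" "x \<in> fst d" and F: "F \<noteq> bot" "F \<le> nhdsin X x" "F \<le> prime_end D d j m"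
    and c: "adapted_chart X A D c k" "x \<in> fst c" and f: "f \<in> blown k c"
  obtains s where "((\<lambda>y. sgn (f y)) \<longlongrightarrow> s) F"
proof (cases "f x = 0")
  case False
  have "(f \<longlongrightarrow> f x) F"
    using filterlim_mono[OF coord_tendsto[OF blown_coord[OF adapted_hol[OF c(1)] c(2) f]] order_refl F(2)] .
  then show thesis using that tendsto_sgn[OF _ False] by blast
next
  case True
  then obtain e where e: "e \<in> blown j d" "e x = 0" "eventually (\<lambda>y. e y = 0 \<longrightarrow> f y = 0) (nhdsin X x)"
    using adapted_branch[OF c d f] by blast
  obtain u where u: "u \<noteq> 0" "((\<lambda>y. f y / e y) \<longlongrightarrow> u) (inf (nhdsin X x) (principal {y. e y \<noteq> 0}))"
    using coord_divide_tendsto[OF blown_coord[OF adapted_hol[OF c(1)] c(2) f]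
        blown_coord[OF adapted_hol[OF d(1)] d(2) e(1)] e(2,3)] by blast
  obtain s where s: "((\<lambda>y. sgn (e y)) \<longlongrightarrow> s) F" using prime_end_sgn_blown[OF F(3) e(1)] by blast
  have "eventually (\<lambda>y. y \<in> fst d - D) F" using F(3) unfolding le_prime_end_iff by blast
  then have ne: "eventually (\<lambda>y. e y \<noteq> 0) F"
    by (rule eventually_mono) (use adapted_blown[OF d(1)] e(1) in blast)
  then have "F \<le> inf (nhdsin X x) (principal {y. e y \<noteq> 0})"
    using F(2) by (simp add: le_principal)
  from filterlim_mono[OF u(2) order_refl this]
  have "((\<lambda>y. sgn (f y / e y) * sgn (e y)) \<longlongrightarrow> sgn u * s) F"
    by (intro tendsto_mult tendsto_sgn s u(1))
  moreover have "eventually (\<lambda>y. sgn (f y / e y) * sgn (e y) = sgn (f y)) F"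
    using ne by (rule eventually_mono) (simp only: sgn_mult[symmetric], simp)
  ultimately have "((\<lambda>y. sgn (f y)) \<longlongrightarrow> sgn u * s) F" using Lim_transform_eventually by fast
  then show thesis by (rule that)
qed

lemma prime_end_le_other_chart:
  assumes d: "adapted_chart X A D d j" "m \<in> polar_model D d j"
    and c: "adapted_chart X A D c k" "foot X (prime_end D d j m) \<in> fst c"
  obtains m' where "m' \<in> polar_model D c k" "prime_end D d j m \<le> prime_end D c k m'"
    "fst m' = snd c (foot X (prime_end D d j m))"
proof -
  let ?F = "prime_end D d j m"
  obtain x where x: "x \<in> fst d" "snd d x = fst m" "?F \<le> nhdsin X x" "foot X ?F = x"
    using model_foot[OF d] by blast
  have nb: "?F \<noteq> bot" using prime_end_not_bot[OF d(2)] .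
  have xc: "x \<in> fst c" using c(2) x(4) by simp
  have ex: "\<exists>s. ((\<lambda>y. sgn (f y)) \<longlongrightarrow> s) ?F" if "f \<in> blown k c" for f
    using prime_end_sgn_tendsto[OF d(1) x(1) nb x(3) order_refl c(1) xc that] by blast
  obtain s1 where s1: "k = Crossing \<Longrightarrow> ((\<lambda>y. sgn (fst (snd c y))) \<longlongrightarrow> s1) ?F" "k \<noteq> Crossing \<Longrightarrow> s1 = 1"
    using ex by (cases k) fastforce+
  obtain s2 where s2: "k \<noteq> Away \<Longrightarrow> ((\<lambda>y. sgn (snd (snd c y))) \<longlongrightarrow> s2) ?F" "k = Away \<Longrightarrow> s2 = 1"
    using ex by (cases k) fastforce+
  have "eventually (\<lambda>y. y \<notin> D) ?F" using prime_end_eventually[of d D j m] by (rule eventually_mono) blast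
  from le_prime_endI[OF nb x(3) this c(1) xc s1 s2] show thesis using that x(4) by simp
qed

text \<open>Passing to \<open>c\<close> and back gives
  \<open>?F \<le> ?G \<le> prime_end D d j m''\<close>. Uniqueness of limits forces
  \<open>m'' = m\<close>, so both inequalities are equalities.\<close>

lemma prime_end_change_chart:
  assumes d: "adapted_chart X A D d j" "m \<in> polar_model D d j"
    and c: "adapted_chart X A D c k" "foot X (prime_end D d j m) \<in> fst c"
  obtains m' where "m' \<in> polar_model D c k" "prime_end D d j m = prime_end D c k m'"
    "fst m' = snd c (foot X (prime_end D d j m))"
proof -
  let ?F = "prime_end D d j m"
  obtain m' where m': "m' \<in> polar_model D c k" "?F \<le> prime_end D c k m'" "fst m' = snd c (foot X ?F)"
    using prime_end_le_other_chart[OF assms] by blast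
  let ?G = "prime_end D c k m'"
  obtain x where x: "x \<in> fst d" "snd d x = fst m" "?F \<le> nhdsin X x" "foot X ?F = x"
    using model_foot[OF d] by blast
  obtain x' where x': "x' \<in> fst c" "?G \<le> nhdsin X x'" "foot X ?G = x'"
    using model_foot[OF c(1) m'(1)] by blast
  have nb: "?F \<noteq> bot" using prime_end_not_bot[OF d(2)] .
  have "foot X ?F = x'"
    using foot_eqI[OF nb] order_trans[OF m'(2) x'(2)] chart_ofD(6)[OF hol_chart_chart_of[OF adapted_hol[OF c(1)]] x'(1)] by blast
  then have "foot X ?G \<in> fst d" using x x' by simp
  then obtain m'' where "?G \<le> prime_end D d j m''"
    using prime_end_le_other_chart[OF c(1) m'(1) d(1)] by blast
  moreover from this have "m'' = m" using prime_end_unique[OF nb, of D d j m'' m] m'(2) by (meson order_refl order_trans)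
  ultimately have "?F = ?G" using m'(2) by (simp add: antisym)
  with m' show thesis using that by blast
qed

lemma prime_ends_basic:
  assumes "F \<in> prime_ends X A D"
  shows "F \<noteq> bot" "F \<le> nhdsin X (foot X F)" "foot X F \<in> topspace X"
    "eventually (\<lambda>y. y \<in> topspace X - D) F"
    "\<exists>c k m. adapted_chart X A D c k \<and> m \<in> polar_model D c k \<and> foot X F \<in> fst c \<and>
      fst m = snd c (foot X F) \<and> F = prime_end D c k m"
proof -
  obtain c k m where c: "adapted_chart X A D c k" "m \<in> polar_model D c k" "F = prime_end D c k m"
    using assms unfolding prime_ends_iff by blast
  obtain x where x: "x \<in> fst c" "snd c x = fst m" "prime_end D c k m \<le> nhdsin X x"
    "foot X (prime_end D c k m) = x"
    using model_foot[OF c(1,2)] by blast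
  note top = chart_ofD(6)[OF hol_chart_chart_of[OF adapted_hol[OF c(1)]]]
  show "F \<noteq> bot" unfolding c(3) by (rule prime_end_not_bot[OF c(2)])
  show "F \<le> nhdsin X (foot X F)" using c x by simp
  show "foot X F \<in> topspace X" using c x top by simp
  show "eventually (\<lambda>y. y \<in> topspace X - D) F"
    unfolding c(3) using prime_end_eventually by (rule eventually_mono) (use top in blast)
  show "\<exists>c k m. adapted_chart X A D c k \<and> m \<in> polar_model D c k \<and> foot X F \<in> fst c \<and>
      fst m = snd c (foot X F) \<and> F = prime_end D c k m"
    using c x by (intro exI[of _ c] exI[of _ k] exI[of _ m]) simp
qed

lemma prime_ends_in_chart:
  assumes "F \<in> prime_ends X A D" "adapted_chart X A D c k" "foot X F \<in> fst c"
  obtains m where "m \<in> polar_model D c k" "F = prime_end D c k m" "fst m = snd c (foot X F)"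
proof -
  obtain d j m where "adapted_chart X A D d j" "m \<in> polar_model D d j" "F = prime_end D d j m"
    using assms(1) unfolding prime_ends_iff by blast
  then show thesis using prime_end_change_chart[of D d j m c k] assms(2,3) that by metis
qed

text \<open>A proper filter below both determines the foot of each, so both can be written in one
  chart, where limits are unique. Thanks to this separation, equality of trace filters is always
  obtained from an inequality.\<close>

lemma prime_ends_unique:
  assumes "F \<noteq> bot" "F \<le> G" "F \<le> G'" "G \<in> prime_ends X A D" "G' \<in> prime_ends X A D"
  shows "G = G'"
proof -
  have "foot X F = foot X G" "foot X F = foot X G'"
    using foot_eqI[OF assms(1)] prime_ends_basic(2,3)[OF assms(4)] prime_ends_basic(2,3)[OF assms(5)]
      assms(2,3) order_trans by blast+
  moreover obtain c k m where c: "adapted_chart X A D c k" "foot X G \<in> fst c" "G = prime_end D c k m"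
    using prime_ends_basic(5)[OF assms(4)] by blast
  ultimately obtain m' where "G' = prime_end D c k m'"
    using prime_ends_in_chart[OF assms(5) c(1)] by metis
  with c prime_end_unique[OF assms(1)] assms(2,3) show ?thesis by metis
qed

lemma prime_end_in_prime_ends:
  "adapted_chart X A D c k \<Longrightarrow> m \<in> polar_model D c k \<Longrightarrow> prime_end D c k m \<in> prime_ends X A D"
  unfolding prime_ends_iff by blast

text \<open>Compact sets in a Hausdorff space are closed. Consequently a filter whose coordinates
  stay in a compact part of the chart image cannot converge to a point outside the chart.\<close>

lemma chart_compact_closedin:
  assumes c: "chart_of X c" and K: "compact K" "K \<subseteq> snd c ` fst c"
  shows "closedin X {y \<in> fst c. snd c y \<in> K}"
proof -
  have U: "openin X (fst c)" and hom: "homeomorphic_map (subtopology X (fst c)) (top_of_set (snd c ` fst c)) (snd c)"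
    using c by (cases c; simp)+
  obtain g where g: "homeomorphic_maps (subtopology X (fst c)) (top_of_set (snd c ` fst c)) (snd c) g"
    using hom homeomorphic_map_maps by blast
  then have cg: "continuous_map (top_of_set (snd c ` fst c)) (subtopology X (fst c)) g"
    and inv: "\<And>y. y \<in> fst c \<Longrightarrow> g (snd c y) = y" and inv': "\<And>q. q \<in> snd c ` fst c \<Longrightarrow> snd c (g q) = q"
    using openin_subset[OF U] unfolding homeomorphic_maps_def by (auto simp: topspace_subtopology_subset)
  have "{y \<in> fst c. snd c y \<in> K} = g ` K"
  proof (intro equalityI subsetI)
    fix y assume "y \<in> {y \<in> fst c. snd c y \<in> K}"
    then show "y \<in> g ` K" using inv[of y] by force
  next
    fix y assume "y \<in> g ` K"
    then obtain q where "q \<in> K" "y = g q" by blast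
    then show "y \<in> {y \<in> fst c. snd c y \<in> K}" using K(2) inv inv' by auto
  qed
  moreover have "compactin (top_of_set (snd c ` fst c)) K"
    using K by (simp add: compactin_subtopology)
  then have "compactin (subtopology X (fst c)) (g ` K)" using image_compactin cg by blast
  then have "compactin X (g ` K)" by (simp add: compactin_subtopology)
  ultimately show ?thesis using compactin_imp_closedin Hausdorff by metis
qed

lemma foot_in_closedin:
  assumes "F \<noteq> bot" "F \<le> nhdsin X x" "x \<in> topspace X" "closedin X C" "eventually (\<lambda>y. y \<in> C) F"
  shows "x \<in> C"
proof (rule ccontr)
  assume "x \<notin> C"
  then have "eventually (\<lambda>y. y \<in> topspace X - C) (nhdsin X x)"
    using assms(3,4) by (intro eventually_nhdsin_openin) (auto simp: closedin_def)
  from filter_leD[OF assms(2) this] assms(5) have "eventually (\<lambda>y. False) F"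
    by eventually_elim blast
  then show False using assms(1) by simp
qed

text \<open>The real blow-up carries the topology of a strict extension of \<open>X - D\<close>: it
  depends only on the set of the trace filters.\<close>

theorem openin_real_blow_up_iff:
  "openin (real_blow_up X A D) G \<longleftrightarrow> G \<subseteq> prime_ends X A D \<and>
    (\<forall>F\<in>G. \<exists>P. eventually P F \<and> (\<forall>F'\<in>prime_ends X A D. eventually P F' \<longrightarrow> F' \<in> G))"
proof
  assume G: "openin (real_blow_up X A D) G"
  have "\<exists>P. eventually P F \<and> (\<forall>F'\<in>prime_ends X A D. eventually P F' \<longrightarrow> F' \<in> G)" if F: "F \<in> G" for F
  proof -
    have "F \<in> prime_ends X A D" using F G unfolding openin_real_blow_up by blast
    then obtain c k m where c: "adapted_chart X A D c k" "m \<in> polar_model D c k" "F = prime_end D c k m"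
      unfolding prime_ends_iff by blast
    note chc = hol_chart_chart_of[OF adapted_hol[OF c(1)]]
    have "openin (top_of_set (polar_model D c k)) {m \<in> polar_model D c k. prime_end D c k m \<in> G}"
      using G c(1) unfolding openin_real_blow_up by blast
    then obtain T where T: "open T" "{m \<in> polar_model D c k. prime_end D c k m \<in> G} = polar_model D c k \<inter> T"
      unfolding openin_open by blast
    have "m \<in> T" using T(2) c F by blast
    then obtain e1 where e1: "0 < e1" "cball m e1 \<subseteq> T" using T(1) open_contains_cball by blast
    have "fst m \<in> snd c ` fst c" using c(2) unfolding polar_model_eq by blast
    then obtain e2 where e2: "0 < e2" "cball (fst m) e2 \<subseteq> snd c ` fst c"
      using chart_ofD(2)[OF chc] open_contains_cball by blast
    \<comment> \<open>One radius for two purposes: polar coordinates in the closed ball remain in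
      \<open>T\<close>, and the feet remain over a compact part of the chart image.\<close>
    define e where "e = min e1 e2"
    have e: "0 < e" "cball m e \<subseteq> T" "cball (fst m) e \<subseteq> snd c ` fst c"
      using e1 e2 by (auto simp: e_def subset_eq)
    let ?P = "\<lambda>y. y \<in> fst c - D \<and> polar k (snd c y) \<in> ball m e"
    have "eventually (\<lambda>y. polar k (snd c y) \<in> ball m e) F"
      unfolding c(3) by (rule topological_tendstoD[OF prime_end_tendsto open_ball]) (use e in simp)
    then have "eventually ?P F" using eventually_conj prime_end_eventually unfolding c(3) by blast
    moreover have "F' \<in> G" if F': "F' \<in> prime_ends X A D" "eventually ?P F'" for F'
    proof -
      note b = prime_ends_basic[OF F'(1)]
      have "eventually (\<lambda>y. y \<in> {y \<in> fst c. snd c y \<in> cball (fst m) e}) F'"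
        using F'(2)
      proof (rule eventually_mono)
        fix y assume y: "y \<in> fst c - D \<and> polar k (snd c y) \<in> ball m e"
        then have "dist (fst m) (fst (polar k (snd c y))) < e"
          using dist_fst_le[of m "polar k (snd c y)"] by (auto intro: le_less_trans)
        then show "y \<in> {y \<in> fst c. snd c y \<in> cball (fst m) e}" using y by (simp add: polar_eq)
      qed
      then have "foot X F' \<in> fst c"
        using foot_in_closedin[OF b(1,2,3) chart_compact_closedin[OF chc compact_cball e(3)]] by blast
      then obtain m' where m': "m' \<in> polar_model D c k" "F' = prime_end D c k m'"
        using prime_ends_in_chart[OF F'(1) c(1)] by blast
      have "m' \<in> cball m e"
      proof (rule Lim_in_closed_set[OF closed_cball _ b(1)])
        show "((\<lambda>x. polar k (snd c x)) \<longlongrightarrow> m') F'" unfolding m'(2) by (rule prime_end_tendsto)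
        show "eventually (\<lambda>x. polar k (snd c x) \<in> cball m e) F'"
          using F'(2) by (rule eventually_mono) auto
      qed
      then show "F' \<in> G" using e(2) T(2) m' by blast
    qed
    ultimately show ?thesis by blast
  qed
  then show "G \<subseteq> prime_ends X A D \<and>
    (\<forall>F\<in>G. \<exists>P. eventually P F \<and> (\<forall>F'\<in>prime_ends X A D. eventually P F' \<longrightarrow> F' \<in> G))"
    using G unfolding openin_real_blow_up by blast
next
  assume G: "G \<subseteq> prime_ends X A D \<and>
    (\<forall>F\<in>G. \<exists>P. eventually P F \<and> (\<forall>F'\<in>prime_ends X A D. eventually P F' \<longrightarrow> F' \<in> G))"
  have "openin (top_of_set (polar_model D c k)) {m \<in> polar_model D c k. prime_end D c k m \<in> G}"
    if c: "adapted_chart X A D c k" for c k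
  proof (subst openin_subopen, intro ballI)
    fix m assume m: "m \<in> {m \<in> polar_model D c k. prime_end D c k m \<in> G}"
    then obtain P where P: "eventually P (prime_end D c k m)"
      "\<And>F'. F' \<in> prime_ends X A D \<Longrightarrow> eventually P F' \<Longrightarrow> F' \<in> G"
      using G by blast
    obtain Q where Q: "eventually Q (nhds m)" "\<And>x. Q (polar k (snd c x)) \<Longrightarrow> x \<in> fst c - D \<longrightarrow> P x"
      using P(1) unfolding prime_end_eq eventually_inf_principal eventually_filtercomap by blast
    obtain T where T: "open T" "m \<in> T" "\<forall>x\<in>T. Q x" using Q(1) unfolding eventually_nhds by blast
    have "prime_end D c k m' \<in> G" if m': "m' \<in> polar_model D c k" "m' \<in> T" for m'
    proof (rule P(2)[OF prime_end_in_prime_ends[OF c m'(1)]])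
      have "eventually (\<lambda>x. polar k (snd c x) \<in> T) (prime_end D c k m')"
        using topological_tendstoD[OF prime_end_tendsto T(1) m'(2)] .
      with prime_end_eventually[of c D k m'] show "eventually P (prime_end D c k m')"
        by eventually_elim (use Q(2) T(3) in blast)
    qed
    then show "\<exists>S. openin (top_of_set (polar_model D c k)) S \<and> m \<in> S \<and>
        S \<subseteq> {m \<in> polar_model D c k. prime_end D c k m \<in> G}"
      using T m by (intro exI[of _ "polar_model D c k \<inter> T"]) auto
  qed
  then show "openin (real_blow_up X A D) G" using G unfolding openin_real_blow_up by blast
qed

end

section \<open>Boundary points in adapted charts\<close>

declare prime_end.simps [simp del] polar_model.simps [simp del]

text \<open>One equation covers both cases of a blown-up coordinate: \<open>a = norm a * s\<close>
  leaves the unit vector \<open>s\<close> free at \<open>a = 0\<close> and forces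
  \<open>sgn a\<close> elsewhere. \<open>B\<close> tells whether the coordinate is blown up; if not,
  the angle has the dummy value 1.\<close>

definition ang :: "bool \<Rightarrow> complex \<Rightarrow> complex \<Rightarrow> bool"
  where "ang B a s \<longleftrightarrow> (if B then norm s = 1 \<and> a = of_real (norm a) * s else s = 1)"

lemma ang_True_0 [simp]: "ang True 0 s \<longleftrightarrow> norm s = 1"
  by (simp add: ang_def)

lemma ang_False [simp]: "ang False a s \<longleftrightarrow> s = 1"
  by (simp add: ang_def)

lemma ang_True_nonzero:
  assumes "a \<noteq> 0"
  shows "ang True a s \<longleftrightarrow> s = sgn a"
proof
  assume "ang True a s"
  then have "a = of_real (norm a) * s" by (simp add: ang_def)
  then have "s = a / of_real (norm a)" using assms by (simp add: eq_divide_eq mult.commute)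
  then show "s = sgn a" by (simp add: sgn_eq)
next
  assume "s = sgn a"
  then show "ang True a s" using assms by (simp add: ang_def norm_sgn) (simp add: sgn_eq)
qed

lemma ang_True_norm: "ang True a s \<Longrightarrow> norm s = 1"
  and ang_True_eq: "ang True a s \<Longrightarrow> a = of_real (norm a) * s"
  by (simp_all add: ang_def)

text \<open>Since \<open>a\<close> is a nonnegative multiple of \<open>s\<close>, moving in the
  direction \<open>s\<close> leaves the divisor at once and keeps the angle constant.\<close>

lemma ang_sgn_add:
  assumes "ang True a s" "0 < t"
  shows "a + of_real t * s \<noteq> 0" "sgn (a + of_real t * s) = s"
proof -
  have s: "norm s = 1" "s \<noteq> 0" using assms(1) by (auto simp: ang_def)
  have eq: "a + of_real t * s = of_real (norm a + t) * s"
    using ang_True_eq[OF assms(1)] by (simp add: algebra_simps)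
  have pos: "norm a + t > 0" using assms(2) by (simp add: add_nonneg_pos)
  show "a + of_real t * s \<noteq> 0" unfolding eq using pos s by (simp del: of_real_add)
  show "sgn (a + of_real t * s) = s"
    unfolding eq sgn_mult sgn_of_real using pos s by (simp add: sgn_eq)
qed

lemma ang_tendsto:
  fixes f :: "'x \<Rightarrow> complex"
  assumes "F \<noteq> bot" "(f \<longlongrightarrow> a) F" "((\<lambda>x. sgn (f x)) \<longlongrightarrow> s) F" "eventually (\<lambda>x. f x \<noteq> 0) F"
  shows "ang True a s"
proof -
  have "((\<lambda>x. norm (sgn (f x))) \<longlongrightarrow> norm s) F" by (intro tendsto_norm assms)
  moreover have "eventually (\<lambda>x. norm (sgn (f x)) = 1) F"
    using assms(4) by (rule eventually_mono) (simp add: norm_sgn)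
  ultimately have "((\<lambda>x. 1) \<longlongrightarrow> norm s) F" by (rule Lim_transform_eventually)
  then have "norm s = 1" using tendsto_unique[OF assms(1) _ tendsto_const] by blast
  moreover have "((\<lambda>x. of_real (norm (f x)) * sgn (f x)) \<longlongrightarrow> of_real (norm a) * s) F"
    by (intro tendsto_mult tendsto_of_real tendsto_norm assms)
  then have "(f \<longlongrightarrow> of_real (norm a) * s) F" by (simp add: sgn_eq)
  then have "a = of_real (norm a) * s" using tendsto_unique[OF assms(1,2)] by blast
  ultimately show ?thesis by (simp add: ang_def)
qed

section \<open>Explicit local models and the rotation over ordinary points\<close>

context cx_surface
begin

lemma adapted_iff:
  "adapted_chart X A D c k \<longleftrightarrow> hol_chart X A c \<and> (\<forall>x\<in>fst c. x \<in> D \<longleftrightarrow> snd c x \<in> local_divisor k)"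
proof
  assume "adapted_chart X A D c k"
  then show "hol_chart X A c \<and> (\<forall>x\<in>fst c. x \<in> D \<longleftrightarrow> snd c x \<in> local_divisor k)"
    using adapted_in_D_iff adapted_hol by blast
next
  assume "hol_chart X A c \<and> (\<forall>x\<in>fst c. x \<in> D \<longleftrightarrow> snd c x \<in> local_divisor k)"
  then show "adapted_chart X A D c k" unfolding adapted_chart_def by auto
qed

lemma chart_preimage_openin:
  assumes c: "chart_of X c" and T: "open T"
  shows "openin X {y \<in> fst c. snd c y \<in> T}"
proof (subst openin_subopen, intro ballI)
  fix y assume y: "y \<in> {y \<in> fst c. snd c y \<in> T}"
  have "eventually (\<lambda>y. snd c y \<in> T) (nhdsin X y)"
    using chart_eventually[OF c, of y "\<lambda>q. q \<in> T"] eventually_nhds_in_open[OF T, of "snd c y"] y by simp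
  moreover have "eventually (\<lambda>y. y \<in> fst c) (nhdsin X y)"
    using eventually_nhdsin_openin[OF chart_ofD(1)[OF c], of y] y by simp
  ultimately have "eventually (\<lambda>y. y \<in> {y \<in> fst c. snd c y \<in> T}) (nhdsin X y)"
    by eventually_elim simp
  then obtain S where S: "openin X S" "y \<in> S" "\<forall>z\<in>S. z \<in> {y \<in> fst c. snd c y \<in> T}"
    using chart_ofD(6)[OF c, of y] y by (auto simp: eventually_nhdsin)
  then show "\<exists>S. openin X S \<and> y \<in> S \<and> S \<subseteq> {y \<in> fst c. snd c y \<in> T}" by blast
qed

text \<open>The closure in the local model, made explicit. Limits of points off \<open>D\<close>
  satisfy \<open>ang\<close> by \<open>ang_tendsto\<close>; conversely, a point satisfying it is
  approached along the ray \<open>p\<close>, on which the angles are constant.\<close>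

lemma polar_model_iff:
  assumes c: "adapted_chart X A D c k"
  shows "m \<in> polar_model D c k \<longleftrightarrow> fst m \<in> snd c ` fst c \<and>
    ang (k = Crossing) (fst (fst m)) (fst (snd m)) \<and> ang (k \<noteq> Away) (snd (fst m)) (snd (snd m))"
proof
  assume m: "m \<in> polar_model D c k"
  let ?F = "prime_end D c k m"
  have nb: "?F \<noteq> bot" by (rule prime_end_not_bot[OF m])
  note lim = prime_end_tendsto_components[where F = "prime_end D c k m", OF order_refl]
  have ne: "eventually (\<lambda>x. f x \<noteq> 0) ?F" if "f \<in> blown k c" for f
    using prime_end_eventually[of c D k m] by (rule eventually_mono) (use adapted_blown[OF c] that in blast)
  have 1: "ang (k = Crossing) (fst (fst m)) (fst (snd m))"
  proof (cases "k = Crossing")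
    case True
    have "ang True (fst (fst m)) (fst (snd m))"
      using ang_tendsto[OF nb tendsto_fst[OF lim(1)] lim(2)[OF True] ne] True by simp
    then show ?thesis using True by simp
  next
    case False
    have "((\<lambda>x. 1) \<longlongrightarrow> fst (snd m)) ?F"
      using tendsto_fst[OF tendsto_snd[OF prime_end_tendsto[of k c m D]]] False by (simp add: polar_eq)
    then show ?thesis using False tendsto_unique[OF nb _ tendsto_const] by simp
  qed
  have 2: "ang (k \<noteq> Away) (snd (fst m)) (snd (snd m))"
  proof (cases "k = Away")
    case False
    have "(\<lambda>y. snd (snd c y)) \<in> blown k c" using False by (cases k) auto
    then have "ang True (snd (fst m)) (snd (snd m))"
      using ang_tendsto[OF nb tendsto_snd[OF lim(1)] lim(3)[OF False] ne] by simp
    then show ?thesis using False by simp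
  next
    case True
    have "((\<lambda>x. 1) \<longlongrightarrow> snd (snd m)) ?F"
      using tendsto_snd[OF tendsto_snd[OF prime_end_tendsto[of k c m D]]] True by (simp add: polar_eq)
    then show ?thesis using True tendsto_unique[OF nb _ tendsto_const] by simp
  qed
  show "fst m \<in> snd c ` fst c \<and> ang (k = Crossing) (fst (fst m)) (fst (snd m)) \<and>
      ang (k \<noteq> Away) (snd (fst m)) (snd (snd m))"
    using 1 2 m unfolding polar_model_eq by blast
next
  assume "fst m \<in> snd c ` fst c \<and> ang (k = Crossing) (fst (fst m)) (fst (snd m)) \<and>
      ang (k \<noteq> Away) (snd (fst m)) (snd (snd m))"
  moreover obtain a b s1 s2 where m: "m = ((a, b), (s1, s2))" by (metis prod.collapse)
  ultimately have ab: "(a, b) \<in> snd c ` fst c"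
    and s: "ang (k = Crossing) a s1" "ang (k \<noteq> Away) b s2" by auto
  note chc = hol_chart_chart_of[OF adapted_hol[OF c]]
  \<comment> \<open>Only blown-up coordinates move, each in the direction of its own angle.\<close>
  define p where "p = (\<lambda>t. (a + of_real t * (if k = Crossing then s1 else 0), b + of_real t * (if k = Away then 0 else s2)))"
  have "(p \<longlongrightarrow> (a + of_real 0 * (if k = Crossing then s1 else 0), b + of_real 0 * (if k = Away then 0 else s2))) (at_right 0)"
    unfolding p_def by (intro tendsto_intros)
  then have p: "(p \<longlongrightarrow> (a, b)) (at_right 0)" by simp
  have pos: "eventually (\<lambda>t::real. 0 < t) (at_right 0)" by (simp add: eventually_at_right_less)
  have pol: "polar k (p t) = (p t, (s1, s2))" "p t \<notin> local_divisor k" if "0 < t" for t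
    using that ang_sgn_add[of a s1 t] ang_sgn_add[of b s2 t] s by (cases k; simp add: p_def polar_eq)+
  have "((\<lambda>t. (p t, (s1, s2))) \<longlongrightarrow> m) (at_right 0)" unfolding m by (intro tendsto_intros p)
  moreover have "eventually (\<lambda>t. (p t, (s1, s2)) \<in> closure ((\<lambda>x. polar k (snd c x)) ` (fst c - D))) (at_right 0)"
    using pos topological_tendstoD[OF p chart_ofD(2)[OF chc] ab]
  proof eventually_elim
    case (elim t)
    then obtain x where x: "x \<in> fst c" "p t = snd c x" by blast
    have "x \<notin> D" using adapted_in_D_iff[OF c x(1)] pol(2)[OF elim(1)] x(2) by simp
    then have "polar k (snd c x) \<in> (\<lambda>x. polar k (snd c x)) ` (fst c - D)" using x(1) by blast
    from subsetD[OF closure_subset this] show ?case using pol(1)[OF elim(1)] x(2) by simp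
  qed
  ultimately have "m \<in> closure ((\<lambda>x. polar k (snd c x)) ` (fst c - D))"
    by (intro Lim_in_closed_set[OF closed_closure _ trivial_limit_at_right_real])
  then show "m \<in> polar_model D c k" unfolding polar_model_eq using ab m by simp
qed

text \<open>Shrinking the domain around the foot changes neither the polar coordinates nor their
  limit, only the set on which the trace is taken.\<close>

lemma prime_end_subchart:
  assumes c: "adapted_chart X A D c k" "m \<in> polar_model D c k"
    and c': "adapted_chart X A D c' k'" "foot X (prime_end D c k m) \<in> fst c'"
    and eq: "\<And>y. y \<in> fst c' \<Longrightarrow> y \<in> fst c \<and> snd c y = snd c' y" "k' = k"
  shows "m \<in> polar_model D c' k" "prime_end D c' k m = prime_end D c k m"
proof -
  obtain m' where m': "m' \<in> polar_model D c' k'" "prime_end D c k m = prime_end D c' k' m'"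
    using prime_end_change_chart[OF c c'] by blast
  let ?F = "prime_end D c' k' m'"
  have "?F \<le> prime_end D c k m'"
    unfolding le_prime_end_iff
  proof
    show "eventually (\<lambda>x. x \<in> fst c - D) ?F"
      using prime_end_eventually by (rule eventually_mono) (use eq(1) in blast)
    show "((\<lambda>x. polar k (snd c x)) \<longlongrightarrow> m') ?F"
    proof (rule Lim_transform_eventually[OF prime_end_tendsto])
      show "eventually (\<lambda>x. polar k' (snd c' x) = polar k (snd c x)) ?F"
        using prime_end_eventually by (rule eventually_mono) (simp add: eq)
    qed
  qed
  then have "m' = m"
    using prime_end_unique[OF prime_end_not_bot[OF m'(1)]] m'(2) by (metis order_refl)
  then show "m \<in> polar_model D c' k" "prime_end D c' k m = prime_end D c k m"
    using m' eq(2) by simp_all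
qed

lemma adapted_restrict:
  assumes "adapted_chart X A D c k" "openin X S"
  shows "adapted_chart X A D (fst c \<inter> S, snd c) k"
  using assms hol_chart_restrict unfolding adapted_iff by auto

lemma adapted_swap:
  assumes "adapted_chart X A D c Crossing"
  shows "adapted_chart X A D (fst c, \<lambda>x. prod.swap (snd c x)) Crossing"
proof -
  have "prod.swap q \<in> local_divisor Crossing \<longleftrightarrow> q \<in> local_divisor Crossing" for q
    by (cases q) auto
  then show ?thesis using assms hol_chart_swap unfolding adapted_iff by simp
qed

lemma prime_end_swap:
  fixes c :: "'a chart"
  shows "prime_end D (fst c, \<lambda>x. prod.swap (snd c x)) Crossing ((b, a), (t, s)) = prime_end D c Crossing ((a, b), (s, t))"
proof -
  have le: "prime_end D c Crossing ((a, b), (s, t)) \<le> prime_end D (fst c, \<lambda>x. prod.swap (snd c x)) Crossing ((b, a), (t, s))"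
    for c :: "'a chart" and a b s t
  proof -
    let ?F = "prime_end D c Crossing ((a, b), (s, t))"
    note lim = prime_end_tendsto_components[where F = "prime_end D c Crossing ((a, b), (s, t))", OF order_refl, simplified]
    show ?thesis
      unfolding le_prime_end_iff
    proof
      have "((\<lambda>x. prod.swap (snd c x)) \<longlongrightarrow> (b, a)) ?F"
        unfolding prod.swap_def using tendsto_Pair[OF tendsto_snd[OF lim(1)] tendsto_fst[OF lim(1)]] by simp
      then show "((\<lambda>x. polar Crossing (snd (fst c, \<lambda>x. prod.swap (snd c x)) x)) \<longlongrightarrow> ((b, a), (t, s))) ?F"
        unfolding polar_eq using lim(2,3) by (auto intro!: tendsto_Pair)
    qed (use prime_end_eventually[of c D Crossing "((a, b), (s, t))"] in simp)
  qed
  show ?thesis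
  proof (rule antisym)
    show "prime_end D (fst c, \<lambda>x. prod.swap (snd c x)) Crossing ((b, a), (t, s)) \<le> prime_end D c Crossing ((a, b), (s, t))"
      using le[of "(fst c, \<lambda>x. prod.swap (snd c x))" b a t s] by simp
  qed (rule le)
qed

text \<open>Where the first coordinate is nonzero, the crossing chart is a smooth one, and the first
  angle carries no information, being \<open>sgn a\<close>. One chart \<open>c'\<close> serves all
  angles because a rotated point has to be read in the same chart.\<close>

lemma crossing_as_smooth:
  assumes c: "adapted_chart X A D c Crossing" and m: "((a, 0), (s, t)) \<in> polar_model D c Crossing" and a: "a \<noteq> 0"
  obtains c' where "adapted_chart X A D c' Smooth"
    "\<forall>s t. ((a, 0), (s, t)) \<in> polar_model D c Crossing \<longrightarrow>
      ((a, 0), (1, t)) \<in> polar_model D c' Smooth \<and>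
      prime_end D c Crossing ((a, 0), (s, t)) = prime_end D c' Smooth ((a, 0), (1, t))"
proof -
  note chc = hol_chart_chart_of[OF adapted_hol[OF c]]
  define S where "S = {y \<in> fst c. snd c y \<in> - {w. fst w = 0}}"
  have "closed {w :: complex \<times> complex. fst w = 0}" by (intro closed_Collect_eq continuous_intros)
  then have S: "openin X S" unfolding S_def by (intro chart_preimage_openin[OF chc]) auto
  let ?c = "(fst c \<inter> S, snd c)"
  have c': "adapted_chart X A D ?c Smooth"
    unfolding adapted_iff
  proof (intro conjI ballI)
    show "hol_chart X A ?c" using hol_chart_restrict[OF adapted_hol[OF c] S] .
    fix x assume "x \<in> fst ?c"
    then have x: "x \<in> fst c" "fst (snd c x) \<noteq> 0" by (auto simp: S_def)
    then show "x \<in> D \<longleftrightarrow> snd ?c x \<in> local_divisor Smooth"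
      using adapted_in_D_iff[OF c x(1)] by (cases "snd c x") auto
  qed
  show thesis
  proof (rule that[OF c'], intro allI impI)
    fix s t assume m: "((a, 0), (s, t)) \<in> polar_model D c Crossing"
    then have "(a, 0) \<in> snd c ` fst c" "norm t = 1" unfolding polar_model_iff[OF c] by auto
    then have m': "((a, 0), (1, t)) \<in> polar_model D ?c Smooth"
    proof -
      obtain y where "y \<in> fst c" "snd c y = (a, 0)" using \<open>(a, 0) \<in> snd c ` fst c\<close> by force
      then have "(a, 0) \<in> snd c ` (fst c \<inter> S)" using a by (intro image_eqI[of _ _ y]) (auto simp: S_def)
      then show ?thesis unfolding polar_model_iff[OF c'] using \<open>norm t = 1\<close> by simp
    qed
    let ?F = "prime_end D ?c Smooth ((a, 0), (1, t))"
    note lim = prime_end_tendsto_components[where F = "prime_end D ?c Smooth ((a, 0), (1, t))", OF order_refl, simplified]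
    have s: "s = sgn a" using m a unfolding polar_model_iff[OF c] by (simp add: ang_True_nonzero)
    have "?F \<le> prime_end D c Crossing ((a, 0), (s, t))"
      unfolding le_prime_end_iff
    proof
      show "eventually (\<lambda>x. x \<in> fst c - D) ?F"
        using prime_end_eventually by (rule eventually_mono) auto
      have "((\<lambda>y. sgn (fst (snd c y))) \<longlongrightarrow> s) ?F"
        unfolding s using tendsto_sgn[OF tendsto_fst[OF lim(1)]] a by simp
      then show "((\<lambda>x. polar Crossing (snd c x)) \<longlongrightarrow> ((a, 0), (s, t))) ?F"
        unfolding polar_eq using lim by (auto intro!: tendsto_Pair)
    qed
    then have "?F = prime_end D c Crossing ((a, 0), (s, t))"
      using prime_ends_unique[OF prime_end_not_bot[OF m'] order_refl] prime_end_in_prime_ends[OF c' m']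
        prime_end_in_prime_ends[OF c m] by blast
    then show "((a, 0), (1, t)) \<in> polar_model D ?c Smooth \<and>
      prime_end D c Crossing ((a, 0), (s, t)) = prime_end D ?c Smooth ((a, 0), (1, t))"
      using m' by simp
  qed
qed

text \<open>The definite description is independent of the chart: the two equations have a quotient
  with limit \<open>u\<close>, so the angles differ by the constant \<open>sgn u\<close>, which
  commutes with multiplication by \<open>cis \<Theta>\<close>. The rotated filter has the same foot
  and hence the same \<open>u\<close>.\<close>

lemma canonical_rotation_smooth:
  assumes c: "adapted_chart X A D c Smooth" and m: "((a, 0), (1, s)) \<in> polar_model D c Smooth"
  shows "canonical_rotation X A D \<Theta> (prime_end D c Smooth ((a, 0), (1, s))) =
    prime_end D c Smooth ((a, 0), (1, cis \<Theta> * s))"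
  unfolding canonical_rotation_def
proof (rule the_equality)
  show "\<exists>c' w1 s'. adapted_chart X A D c' Smooth \<and> ((w1, 0), (1, s')) \<in> polar_model D c' Smooth \<and>
    prime_end D c Smooth ((a, 0), (1, s)) = prime_end D c' Smooth ((w1, 0), (1, s')) \<and>
    prime_end D c Smooth ((a, 0), (1, cis \<Theta> * s)) = prime_end D c' Smooth ((w1, 0), (1, cis \<Theta> * s'))"
    using c m by blast
next
  let ?F = "prime_end D c Smooth ((a, 0), (1, s))" and ?G = "prime_end D c Smooth ((a, 0), (1, cis \<Theta> * s))"
  fix H assume "\<exists>c' w1 s'. adapted_chart X A D c' Smooth \<and> ((w1, 0), (1, s')) \<in> polar_model D c' Smooth \<and>
    ?F = prime_end D c' Smooth ((w1, 0), (1, s')) \<and> H = prime_end D c' Smooth ((w1, 0), (1, cis \<Theta> * s'))"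
  then obtain d b t where d: "adapted_chart X A D d Smooth" "((b, 0), (1, t)) \<in> polar_model D d Smooth"
    "?F = prime_end D d Smooth ((b, 0), (1, t))" "H = prime_end D d Smooth ((b, 0), (1, cis \<Theta> * t))"
    by blast
  have rot: "((a, 0), (1, cis \<Theta> * s)) \<in> polar_model D c Smooth"
    "((b, 0), (1, cis \<Theta> * t)) \<in> polar_model D d Smooth"
    using m d(2) unfolding polar_model_iff[OF c] polar_model_iff[OF d(1)] by (auto simp: norm_mult)
  obtain x where x: "x \<in> fst c" "snd c x = (a, 0)" "?F \<le> nhdsin X x" "foot X ?F = x"
    using model_foot[OF c m] by auto
  obtain x' where x': "x' \<in> fst d" "snd d x' = (b, 0)" "foot X ?F = x'"
    using model_foot[OF d(1,2)] d(3) by auto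
  obtain y where y: "y \<in> fst c" "snd c y = (a, 0)" "?G \<le> nhdsin X y"
    using model_foot[OF c rot(1)] by auto
  have eq: "x' = x" "y = x"
    using x(4) x'(3) inj_onD[OF chart_ofD(3)[OF hol_chart_chart_of[OF adapted_hol[OF c]]] _ y(1) x(1)] x(2) y(2)
    by simp_all
  let ?f = "\<lambda>y. snd (snd d y)" and ?e = "\<lambda>y. snd (snd c y)"
  have ev: "eventually (\<lambda>y. ?e y = 0 \<longrightarrow> ?f y = 0) (nhdsin X x)"
  proof -
    obtain e where "e \<in> blown Smooth c" "eventually (\<lambda>y. e y = 0 \<longrightarrow> ?f y = 0) (nhdsin X x)"
      using adapted_branch[OF d(1) x'(1)[unfolded eq] c x(1), of ?f] x'(2) eq by auto
    then show ?thesis by simp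
  qed
  have ex: "?e x = 0" using x(2) by simp
  have xd: "x \<in> fst d" using x'(1) eq by simp
  obtain u where u: "u \<noteq> 0" "((\<lambda>y. ?f y / ?e y) \<longlongrightarrow> u) (inf (nhdsin X x) (principal {y. ?e y \<noteq> 0}))"
    using coord_divide_tendsto[OF coord_snd[OF adapted_hol[OF d(1)] xd] coord_snd[OF adapted_hol[OF c] x(1)] ex ev]
    by blast
  \<comment> \<open>Stated for an arbitrary angle \<open>r\<close>, since it is applied both to the
    given filter and to the rotated one.\<close>
  have lim: "((\<lambda>y. sgn (?f y)) \<longlongrightarrow> sgn u * r) E"
    if E: "E \<le> nhdsin X x" "E \<le> prime_end D c Smooth ((a, 0), (1, r))" for E r
  proof -
    have "eventually (\<lambda>y. y \<in> fst c - D) E" using E(2) unfolding le_prime_end_iff by blast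
    then have ne: "eventually (\<lambda>y. ?e y \<noteq> 0) E"
      by (rule eventually_mono) (use adapted_blown[OF c] in auto)
    then have "E \<le> inf (nhdsin X x) (principal {y. ?e y \<noteq> 0})"
      using E(1) by (simp add: le_principal)
    from filterlim_mono[OF u(2) order_refl this]
    have "((\<lambda>y. sgn (?f y / ?e y) * sgn (?e y)) \<longlongrightarrow> sgn u * r) E"
      using prime_end_tendsto_components(3)[OF E(2)] by (intro tendsto_mult tendsto_sgn u(1)) simp_all
    moreover have "eventually (\<lambda>y. sgn (?f y / ?e y) * sgn (?e y) = sgn (?f y)) E"
      using ne by (rule eventually_mono) (simp only: sgn_mult[symmetric], simp)
    ultimately show ?thesis by (rule Lim_transform_eventually)
  qed
  have "((\<lambda>y. sgn (?f y)) \<longlongrightarrow> t) ?F"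
    using prime_end_tendsto_components(3)[of ?F D d Smooth "((b, 0), (1, t))"] d(3) by simp
  then have t: "t = sgn u * s"
    using tendsto_unique[OF prime_end_not_bot[OF m] _ lim[OF x(3) order_refl]] by blast
  have "((\<lambda>y. sgn (?f y)) \<longlongrightarrow> cis \<Theta> * t) ?G"
    using lim[OF y(3)[unfolded eq] order_refl] by (simp add: t mult_ac)
  moreover have "eventually (\<lambda>y. y \<notin> D) ?G"
    using prime_end_eventually by (rule eventually_mono) blast
  ultimately have "?G \<le> H"
    using le_prime_endI(2)[OF prime_end_not_bot[OF rot(1)] y(3)[unfolded eq] _ d(1), of 1 "cis \<Theta> * t"] x' eq
    unfolding d(4) by simp
  then show "H = ?G"
    using prime_ends_unique[OF prime_end_not_bot[OF rot(1)] _ order_refl, of H]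
      prime_end_in_prime_ends[OF c rot(1)] prime_end_in_prime_ends[OF d(1) rot(2)] d(4) by simp
qed

lemma canonical_rotation_crossing_fst:
  assumes c: "adapted_chart X A D c Crossing" and m: "((a, 0), (s, t)) \<in> polar_model D c Crossing" and a: "a \<noteq> 0"
  shows "canonical_rotation X A D \<Theta> (prime_end D c Crossing ((a, 0), (s, t))) =
    prime_end D c Crossing ((a, 0), (s, cis \<Theta> * t))"
proof -
  obtain c' where c': "adapted_chart X A D c' Smooth"
    "\<forall>s t. ((a, 0), (s, t)) \<in> polar_model D c Crossing \<longrightarrow>
      ((a, 0), (1, t)) \<in> polar_model D c' Smooth \<and>
      prime_end D c Crossing ((a, 0), (s, t)) = prime_end D c' Smooth ((a, 0), (1, t))"
    using crossing_as_smooth[OF assms] by blast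
  have "((a, 0), (s, cis \<Theta> * t)) \<in> polar_model D c Crossing"
    using m unfolding polar_model_iff[OF c] by (auto simp: norm_mult)
  then show ?thesis using c'(2) canonical_rotation_smooth[OF c'(1)] m by simp
qed

lemma polar_model_swap:
  assumes c: "adapted_chart X A D c Crossing"
  shows "((b, a), (t, s)) \<in> polar_model D (fst c, \<lambda>x. prod.swap (snd c x)) Crossing \<longleftrightarrow>
    ((a, b), (s, t)) \<in> polar_model D c Crossing"
proof -
  have "(b, a) \<in> (\<lambda>x. prod.swap (snd c x)) ` fst c \<longleftrightarrow> (a, b) \<in> snd c ` fst c"
    by (auto simp: image_iff prod_eq_iff)
  then show ?thesis unfolding polar_model_iff[OF c] polar_model_iff[OF adapted_swap[OF c]] by auto
qed

lemma canonical_rotation_crossing_snd: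
  assumes c: "adapted_chart X A D c Crossing" and m: "((0, b), (s, t)) \<in> polar_model D c Crossing" and b: "b \<noteq> 0"
  shows "canonical_rotation X A D \<Theta> (prime_end D c Crossing ((0, b), (s, t))) =
    prime_end D c Crossing ((0, b), (cis \<Theta> * s, t))"
  using canonical_rotation_crossing_fst[OF adapted_swap[OF c] _ b, of t s \<Theta>] m
  unfolding prime_end_swap polar_model_swap[OF c] by simp

lemma crossing_ordinary:
  assumes c: "adapted_chart X A D c Crossing" "x \<in> fst c" "snd c x = (a, 0)" "a \<noteq> 0"
  obtains c' where "adapted_chart X A D c' Smooth" "x \<in> fst c'"
proof -
  note chc = hol_chart_chart_of[OF adapted_hol[OF c(1)]]
  \<comment> \<open>An auxiliary boundary point over \<open>x\<close>: its foot, read in both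
    charts, shows that \<open>x\<close> lies in the domain of \<open>c'\<close>.\<close>
  have m: "((a, 0), (sgn a, 1)) \<in> polar_model D c Crossing"
    unfolding polar_model_iff[OF c(1)] using c by (force simp: ang_True_nonzero)
  obtain c' where c'': "adapted_chart X A D c' Smooth"
    "\<forall>s t. ((a, 0), (s, t)) \<in> polar_model D c Crossing \<longrightarrow>
      ((a, 0), (1, t)) \<in> polar_model D c' Smooth \<and>
      prime_end D c Crossing ((a, 0), (s, t)) = prime_end D c' Smooth ((a, 0), (1, t))"
    using crossing_as_smooth[OF c(1) m c(4)] by blast
  then have c': "adapted_chart X A D c' Smooth" "((a, 0), (1, 1)) \<in> polar_model D c' Smooth"
    "prime_end D c Crossing ((a, 0), (sgn a, 1)) = prime_end D c' Smooth ((a, 0), (1, 1))"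
    using m by auto
  obtain y where y: "y \<in> fst c" "snd c y = (a, 0)" "foot X (prime_end D c Crossing ((a, 0), (sgn a, 1))) = y"
    using model_foot[OF c(1) m] by auto
  have "y = x" using inj_onD[OF chart_ofD(3)[OF chc] _ y(1) c(2)] y(2) c(3) by simp
  with y(3) have "foot X (prime_end D c Crossing ((a, 0), (sgn a, 1))) = x" by simp
  moreover obtain y' where "y' \<in> fst c'" "foot X (prime_end D c' Smooth ((a, 0), (1, 1))) = y'"
    using model_foot[OF c'(1,2)] by auto
  ultimately show thesis using that[OF c'(1)] c'(3) by simp
qed

text \<open>Forward, a chart of the only branch through \<open>x\<close> is shrunk so that it misses
  the other branches, which are finitely many and relatively closed. Backward, \<open>D\<close> has
  a single branch in the domain of the chart.\<close>

lemma ordinary_point_iff: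
  "ordinary_point X A D x \<longleftrightarrow> x \<in> D \<and> (\<exists>c. adapted_chart X A D c Smooth \<and> x \<in> fst c)"
proof
  assume "ordinary_point X A D x"
  then obtain N \<C> where N: "x \<in> N" "nc_branches X A D N \<C>" "card {C \<in> \<C>. x \<in> C} = 1"
    unfolding ordinary_point_def by blast
  have br: "openin X N" "finite \<C>" "D \<inter> N = \<Union>\<C>" "\<And>C. C \<in> \<C> \<Longrightarrow> smooth_curve_in X A N C"
    using N(2) unfolding nc_branches_def by simp_all
  obtain C0 where C0: "{C \<in> \<C>. x \<in> C} = {C0}" using N(3) card_1_singletonE by metis
  then have C0': "C0 \<in> \<C>" "x \<in> C0" by blast+
  obtain c where c: "hol_chart X A c" "x \<in> fst c" "snd c ` (C0 \<inter> fst c) = {w \<in> snd c ` fst c. snd w = 0}"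
    using br(4)[OF C0'(1)] C0'(2) unfolding smooth_curve_in_def curve_chart_def by blast
  define S where "S = N \<inter> ((\<Inter>C\<in>\<C> - {C0}. N - C) \<inter> topspace X)"
  have "openin X (N - C)" if "C \<in> \<C>" for C
  proof -
    have "closedin (subtopology X N) C" using br(4)[OF that] unfolding smooth_curve_in_def by blast
    then have "openin (subtopology X N) (topspace (subtopology X N) - C)" unfolding closedin_def by blast
    then show ?thesis using br(1) openin_subset[OF br(1)]
      by (simp add: openin_open_subtopology inf.absorb2)
  qed
  then have S: "openin X S"
    unfolding S_def using br(1,2) by (intro openin_Int openin_INT) auto
  have xS: "x \<in> S" unfolding S_def using N(1) C0 openin_subset[OF br(1)] by blast
  have "adapted_chart X A D (fst c \<inter> S, snd c) Smooth"
    unfolding adapted_iff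
  proof (intro conjI ballI)
    show "hol_chart X A (fst c \<inter> S, snd c)" using hol_chart_restrict[OF c(1) S] .
    fix y assume "y \<in> fst (fst c \<inter> S, snd c)"
    then have y: "y \<in> fst c" "y \<in> S" by auto
    have "y \<in> N" "\<And>C. C \<in> \<C> \<Longrightarrow> C \<noteq> C0 \<Longrightarrow> y \<notin> C" using y(2) unfolding S_def by blast+
    then have "y \<in> D \<longleftrightarrow> y \<in> C0" using br(3) C0'(1) by blast
    also have "\<dots> \<longleftrightarrow> snd c y \<in> snd c ` (C0 \<inter> fst c)"
      using inj_on_image_mem_iff[OF chart_ofD(3)[OF hol_chart_chart_of[OF c(1)]] y(1), of "C0 \<inter> fst c"] y by auto
    also have "\<dots> \<longleftrightarrow> snd (snd c y) = 0" unfolding c(3) using y(1) by blast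
    finally show "y \<in> D \<longleftrightarrow> snd (fst c \<inter> S, snd c) y \<in> local_divisor Smooth" by (cases "snd c y") simp
  qed
  moreover have "x \<in> D" using C0' br(3) by blast
  ultimately show "x \<in> D \<and> (\<exists>c. adapted_chart X A D c Smooth \<and> x \<in> fst c)"
    using c(2) xS by (intro conjI exI[of _ "(fst c \<inter> S, snd c)"]) auto
next
  assume "x \<in> D \<and> (\<exists>c. adapted_chart X A D c Smooth \<and> x \<in> fst c)"
  then obtain c where x: "x \<in> D" and c: "adapted_chart X A D c Smooth" "x \<in> fst c" by blast
  note chc = hol_chart_chart_of[OF adapted_hol[OF c(1)]]
  let ?C = "D \<inter> fst c"
  have img: "snd c ` (?C \<inter> fst c) = {w \<in> snd c ` fst c. snd w = 0}"
    using adapted_in_D_iff[OF c(1)] by force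
  have "openin X {y \<in> fst c. snd c y \<in> - {w. snd w = 0}}"
  proof (rule chart_preimage_openin[OF chc])
    have "closed {w :: complex \<times> complex. snd w = 0}" by (intro closed_Collect_eq continuous_intros)
    then show "open (- {w :: complex \<times> complex. snd w = 0})" by auto
  qed
  moreover have "{y \<in> fst c. snd c y \<in> - {w. snd w = 0}} = fst c - ?C"
    using adapted_in_D_iff[OF c(1)] by force
  ultimately have "openin X (fst c - ?C)" by simp
  then have "closedin (subtopology X (fst c)) ?C"
    unfolding closedin_def using chart_ofD(1)[OF chc] openin_subset[OF chart_ofD(1)[OF chc]]
    by (simp add: openin_open_subtopology inf.absorb2)
  then have "smooth_curve_in X A (fst c) ?C"
    unfolding smooth_curve_in_def curve_chart_def using adapted_hol[OF c(1)] img by blast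
  moreover have one: "{C \<in> {?C}. y \<in> C} = (if y \<in> ?C then {?C} else {})" for y by auto
  ultimately have "nc_branches X A D (fst c) {?C}"
    unfolding nc_branches_def using chart_ofD(1)[OF chc] by (auto simp: one)
  moreover have "card {C \<in> {?C}. x \<in> C} = 1" unfolding one using x c(2) by simp
  ultimately show "ordinary_point X A D x" unfolding ordinary_point_def using c(2) by blast
qed

lemma crossing_not_ordinary:
  assumes "adapted_chart X A D c Crossing" "x \<in> fst c" "snd c x = (0, 0)"
  shows "\<not> ordinary_point X A D x"
  using crossing_point_unique[OF assms] unfolding ordinary_point_iff by blast

end

section \<open>Homeomorphisms induced by maps of the complements\<close>

lemma continuous_map_filtermap:
  assumes X: "cx_surface X A" and Y: "cx_surface Y B"
    and f: "\<And>F. F \<in> prime_ends X A D \<Longrightarrow> filtermap f F \<in> prime_ends Y B E"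
  shows "continuous_map (real_blow_up X A D) (real_blow_up Y B E) (filtermap f)"
  unfolding continuous_map_def topspace_real_blow_up
proof (intro conjI allI impI)
  show "filtermap f \<in> prime_ends X A D \<rightarrow> prime_ends Y B E" using f by blast
  fix G assume G: "openin (real_blow_up Y B E) G"
  show "openin (real_blow_up X A D) {F \<in> prime_ends X A D. filtermap f F \<in> G}"
    unfolding cx_surface.openin_real_blow_up_iff[OF X]
  proof (intro conjI ballI)
    fix F assume F: "F \<in> {F \<in> prime_ends X A D. filtermap f F \<in> G}"
    then obtain P where P: "eventually P (filtermap f F)"
      "\<And>F'. F' \<in> prime_ends Y B E \<Longrightarrow> eventually P F' \<Longrightarrow> F' \<in> G"
      using G unfolding cx_surface.openin_real_blow_up_iff[OF Y] by blast
    \<comment> \<open>Open sets are described by predicates on the complement, and these pull back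
      along \<open>f\<close>.\<close>
    show "\<exists>P. eventually P F \<and> (\<forall>F'\<in>prime_ends X A D. eventually P F' \<longrightarrow>
        F' \<in> {F \<in> prime_ends X A D. filtermap f F \<in> G})"
      using P f by (intro exI[of _ "\<lambda>x. P (f x)"]) (auto simp: eventually_filtermap)
  qed blast
qed

lemma filtermap_inverse:
  assumes "eventually (\<lambda>x. g (f x) = x) F"
  shows "filtermap g (filtermap f F) = F"
  unfolding filter_eq_iff eventually_filtermap
proof
  fix P
  show "eventually (\<lambda>x. P (g (f x))) F \<longleftrightarrow> eventually P F"
    by (rule eventually_subst) (use assms in \<open>auto elim: eventually_mono\<close>)
qed

text \<open>From \<open>F \<le> filtermap g G \<le> F'\<close> the separation of trace filters gives
  \<open>F = F'\<close> and so equality throughout; this is why inequalities suffice as hypotheses.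
  The maps have to be inverse to each other only off the divisors, where the filters live.\<close>

theorem filtermap_homeomorphic_map:
  assumes X: "cx_surface X A" and Y: "cx_surface Y B"
    and gf: "\<And>F. F \<in> prime_ends X A D \<Longrightarrow> eventually (\<lambda>x. g (f x) = x) F"
    and fg: "\<And>G. G \<in> prime_ends Y B E \<Longrightarrow> eventually (\<lambda>y. f (g y) = y) G"
    and f: "\<And>F. F \<in> prime_ends X A D \<Longrightarrow> \<exists>G\<in>prime_ends Y B E. filtermap f F \<le> G"
    and g: "\<And>G. G \<in> prime_ends Y B E \<Longrightarrow> \<exists>F\<in>prime_ends X A D. filtermap g G \<le> F"
  shows "homeomorphic_map (real_blow_up X A D) (real_blow_up Y B E) (filtermap f)"
    and "\<And>F. F \<in> prime_ends X A D \<Longrightarrow> filtermap f F \<in> prime_ends Y B E"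
    and "filtermap f ` prime_ends X A D = prime_ends Y B E"
proof -
  have f_in: "filtermap f F \<in> prime_ends Y B E" if F: "F \<in> prime_ends X A D" for F
  proof -
    obtain G where G: "G \<in> prime_ends Y B E" "filtermap f F \<le> G" using f[OF F] by blast
    obtain F' where F': "F' \<in> prime_ends X A D" "filtermap g G \<le> F'" using g[OF G(1)] by blast
    have le: "F \<le> filtermap g G" using filtermap_mono[OF G(2), of g] filtermap_inverse[of g f, OF gf[OF F]] by simp
    then have "F = F'"
      using cx_surface.prime_ends_unique[OF X cx_surface.prime_ends_basic(1)[OF X F] order_refl _ F F'(1)] F'(2)
      by (meson order_trans)
    then have "F = filtermap g G" using le F'(2) by (simp add: antisym)
    then show ?thesis using filtermap_inverse[of f g, OF fg[OF G(1)]] G(1) by simp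
  qed
  have g_in: "filtermap g G \<in> prime_ends X A D" if G: "G \<in> prime_ends Y B E" for G
  proof -
    obtain F where F: "F \<in> prime_ends X A D" "filtermap g G \<le> F" using g[OF G] by blast
    have "G \<le> filtermap f F" using filtermap_mono[OF F(2), of f] filtermap_inverse[of f g, OF fg[OF G]] by simp
    then have "G = filtermap f F"
      using cx_surface.prime_ends_unique[OF Y cx_surface.prime_ends_basic(1)[OF Y G] order_refl _ G f_in[OF F(1)]] by blast
    then show ?thesis using filtermap_inverse[of g f, OF gf[OF F(1)]] F(1) by simp
  qed
  have "homeomorphic_maps (real_blow_up X A D) (real_blow_up Y B E) (filtermap f) (filtermap g)"
    unfolding homeomorphic_maps_def topspace_real_blow_up
    using continuous_map_filtermap[OF X Y f_in] continuous_map_filtermap[OF Y X g_in]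
      filtermap_inverse[of g f, OF gf] filtermap_inverse[of f g, OF fg] by blast
  then show "homeomorphic_map (real_blow_up X A D) (real_blow_up Y B E) (filtermap f)"
    using homeomorphic_maps_map by blast
  show "filtermap f F \<in> prime_ends Y B E" if "F \<in> prime_ends X A D" for F using f_in[OF that] .
  show "filtermap f ` prime_ends X A D = prime_ends Y B E"
  proof (intro equalityI subsetI)
    fix G assume G: "G \<in> prime_ends Y B E"
    have "filtermap f (filtermap g G) = G" by (rule filtermap_inverse[of f g, OF fg[OF G]])
    then show "G \<in> filtermap f ` prime_ends X A D" using imageI[OF g_in[OF G], of "filtermap f"] by simp
  qed (use f_in in blast)
qed

section \<open>Biholomorphic maps between open subsets\<close>

text \<open>\<open>biholomorphic\<close> between open sets, with the inverse as an explicit argument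
  and holomorphy stated pointwise, so that the two sides can be exchanged.\<close>

definition bih :: "'a topology \<Rightarrow> 'a chart set \<Rightarrow> 'a set \<Rightarrow> 'b topology \<Rightarrow> 'b chart set \<Rightarrow> 'b set \<Rightarrow>
    ('a \<Rightarrow> 'b) \<Rightarrow> ('b \<Rightarrow> 'a) \<Rightarrow> bool"
  where "bih X A S Y B T f g \<longleftrightarrow> openin X S \<and> openin Y T \<and>
    homeomorphic_maps (subtopology X S) (subtopology Y T) f g \<and>
    (\<forall>c\<in>A. \<forall>d\<in>B. \<forall>x\<in>fst c \<inter> S. f x \<in> fst d \<longrightarrow>
      cholo2 (\<lambda>q. snd d (f (inv_into (fst c) (snd c) q))) (snd c x) \<and>
      cholo2 (\<lambda>q. snd c (g (inv_into (fst d) (snd d) q))) (snd d (f x)))"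

lemma bih_maps:
  assumes "bih X A S Y B T f g"
  shows "x \<in> S \<Longrightarrow> f x \<in> T" "y \<in> T \<Longrightarrow> g y \<in> S" "x \<in> S \<Longrightarrow> g (f x) = x" "y \<in> T \<Longrightarrow> f (g y) = y"
    "openin X S" "openin Y T"
proof -
  have op: "openin X S" "openin Y T" and h: "homeomorphic_maps (subtopology X S) (subtopology Y T) f g"
    using assms unfolding bih_def by auto
  have top: "topspace (subtopology X S) = S" "topspace (subtopology Y T) = T"
    using openin_subset[OF op(1)] openin_subset[OF op(2)] by (simp_all add: inf.absorb2)
  have "continuous_map (subtopology X S) (subtopology Y T) f" "continuous_map (subtopology Y T) (subtopology X S) g"
    "\<forall>x\<in>S. g (f x) = x" "\<forall>y\<in>T. f (g y) = y"
    using h unfolding homeomorphic_maps_def top by blast+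
  then show "x \<in> S \<Longrightarrow> f x \<in> T" "y \<in> T \<Longrightarrow> g y \<in> S" "x \<in> S \<Longrightarrow> g (f x) = x" "y \<in> T \<Longrightarrow> f (g y) = y"
    unfolding continuous_map_def top by auto
  show "openin X S" "openin Y T" by (fact op)+
qed

lemma bih_sym:
  assumes "bih X A S Y B T f g"
  shows "bih Y B T X A S g f"
proof -
  note m = bih_maps[OF assms]
  have hol: "\<And>c d x. c \<in> A \<Longrightarrow> d \<in> B \<Longrightarrow> x \<in> fst c \<inter> S \<Longrightarrow> f x \<in> fst d \<Longrightarrow>
      cholo2 (\<lambda>q. snd d (f (inv_into (fst c) (snd c) q))) (snd c x) \<and>
      cholo2 (\<lambda>q. snd c (g (inv_into (fst d) (snd d) q))) (snd d (f x))"
    and h: "homeomorphic_maps (subtopology X S) (subtopology Y T) f g"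
    using assms unfolding bih_def by auto
  show ?thesis
    unfolding bih_def
  proof (intro conjI ballI impI m(5,6))
    show "homeomorphic_maps (subtopology Y T) (subtopology X S) g f" using h homeomorphic_maps_sym by blast
    fix c d y assume *: "c \<in> B" "d \<in> A" "y \<in> fst c \<inter> T" "g y \<in> fst d"
    have "g y \<in> S" "f (g y) = y" using m * by auto
    then show "cholo2 (\<lambda>q. snd d (g (inv_into (fst c) (snd c) q))) (snd c y)"
      "cholo2 (\<lambda>q. snd c (f (inv_into (fst d) (snd d) q))) (snd d (g y))"
      using hol[of d c "g y"] * by auto
  qed
qed

lemma bih_filterlim:
  assumes "bih X A S Y B T f g" "x \<in> S"
  shows "filterlim f (nhdsin Y (f x)) (nhdsin X x)"
proof -
  note m = bih_maps[OF assms(1)]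
  have c: "continuous_map (subtopology X S) (subtopology Y T) f"
    using assms(1) unfolding bih_def homeomorphic_maps_def by blast
  have fT: "f x \<in> topspace Y" using m(1)[OF assms(2)] openin_subset[OF m(6)] by blast
  show ?thesis
    unfolding filterlim_iff
  proof (intro allI impI)
    fix P assume "eventually P (nhdsin Y (f x))"
    then obtain V where V: "openin Y V" "f x \<in> V" "\<forall>y\<in>V. P y" using fT by (auto simp: eventually_nhdsin)
    have "openin (subtopology Y T) (V \<inter> T)" using V(1) openin_subtopology by blast
    from openin_continuous_map_preimage[OF c this]
    have "openin X {x \<in> S. f x \<in> V \<inter> T}"
      using m(5) openin_subset[OF m(5)] by (simp add: openin_open_subtopology inf.absorb2)
    from eventually_nhdsin_openin[OF this, of x]
    have "eventually (\<lambda>x. x \<in> {x \<in> S. f x \<in> V \<inter> T}) (nhdsin X x)" using V(2) m(1) assms(2) by blast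
    then show "eventually (\<lambda>x. P (f x)) (nhdsin X x)" by (rule eventually_mono) (use V(3) in blast)
  qed
qed

locale bih_surfaces = X: cx_surface X A + Y: cx_surface Y B
  for X :: "'a topology" and A and Y :: "'b topology" and B +
  fixes S T f g
  assumes bih: "bih X A S Y B T f g"
begin

lemmas maps = bih_maps[OF bih]

text \<open>Factoring through an atlas chart at each point reduces compatibility to the holomorphy
  of \<open>f\<close> and \<open>g\<close> in atlas charts, which \<open>bih\<close>
  provides.\<close>

lemma push_chart:
  assumes c: "hol_chart X A c" and cS: "fst c \<subseteq> S"
  shows "hol_chart Y B (f ` fst c, \<lambda>y. snd c (g y))"
proof -
  let ?c = "(f ` fst c, \<lambda>y. snd c (g y))"
  note chc = hol_chart_chart_of[OF c]
  note ch = chart_ofD[OF chc]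
  have gf: "g (f x) = x" if "x \<in> fst c" for x using maps(3) cS that by blast
  have img: "(\<lambda>y. snd c (g y)) ` f ` fst c = snd c ` fst c" using gf by (force simp: image_image)
  have inj: "inj_on (\<lambda>y. snd c (g y)) (f ` fst c)"
    using gf ch(3) by (auto simp: inj_on_def)
  have inv: "inv_into (f ` fst c) (\<lambda>y. snd c (g y)) (snd c x) = f x" if "x \<in> fst c" for x
    using inv_into_f_f[OF inj, of "f x"] gf that by simp
  have ev: "eventually (\<lambda>q. f (inv_into (fst c) (snd c) q) = inv_into (f ` fst c) (\<lambda>y. snd c (g y)) q) (nhds (snd c x))"
    if "x \<in> fst c" for x
    using chart_inv_in[OF chc that] by (rule eventually_mono) (use inv in force)
  have op: "openin Y (f ` fst c)"
  proof -
    have "homeomorphic_map (subtopology X S) (subtopology Y T) f"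
      using bih unfolding bih_def by (meson homeomorphic_maps_map)
    from homeomorphic_imp_open_map[OF this]
    have "openin (subtopology Y T) (f ` fst c)"
      unfolding open_map_def using ch(1) cS maps(5) by (simp add: openin_open_subtopology)
    then show ?thesis using maps(6) by (simp add: openin_open_subtopology)
  qed
  have chc': "chart_of Y ?c"
    unfolding chart_of_iff
  proof (intro conjI ballI)
    fix y assume "y \<in> fst ?c"
    then obtain x where x: "x \<in> fst c" "y = f x" by auto
    have "filterlim g (nhdsin X x) (nhdsin Y y)"
      using bih_filterlim[OF bih_sym[OF bih], of y] maps(1)[of x] gf[OF x(1)] x cS by auto
    from filterlim_compose[OF ch(4)[OF x(1)] this]
    show "filterlim (snd ?c) (nhds (snd ?c y)) (nhdsin Y y)" using gf x by simp
    have "filterlim (\<lambda>q. f (inv_into (fst c) (snd c) q)) (nhdsin Y (f x)) (nhds (snd c x))"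
      using filterlim_compose[OF bih_filterlim[OF bih] ch(5)[OF x(1)]] x cS by blast
    then show "filterlim (inv_into (fst ?c) (snd ?c)) (nhdsin Y y) (nhds (snd ?c y))"
      using filterlim_cong[THEN iffD1, OF refl refl ev[OF x(1)]] gf x by simp
  qed (use op inj ch(2) img in simp_all)
  show ?thesis
    unfolding hol_chart_iff
  proof (intro conjI ballI chc')
    fix d y assume d: "d \<in> B" and "y \<in> fst ?c \<inter> fst d"
    then obtain x where x: "x \<in> fst c" "y = f x" "f x \<in> fst d" by auto
    note chd = hol_chart_chart_of[OF Y.atlas_hol_chart[OF d]]
    have xS: "x \<in> S" using x cS by blast
    obtain a where a: "a \<in> A" "x \<in> fst a" "chart_of X a" using X.atlas_chart[OF ch(6)[OF x(1)]] by blast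
    have hol: "cholo2 (\<lambda>q. snd d (f (inv_into (fst a) (snd a) q))) (snd a x)"
      "cholo2 (\<lambda>q. snd a (g (inv_into (fst d) (snd d) q))) (snd d (f x))"
      using bih a d x xS unfolding bih_def by auto
    have tr: "tr c a x" "tr a c x"
      using X.hol_chart_tr[OF c X.atlas_hol_chart[OF a(1)] x(1) a(2)]
        X.hol_chart_tr[OF X.atlas_hol_chart[OF a(1)] c a(2) x(1)] by auto
    show "tr ?c d y"
    proof -
      have "cholo2 (\<lambda>q. snd d (f (inv_into (fst a) (snd a) (snd a (inv_into (fst c) (snd c) q))))) (snd c x)"
        using cholo2_compose[of "\<lambda>q. snd d (f (inv_into (fst a) (snd a) q))"
            "\<lambda>q. snd a (inv_into (fst c) (snd c) q)" "snd c x"] hol(1) tr(1)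
        unfolding tr_def by (simp add: ch(7)[OF x(1)])
      moreover have "eventually (\<lambda>q. snd d (f (inv_into (fst a) (snd a) (snd a (inv_into (fst c) (snd c) q)))) =
          snd d (inv_into (f ` fst c) (\<lambda>y. snd c (g y)) q)) (nhds (snd c x))"
        using chart_inv_eventually[OF chc x(1) eventually_nhdsin_openin[OF chart_ofD(1)[OF a(3)] a(2)]] ev[OF x(1)]
        by eventually_elim (simp add: chart_ofD(7)[OF a(3)])
      ultimately show ?thesis unfolding tr_def using cholo2_cong gf[OF x(1)] x(2) by simp
    qed
    show "tr d ?c y"
    proof -
      have "cholo2 (\<lambda>q. snd c (inv_into (fst a) (snd a) (snd a (g (inv_into (fst d) (snd d) q))))) (snd d (f x))"
        using cholo2_compose[of "\<lambda>q. snd c (inv_into (fst a) (snd a) q)"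
            "\<lambda>q. snd a (g (inv_into (fst d) (snd d) q))" "snd d (f x)"] hol(2) tr(2)
        unfolding tr_def by (simp add: chart_ofD(7)[OF chd x(3)] gf[OF x(1)])
      moreover have "eventually (\<lambda>q. snd c (inv_into (fst a) (snd a) (snd a (g (inv_into (fst d) (snd d) q)))) =
          snd c (g (inv_into (fst d) (snd d) q))) (nhds (snd d (f x)))"
      proof -
        have "filterlim g (nhdsin X x) (nhdsin Y (f x))"
          using bih_filterlim[OF bih_sym[OF bih], of "f x"] maps(1)[OF xS] gf[OF x(1)] by simp
        then have "eventually (\<lambda>y. g y \<in> fst a) (nhdsin Y (f x))"
          using eventually_nhdsin_openin[OF chart_ofD(1)[OF a(3)] a(2)] unfolding filterlim_iff by blast
        from chart_inv_eventually[OF chd x(3) this] show ?thesis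
          by (rule eventually_mono) (simp add: chart_ofD(7)[OF a(3)])
      qed
      ultimately show ?thesis unfolding tr_def using cholo2_cong x(2) by simp
    qed
  qed
qed

section \<open>Transport of adapted charts, trace filters and rotations\<close>

context
  fixes D :: "'a set" and E :: "'b set"
  assumes DE: "\<And>x. x \<in> S \<Longrightarrow> x \<in> D \<longleftrightarrow> f x \<in> E"
begin

lemma push_adapted:
  assumes c: "adapted_chart X A D c k" "fst c \<subseteq> S"
  shows "adapted_chart Y B E (f ` fst c, \<lambda>y. snd c (g y)) k"
  unfolding Y.adapted_iff
proof (intro conjI ballI push_chart[OF X.adapted_hol[OF c(1)] c(2)])
  fix y assume "y \<in> fst (f ` fst c, \<lambda>y. snd c (g y))"
  then obtain x where x: "x \<in> fst c" "y = f x" by auto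
  have "x \<in> S" using x c by blast
  then show "y \<in> E \<longleftrightarrow> snd (f ` fst c, \<lambda>y. snd c (g y)) y \<in> local_divisor k"
    using X.adapted_in_D_iff[OF c(1) x(1)] DE maps(3) x(2) by simp
qed

lemma push_model:
  assumes c: "adapted_chart X A D c k" "fst c \<subseteq> S"
  shows "polar_model E (f ` fst c, \<lambda>y. snd c (g y)) k = polar_model D c k"
proof -
  have "(\<lambda>y. snd c (g y)) ` f ` fst c = snd c ` fst c" using maps(3) c(2) by (force simp: image_image)
  then show ?thesis
    using X.polar_model_iff[OF c(1)] Y.polar_model_iff[OF push_adapted[OF c]] by (intro set_eqI) simp
qed

text \<open>The transported chart takes the same values at corresponding points, so the polar
  coordinates do not change; applying the argument to \<open>g\<close> as well gives the second
  inequality.\<close>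

lemma push_prime_end:
  assumes c: "adapted_chart X A D c k" "fst c \<subseteq> S"
  shows "filtermap f (prime_end D c k m) = prime_end E (f ` fst c, \<lambda>y. snd c (g y)) k m"
proof (rule antisym)
  let ?c = "(f ` fst c, \<lambda>y. snd c (g y))"
  let ?F = "prime_end D c k m" and ?G = "prime_end E ?c k m"
  have F: "eventually (\<lambda>x. x \<in> fst c - D \<and> x \<in> S \<and> g (f x) = x) ?F"
    using prime_end_eventually by (rule eventually_mono) (use c(2) maps(3) in blast)
  show "filtermap f ?F \<le> ?G"
    unfolding le_prime_end_iff filterlim_filtermap eventually_filtermap
  proof
    show "((\<lambda>x. polar k (snd ?c (f x))) \<longlongrightarrow> m) ?F"
      by (rule Lim_transform_eventually[OF prime_end_tendsto], rule eventually_mono[OF F]) simp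
    show "eventually (\<lambda>x. f x \<in> fst ?c - E) ?F"
      by (rule eventually_mono[OF F]) (use DE in auto)
  qed
  have G: "eventually (\<lambda>y. \<exists>x. x \<in> fst c \<and> x \<notin> D \<and> y = f x \<and> g y = x) ?G"
    using prime_end_eventually by (rule eventually_mono) (use c(2) maps(3) DE in auto)
  have "filtermap g ?G \<le> ?F"
    unfolding le_prime_end_iff filterlim_filtermap eventually_filtermap
  proof
    show "((\<lambda>y. polar k (snd c (g y))) \<longlongrightarrow> m) ?G"
      using prime_end_tendsto[of k ?c m E] by simp
    show "eventually (\<lambda>y. g y \<in> fst c - D) ?G"
      by (rule eventually_mono[OF G]) auto
  qed
  from filtermap_mono[OF this, of f]
  show "?G \<le> filtermap f ?F"
    using filtermap_inverse[of f g ?G] eventually_mono[OF G, of "\<lambda>y. f (g y) = y"] by auto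
qed

lemma prime_end_in_S:
  assumes F: "F \<in> prime_ends X A D" "foot X F \<in> S"
  obtains c k m where "adapted_chart X A D c k" "fst c \<subseteq> S" "m \<in> polar_model D c k" "F = prime_end D c k m"
    "foot X F \<in> fst c" "snd c (foot X F) = fst m"
proof -
  obtain c k m where c: "adapted_chart X A D c k" "m \<in> polar_model D c k" "foot X F \<in> fst c"
    "fst m = snd c (foot X F)" "F = prime_end D c k m"
    using X.prime_ends_basic(5)[OF F(1)] by blast
  let ?c = "(fst c \<inter> S, snd c)"
  have c': "adapted_chart X A D ?c k" using X.adapted_restrict[OF c(1) maps(5)] .
  have "m \<in> polar_model D ?c k" "prime_end D ?c k m = prime_end D c k m"
    using X.prime_end_subchart[OF c(1,2) c'] c F(2) by auto
  then show thesis using that[OF c'] c F(2) by auto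
qed

lemma push_prime_ends:
  assumes F: "F \<in> prime_ends X A D" "foot X F \<in> S"
  shows "filtermap f F \<in> prime_ends Y B E" "foot Y (filtermap f F) = f (foot X F)"
proof -
  obtain c k m where c: "adapted_chart X A D c k" "fst c \<subseteq> S" "m \<in> polar_model D c k" "F = prime_end D c k m"
    using prime_end_in_S[OF F] by blast
  show "filtermap f F \<in> prime_ends Y B E"
    unfolding c(4) push_prime_end[OF c(1,2)]
    by (rule Y.prime_end_in_prime_ends[OF push_adapted[OF c(1,2)]]) (simp add: push_model[OF c(1,2)] c(3))
  show "foot Y (filtermap f F) = f (foot X F)"
  proof (rule Y.foot_eqI)
    show "filtermap f F \<noteq> bot" using X.prime_ends_basic(1)[OF F(1)] by (simp add: filtermap_bot_iff)
    show "f (foot X F) \<in> topspace Y" using maps(1)[OF F(2)] openin_subset[OF maps(6)] by blast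
    show "filtermap f F \<le> nhdsin Y (f (foot X F))"
      using filterlim_mono[OF bih_filterlim[OF bih F(2)] order_refl X.prime_ends_basic(2)[OF F(1)]]
      unfolding filterlim_def .
  qed
qed

lemma push_ordinary:
  assumes "x \<in> S" "ordinary_point X A D x"
  shows "ordinary_point Y B E (f x)"
proof -
  obtain c where c: "x \<in> D" "adapted_chart X A D c Smooth" "x \<in> fst c"
    using assms(2) unfolding X.ordinary_point_iff by blast
  have c': "adapted_chart X A D (fst c \<inter> S, snd c) Smooth" using X.adapted_restrict[OF c(2) maps(5)] .
  from push_adapted[OF this] show ?thesis
    unfolding Y.ordinary_point_iff using DE[OF assms(1)] c assms(1)
    by (intro conjI exI[of _ "(f ` fst (fst c \<inter> S, snd c), \<lambda>y. snd (fst c \<inter> S, snd c) (g y))"]) auto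
qed

lemma push_canonical_rotation:
  assumes F: "F \<in> prime_ends X A D" "foot X F \<in> S" and o: "ordinary_point X A D (foot X F)"
  shows "canonical_rotation Y B E \<Theta> (filtermap f F) = filtermap f (canonical_rotation X A D \<Theta> F)"
    and "canonical_rotation X A D \<Theta> F \<in> prime_ends X A D"
    and "foot X (canonical_rotation X A D \<Theta> F) = foot X F"
proof -
  obtain c where c: "foot X F \<in> D" "adapted_chart X A D c Smooth" "foot X F \<in> fst c"
    using o unfolding X.ordinary_point_iff by blast
  let ?c = "(fst c \<inter> S, snd c)"
  have c': "adapted_chart X A D ?c Smooth" "fst ?c \<subseteq> S" using X.adapted_restrict[OF c(2) maps(5)] by auto
  have ft: "foot X F \<in> fst ?c" using c(3) F(2) by simp
  obtain m where m: "m \<in> polar_model D ?c Smooth" "F = prime_end D ?c Smooth m" "fst m = snd ?c (foot X F)"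
    using X.prime_ends_in_chart[OF F(1) c'(1) ft] .
  have "snd (fst m) = 0" using X.adapted_in_D_iff[OF c(2,3)] c(1) m(3) by (cases "snd c (foot X F)") auto
  moreover have "fst (snd m) = 1" using m(1) unfolding X.polar_model_iff[OF c'(1)] by simp
  ultimately obtain a s where ms: "m = ((a, 0), (1, s))" by (metis prod.collapse)
  have rot: "((a, 0), (1, cis \<Theta> * s)) \<in> polar_model D ?c Smooth"
    using m(1) unfolding ms X.polar_model_iff[OF c'(1)] by (auto simp: norm_mult)
  have can: "canonical_rotation X A D \<Theta> F = prime_end D ?c Smooth ((a, 0), (1, cis \<Theta> * s))"
    using X.canonical_rotation_smooth[OF c'(1)] m(1,2) unfolding ms by simp
  have "((a, 0), (1, s)) \<in> polar_model E (f ` fst ?c, \<lambda>y. snd ?c (g y)) Smooth"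
    using m(1) unfolding push_model[OF c'] ms .
  from Y.canonical_rotation_smooth[OF push_adapted[OF c'] this]
  show "canonical_rotation Y B E \<Theta> (filtermap f F) = filtermap f (canonical_rotation X A D \<Theta> F)"
    unfolding can unfolding m(2) ms push_prime_end[OF c'] .
  show "canonical_rotation X A D \<Theta> F \<in> prime_ends X A D"
    unfolding can by (rule X.prime_end_in_prime_ends[OF c'(1) rot])
  obtain x where x: "x \<in> fst ?c" "snd ?c x = (a, 0)" "foot X (prime_end D ?c Smooth ((a, 0), (1, cis \<Theta> * s))) = x"
    using X.model_foot[OF c'(1) rot] by auto
  have "x = foot X F"
    using inj_onD[OF chart_ofD(3)[OF hol_chart_chart_of[OF X.adapted_hol[OF c'(1)]]] _ x(1) ft] x(2) m(3) ms by simp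
  then show "foot X (canonical_rotation X A D \<Theta> F) = foot X F" unfolding can using x(3) by simp
qed

end

end

section \<open>The blow-up of a point\<close>

text \<open>Here \<open>q = (v, t)\<close> is the affine chart \<open>x = v\<close>, \<open>y = v * t\<close> of the blow-up of the origin.\<close>

lemma cdiff2_divide_blow_up:
  fixes G :: "complex \<times> complex \<Rightarrow> complex"
  assumes N: "open N" and G: "\<And>q. q \<in> N \<Longrightarrow> cdiff2 G q" and G0: "G (0, 0) = 0"
    and der: "(G has_derivative (\<lambda>v. \<alpha> * fst v + \<beta> * snd v)) (at (0, 0))"
    and q: "(fst q, fst q * snd q) \<in> N"
  shows "cdiff2 (\<lambda>q. if fst q = 0 then \<alpha> + \<beta> * snd q else G (fst q, fst q * snd q) / fst q) q"
proof -
  \<comment> \<open>On the exceptional curve the quotient is replaced by its limit, the differential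
    of \<open>G\<close> applied to the direction \<open>(1, t)\<close>.\<close>
  define a where "a = (\<lambda>q. if fst q = 0 then \<alpha> + \<beta> * snd q else G (fst q, fst q * snd q) / fst q)"
  define b where "b = (\<lambda>q :: complex \<times> complex. (fst q, fst q * snd q))"
  define M where "M = b -` N"
  have cb: "continuous_on UNIV b" unfolding b_def by (intro continuous_intros)
  have M: "open M" unfolding M_def using N cb by (simp add: open_vimage)
  have bhol: "cholo2 b p" for p
    unfolding cholo2_iff b_def by (simp add: cdiff2_fst cdiff2_mult cdiff2_snd)
  have off: "cdiff2 a p" if p: "p \<in> M" "fst p \<noteq> 0" for p
  proof -
    have "cdiff2 (\<lambda>q. G (b q)) p" using cdiff2_compose[OF G bhol] p(1) unfolding M_def by blast
    then have "cdiff2 (\<lambda>q. G (b q) / fst q) p" using cdiff2_divide cdiff2_fst p(2) by blast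
    moreover have "eventually (\<lambda>q :: complex \<times> complex. fst q \<noteq> 0) (nhds p)"
      using tendsto_imp_eventually_ne[OF tendsto_fst[OF filterlim_ident, of p] p(2)] .
    then have "eventually (\<lambda>q. G (b q) / fst q = a q) (nhds p)"
      by (rule eventually_mono) (simp add: a_def b_def)
    ultimately show ?thesis using cdiff2_cong[of "\<lambda>q. G (b q) / fst q" a p] by simp
  qed
  have cont0: "isCont a (0, t)" for t
    unfolding isCont_def
  proof (rule tendstoI)
    fix e :: real assume e: "0 < e"
    \<comment> \<open>\<open>K\<close> bounds \<open>1 + norm u\<close> for
      \<open>norm u \<le> norm t + 1\<close>, so \<open>(x, x * u)\<close> has norm at most
      \<open>norm x * K\<close>. The quotient then deviates by at most
      \<open>e' * K = e / 4\<close>, leaving \<open>e / 2\<close> for the variation of the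
      slope.\<close>
    define K where "K = norm t + 2"
    have K: "K > 0" unfolding K_def by (simp add: add_nonneg_pos)
    define e' where "e' = e / (4 * K)"
    have e': "e' > 0" using e K by (simp add: e'_def)
    obtain d where d: "d > 0" "\<forall>p. norm (p - (0, 0)) < d \<longrightarrow>
        norm (G p - G (0, 0) - (\<alpha> * fst (p - (0, 0)) + \<beta> * snd (p - (0, 0)))) \<le> e' * norm (p - (0, 0))"
      using conjunct2[OF der[unfolded has_derivative_at_alt], rule_format, OF e'] by auto
    have est: "norm (G (x, x * u) / x - (\<alpha> + \<beta> * u)) \<le> e' * K"
      if x: "x \<noteq> 0" "norm x * K < d" and u: "norm u \<le> norm t + 1" for x u
    proof -
      have "norm (x, x * u) \<le> norm x + norm (x * u)" by (rule norm_Pair_le)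
      also have "\<dots> = norm x * (1 + norm u)" by (simp add: norm_mult algebra_simps)
      also have "\<dots> \<le> norm x * K" using u by (intro mult_left_mono) (auto simp: K_def)
      finally have n: "norm (x, x * u) \<le> norm x * K" .
      then have "norm (G (x, x * u) - (\<alpha> * x + \<beta> * (x * u))) \<le> e' * norm (x, x * u)"
        using spec[OF d(2), of "(x, x * u)"] x(2) G0 by (simp add: zero_prod_def[symmetric])
      also have "\<dots> \<le> e' * (norm x * K)" using n e' by (intro mult_left_mono) auto
      finally have "norm (G (x, x * u) - (\<alpha> * x + \<beta> * (x * u))) \<le> e' * K * norm x" by (simp add: mult_ac)
      moreover have "G (x, x * u) / x - (\<alpha> + \<beta> * u) = (G (x, x * u) - (\<alpha> * x + \<beta> * (x * u))) / x"
        using x(1) by (simp add: field_simps)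
      ultimately show ?thesis using x(1) by (simp add: norm_divide field_simps)
    qed
    have 1: "eventually (\<lambda>q :: complex \<times> complex. norm (fst q) * K < d) (nhds (0, t))"
    proof -
      have "((\<lambda>q :: complex \<times> complex. norm (fst q) * K) \<longlongrightarrow> norm (fst (0 :: complex, t)) * K) (nhds (0, t))"
        by (intro tendsto_intros filterlim_ident)
      then show ?thesis using order_tendstoD(2)[of _ "norm (fst (0 :: complex, t)) * K"] d(1) by force
    qed
    have 2: "eventually (\<lambda>q :: complex \<times> complex. norm (snd q) < norm t + 1) (nhds (0, t))"
    proof -
      have "((\<lambda>q :: complex \<times> complex. norm (snd q)) \<longlongrightarrow> norm (snd (0 :: complex, t))) (nhds (0, t))"
        by (intro tendsto_intros filterlim_ident)
      then show ?thesis using order_tendstoD(2)[of _ "norm (snd (0 :: complex, t))"] by force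
    qed
    have 3: "eventually (\<lambda>q :: complex \<times> complex. dist (\<alpha> + \<beta> * snd q) (\<alpha> + \<beta> * t) < e / 2) (nhds (0, t))"
    proof -
      have "((\<lambda>q :: complex \<times> complex. \<alpha> + \<beta> * snd q) \<longlongrightarrow> \<alpha> + \<beta> * snd (0 :: complex, t)) (nhds (0, t))"
        by (intro tendsto_intros filterlim_ident)
      from tendstoD[OF this, of "e / 2"] e show ?thesis by simp
    qed
    have "eventually (\<lambda>q. dist (a q) (a (0, t)) < e) (nhds (0, t))"
      using 1 2 3
    proof eventually_elim
      case (elim q)
      obtain x u where xu: "q = (x, u)" by fastforce
      have "dist (a q) (\<alpha> + \<beta> * u) \<le> e / 4"
      proof (cases "x = 0")
        case False
        have "norm (G (x, x * u) / x - (\<alpha> + \<beta> * u)) \<le> e' * K" using est[OF False] elim xu by simp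
        also have "\<dots> = e / 4" using K by (simp add: e'_def)
        finally show ?thesis using False by (simp add: a_def xu dist_norm)
      qed (use e in \<open>simp add: a_def xu\<close>)
      moreover have "dist (\<alpha> + \<beta> * u) (a (0, t)) < e / 2" using elim(3) by (simp add: a_def xu)
      ultimately show ?case using dist_triangle[of "a q" "a (0, t)" "\<alpha> + \<beta> * u"] e by simp
    qed
    then show "eventually (\<lambda>q. dist (a q) (a (0, t)) < e) (at (0, t))"
      by (auto simp: eventually_at_filter elim: eventually_mono)
  qed
  have cont: "continuous_on M a"
  proof (rule continuous_at_imp_continuous_on, intro ballI)
    fix p assume p: "p \<in> M"
    show "isCont a p"
    proof (cases "fst p = 0")
      case True
      then show ?thesis using cont0[of "snd p"] by (metis prod.collapse)
    qed (use cdiff2_isCont off p in blast)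
  qed
  \<comment> \<open>With continuity known, only separate differentiability is left: on the
    exceptional curve \<open>a\<close> is affine in the slope, and across it the point 0 is a
    removable singularity in the other variable.\<close>
  have "cdiff2 a q"
  proof (rule osgood[OF M _ cont])
    show "q \<in> M" using q by (simp add: M_def b_def)
    show "(\<lambda>y. a (x, y)) field_differentiable at y" if p: "(x, y) \<in> M" for x y
    proof (cases "x = 0")
      case True
      have "(\<lambda>y. a (x, y)) = (\<lambda>y. \<alpha> + \<beta> * y)" by (simp add: a_def True)
      then show ?thesis by (auto intro!: derivative_intros)
    qed (use off[OF p] cdiff2_partials(1) in auto)
    show "(\<lambda>x. a (x, y)) field_differentiable at x" if p: "(x, y) \<in> M" for x y
    proof (cases "x = 0")
      case True
      obtain r where r: "0 < r" "cball 0 r \<times> cball y r \<subseteq> M"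
        using open_Times_cball[OF M p] True by metis
      have inM: "(x, y) \<in> M" if "x \<in> ball 0 r" for x using r that by force
      have "(\<lambda>x. a (x, y)) holomorphic_on ball 0 r"
      proof (rule no_isolated_singularity[where K = "{0}"])
        show "continuous_on (ball 0 r) (\<lambda>x. a (x, y))"
          using inM by (intro continuous_on_compose2[OF cont] continuous_intros) auto
        show "(\<lambda>x. a (x, y)) holomorphic_on ball 0 r - {0}"
          unfolding holomorphic_on_def
        proof
          fix x :: complex assume "x \<in> ball 0 r - {0}"
          then have "cdiff2 a (x, y)" using off[of "(x, y)"] inM[of x] by simp
          then show "(\<lambda>x. a (x, y)) field_differentiable at x within ball 0 r - {0}"
            using cdiff2_partials(2) field_differentiable_at_within by blast
        qed
      qed auto
      then show ?thesis
        using r(1) True holomorphic_on_imp_differentiable_at[of "\<lambda>x. a (x, y)" "ball 0 r" 0] by simp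
    qed (use off[OF p] cdiff2_partials(2) in auto)
  qed
  then show ?thesis unfolding a_def .
qed

lemma (in cx_surface) chart_inverse_near:
  assumes "hol_chart X A c" "hol_chart X A d" "x \<in> fst c" "x \<in> fst d"
  shows "eventually (\<lambda>q. cdiff2 (\<lambda>q. fst (snd d (inv_into (fst c) (snd c) q))) q \<and>
    cdiff2 (\<lambda>q. snd (snd d (inv_into (fst c) (snd c) q))) q \<and>
    inv_into (fst c) (snd c) q \<in> fst c \<inter> fst d) (nhds (snd c x))"
proof -
  note chc = hol_chart_chart_of[OF assms(1)]
  show ?thesis
    using coord_cdiff2[OF coord_fst[OF assms(2,4)] assms(1,3)] coord_cdiff2[OF coord_snd[OF assms(2,4)] assms(1,3)]
      chart_inv_in[OF chc assms(3)]
      chart_inv_eventually[OF chc assms(3) eventually_nhdsin_openin[OF chart_ofD(1)[OF hol_chart_chart_of[OF assms(2)]] assms(4)]]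
    by eventually_elim blast
qed

section \<open>Lifting a change of centred coordinates to the blow-up\<close>

locale two_surfaces = X: cx_surface X A + X': cx_surface X' A'
  for X :: "'a topology" and A and X' :: "'b topology" and A' +
  fixes \<pi> :: "'b \<Rightarrow> 'a" and z :: 'a
begin

text \<open>In the chart \<open>(v, t)\<close> the new coordinates are \<open>v * a1\<close> and
  \<open>v * a2\<close> with \<open>a1\<close>, \<open>a2\<close> holomorphic across
  \<open>v = 0\<close>, so \<open>H = (v * a1, a2 / a1)\<close> consists of the new coordinate and
  the new slope. On the exceptional curve the slope undergoes the Moebius transformation of the
  Jacobian matrix, and \<open>nz\<close> says that its value at \<open>t0\<close> is finite.\<close>

lemma blow_up_chart:
  assumes \<psi>: "hol_chart X A p" "z \<in> fst p" "snd p z = (0, 0)"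
    and w: "hol_chart X A c" "z \<in> fst c" "snd c z = (0, 0)"
    and \<phi>: "hol_chart X' A' d" "y0 \<in> fst d" "snd d y0 = (0, t0)"
    and proj: "\<forall>y\<in>fst d. \<pi> y \<in> fst p \<and> snd p (\<pi> y) = (fst (snd d y), fst (snd d y) * snd (snd d y))"
    and der: "((\<lambda>q. fst (snd c (inv_into (fst p) (snd p) q))) has_derivative (\<lambda>v. \<alpha>1 * fst v + \<beta>1 * snd v)) (at (0, 0))"
      "((\<lambda>q. snd (snd c (inv_into (fst p) (snd p) q))) has_derivative (\<lambda>v. \<alpha>2 * fst v + \<beta>2 * snd v)) (at (0, 0))"
    and det: "\<alpha>1 * \<beta>2 - \<alpha>2 * \<beta>1 \<noteq> 0" and nz: "\<alpha>1 + \<beta>1 * t0 \<noteq> 0"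
  obtains d' where "y0 \<in> fst d'" "fst d' \<subseteq> fst d" "hol_chart X' A' d'"
    "\<forall>y\<in>fst d'. \<pi> y \<in> fst c \<and> snd c (\<pi> y) = (fst (snd d' y), fst (snd d' y) * snd (snd d' y))"
    "snd d' y0 = (0, (\<alpha>2 + \<beta>2 * t0) / (\<alpha>1 + \<beta>1 * t0))"
proof -
  note chp = hol_chart_chart_of[OF \<psi>(1)] and chc = hol_chart_chart_of[OF w(1)] and chd = hol_chart_chart_of[OF \<phi>(1)]
  define i where "i = inv_into (fst p) (snd p)"
  define G1 where "G1 = (\<lambda>q. fst (snd c (i q)))"
  define G2 where "G2 = (\<lambda>q. snd (snd c (i q)))"
  have "eventually (\<lambda>q. cdiff2 G1 q \<and> cdiff2 G2 q \<and> i q \<in> fst p \<inter> fst c) (nhds (0, 0))"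
    using X.chart_inverse_near[OF \<psi>(1) w(1) \<psi>(2) w(2)] unfolding \<psi>(3) G1_def G2_def i_def .
  then obtain N where N: "open N" "(0, 0) \<in> N" "\<And>q. q \<in> N \<Longrightarrow> cdiff2 G1 q \<and> cdiff2 G2 q \<and> i q \<in> fst p \<inter> fst c"
    unfolding eventually_nhds by blast
  have iz: "i (0, 0) = z" using chart_ofD(7)[OF chp \<psi>(2)] unfolding \<psi>(3) i_def .
  have G0: "G1 (0, 0) = 0" "G2 (0, 0) = 0" unfolding G1_def G2_def iz w(3) by auto
  define a1 where "a1 = (\<lambda>q. if fst q = 0 then \<alpha>1 + \<beta>1 * snd q else G1 (fst q, fst q * snd q) / fst q)"
  define a2 where "a2 = (\<lambda>q. if fst q = 0 then \<alpha>2 + \<beta>2 * snd q else G2 (fst q, fst q * snd q) / fst q)"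
  have va: "fst q * a1 q = G1 (fst q, fst q * snd q)" "fst q * a2 q = G2 (fst q, fst q * snd q)" for q
    using G0 by (auto simp: a1_def a2_def)
  have a: "cdiff2 a1 q" "cdiff2 a2 q" if "(fst q, fst q * snd q) \<in> N" for q
    unfolding a1_def a2_def
    by (rule cdiff2_divide_blow_up[OF N(1) _ _ _ that]; use N(3) G0 der in \<open>simp add: G1_def G2_def i_def\<close>)+
  have evN: "eventually (\<lambda>q. (fst q, fst q * snd q) \<in> N) (nhds (0, t0))"
  proof (rule topological_tendstoD[OF _ N(1,2)])
    have "((\<lambda>q :: complex \<times> complex. (fst q, fst q * snd q)) \<longlongrightarrow> (fst (0 :: complex, t0), fst (0 :: complex, t0) * snd (0 :: complex, t0))) (nhds (0, t0))"
      by (intro tendsto_intros filterlim_ident)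
    then show "((\<lambda>q :: complex \<times> complex. (fst q, fst q * snd q)) \<longlongrightarrow> (0, 0)) (nhds (0, t0))" by simp
  qed
  have a10: "a1 (0, t0) = \<alpha>1 + \<beta>1 * t0" and a20: "a2 (0, t0) = \<alpha>2 + \<beta>2 * t0" by (simp_all add: a1_def a2_def)
  have aN: "cdiff2 a1 (0, t0)" "cdiff2 a2 (0, t0)" using a eventually_nhds_x_imp_x[OF evN] by auto
  have ev1: "eventually (\<lambda>q. a1 q \<noteq> 0) (nhds (0, t0))"
    using tendsto_imp_eventually_ne[OF isCont_tendsto_nhds[OF cdiff2_isCont[OF aN(1)]]] nz a10 by simp
  define H where "H = (\<lambda>q. (fst q * a1 q, a2 q / a1 q))"
  have hol: "eventually (cholo2 H) (nhds (snd d y0))"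
    using evN ev1 unfolding \<phi>(3)
  proof eventually_elim
    case (elim q)
    then show ?case
      unfolding cholo2_iff H_def by (simp add: cdiff2_mult cdiff2_fst cdiff2_divide a)
  qed
  have H0: "cdiff2 (\<lambda>q. fst q * a1 q) (0, t0)" "cdiff2 (\<lambda>q. a2 q / a1 q) (0, t0)"
    using aN nz a10 by (simp_all add: cdiff2_mult cdiff2_fst cdiff2_divide)
  define \<epsilon> where "\<epsilon> = deriv (\<lambda>x. a2 (x, t0) / a1 (x, t0)) 0"
  define \<delta> where "\<delta> = deriv (\<lambda>y. a2 (0, y) / a1 (0, y)) t0"
  have dH2: "((\<lambda>q. a2 q / a1 q) has_derivative (\<lambda>v. \<epsilon> * fst v + \<delta> * snd v)) (at (0, t0))"
    using cdiff2_has_derivative[OF H0(2)] unfolding \<epsilon>_def \<delta>_def .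
  \<comment> \<open>The derivative of the Moebius transformation is the Jacobian determinant over
    the square of the denominator, hence nonzero.\<close>
  have "((\<lambda>y. (\<alpha>2 + \<beta>2 * y) / (\<alpha>1 + \<beta>1 * y)) has_field_derivative
      (\<beta>2 * (\<alpha>1 + \<beta>1 * t0) - (\<alpha>2 + \<beta>2 * t0) * \<beta>1) / ((\<alpha>1 + \<beta>1 * t0) * (\<alpha>1 + \<beta>1 * t0))) (at t0)"
    using nz by (auto intro!: derivative_eq_intros)
  then have "\<delta> = (\<beta>2 * (\<alpha>1 + \<beta>1 * t0) - (\<alpha>2 + \<beta>2 * t0) * \<beta>1) / ((\<alpha>1 + \<beta>1 * t0) * (\<alpha>1 + \<beta>1 * t0))"
    unfolding \<delta>_def a1_def a2_def by (simp add: DERIV_imp_deriv)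
  moreover have "\<beta>2 * (\<alpha>1 + \<beta>1 * t0) - (\<alpha>2 + \<beta>2 * t0) * \<beta>1 = \<alpha>1 * \<beta>2 - \<alpha>2 * \<beta>1"
    by (simp add: algebra_simps)
  ultimately have \<delta>: "\<delta> \<noteq> 0" using det nz by simp
  \<comment> \<open>The first component of \<open>H\<close> vanishes on the exceptional curve, so
    the Jacobian matrix of \<open>H\<close> there is triangular.\<close>
  have dH1: "((\<lambda>q. fst q * a1 q) has_derivative (\<lambda>v. (\<alpha>1 + \<beta>1 * t0) * fst v + 0 * snd v)) (at (0, t0))"
  proof -
    obtain a1' where a1': "(a1 has_derivative a1') (at (0, t0))" using aN(1) unfolding cdiff2_def by blast
    have "(fst has_derivative fst) (at (0 :: complex, t0))" by (auto intro!: derivative_eq_intros)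
    from has_derivative_mult[OF this a1'] show ?thesis by (simp add: a10 mult.commute)
  qed
  have dH: "(H has_derivative (\<lambda>v. ((\<alpha>1 + \<beta>1 * t0) * fst v + 0 * snd v, \<epsilon> * fst v + \<delta> * snd v))) (at (snd d y0))"
    unfolding H_def \<phi>(3) by (rule has_derivative_Pair[OF dH1 dH2])
  have inj: "v = 0" if "((\<alpha>1 + \<beta>1 * t0) * fst v + 0 * snd v, \<epsilon> * fst v + \<delta> * snd v) = 0" for v
    using that nz \<delta> by (auto simp: prod_eq_iff)
  obtain O' where O': "open O'" "(0, t0) \<in> O'" "\<forall>q\<in>O'. (fst q, fst q * snd q) \<in> N \<and> a1 q \<noteq> 0"
    using eventually_conj[OF evN ev1] unfolding eventually_nhds by blast
  define S0 where "S0 = {y \<in> fst d. snd d y \<in> O'}"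
  have S0: "openin X' S0" "y0 \<in> S0"
    unfolding S0_def using X'.chart_preimage_openin[OF chd O'(1)] \<phi> O'(2) by auto
  obtain S where S: "openin X' S" "y0 \<in> S" "S \<subseteq> fst d \<inter> S0" "hol_chart X' A' (S, \<lambda>y. H (snd d y))"
    using X'.hol_chart_local_inverse[OF \<phi>(1,2) hol dH inj S0] by blast
  have main: "\<pi> y \<in> fst c \<and> snd c (\<pi> y) = (fst (H (snd d y)), fst (H (snd d y)) * snd (H (snd d y)))" if y: "y \<in> S" for y
  proof -
    let ?q = "snd d y"
    have yd: "y \<in> fst d" and q: "(fst ?q, fst ?q * snd ?q) \<in> N" "a1 ?q \<noteq> 0"
      using S(3) y O'(3) unfolding S0_def by auto
    have i: "i (fst ?q, fst ?q * snd ?q) = \<pi> y"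
      using chart_ofD(7)[OF chp, of "\<pi> y"] bspec[OF proj yd] unfolding i_def by simp
    have "fst (snd c (\<pi> y)) = fst ?q * a1 ?q" "snd (snd c (\<pi> y)) = fst ?q * a2 ?q"
      using va[of ?q] unfolding G1_def G2_def i by simp_all
    moreover have "\<pi> y \<in> fst c" using N(3)[OF q(1)] unfolding i by simp
    ultimately show ?thesis using q(2) by (simp add: H_def prod_eq_iff)
  qed
  show thesis
    by (rule that[of "(S, \<lambda>y. H (snd d y))"]) (use S main in \<open>auto simp: H_def \<phi>(3) a10 a20\<close>)
qed

end

lemma lines_slope:
  assumes k: "k \<in> lines" and t: "(1, t) \<in> k"
  shows "(THE t. (1, t) \<in> k) = t" and "v \<in> k \<Longrightarrow> snd v = fst v * t"
proof -
  obtain a b where ab: "k = range (\<lambda>c. (c * a, c * b))" using k unfolding lines_def by blast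
  obtain c0 where c0: "1 = c0 * a" "t = c0 * b" using t unfolding ab by auto
  have a: "a \<noteq> 0" using c0 by auto
  have slope: "snd v = fst v * t" if "v \<in> k" for v
  proof -
    obtain c where "v = (c * a, c * b)" using \<open>v \<in> k\<close> unfolding ab by blast
    then have "snd v * 1 = fst v * t" unfolding c0 by simp
    then show ?thesis by simp
  qed
  show "v \<in> k \<Longrightarrow> snd v = fst v * t" by (rule slope)
  show "(THE t. (1, t) \<in> k) = t" using slope t by (intro the_equality) fastforce+
qed

lemma lines_slope':
  assumes k: "k \<in> lines" and t: "(t, 1) \<in> k"
  shows "(THE t. (t, 1) \<in> k) = t" and "v \<in> k \<Longrightarrow> fst v = snd v * t"
proof -
  obtain a b where ab: "k = range (\<lambda>c. (c * a, c * b))" using k unfolding lines_def by blast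
  obtain c0 where c0: "1 = c0 * b" "t = c0 * a" using t unfolding ab by auto
  have b: "b \<noteq> 0" using c0 by auto
  have slope: "fst v = snd v * t" if "v \<in> k" for v
  proof -
    obtain c where "v = (c * a, c * b)" using \<open>v \<in> k\<close> unfolding ab by blast
    then have "fst v * 1 = snd v * t" unfolding c0 by simp
    then show ?thesis by simp
  qed
  show "v \<in> k \<Longrightarrow> fst v = snd v * t" by (rule slope)
  show "(THE t. (t, 1) \<in> k) = t" using slope t by (intro the_equality) fastforce+
qed

lemma lines_cases:
  assumes "k \<in> lines"
  obtains t where "(1, t) \<in> k" "norm t \<le> 1" | t where "(t, 1) \<in> k" "norm t \<le> 1"
proof -
  obtain a b where ab: "k = range (\<lambda>c. (c * a, c * b))" "(a, b) \<noteq> (0, 0)" using assms unfolding lines_def by blast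
  show thesis
  proof (cases "norm b \<le> norm a")
    case True
    then have a: "a \<noteq> 0" using ab(2) by auto
    then have "(1, b / a) \<in> k" unfolding ab(1) by (intro range_eqI[of _ _ "1 / a"]) simp
    moreover have "norm (b / a) \<le> 1" using True a by (simp add: norm_divide)
    ultimately show thesis by (rule that(1))
  next
    case False
    then have b: "b \<noteq> 0" by auto
    then have "(a / b, 1) \<in> k" unfolding ab(1) by (intro range_eqI[of _ _ "1 / b"]) simp
    moreover have "norm (a / b) \<le> 1" using False b by (simp add: norm_divide)
    ultimately show thesis by (rule that(2))
  qed
qed

lemma line_through: 
  assumes "(x, y) \<noteq> (0, 0)"
  shows "range (\<lambda>c. (c * x, c * y)) \<in> lines" "(0, 0) \<in> range (\<lambda>c. (c * x, c * y))"
    "x \<noteq> 0 \<Longrightarrow> (1, y / x) \<in> range (\<lambda>c. (c * x, c * y))"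
    "y \<noteq> 0 \<Longrightarrow> (x / y, 1) \<in> range (\<lambda>c. (c * x, c * y))"
proof -
  show "range (\<lambda>c. (c * x, c * y)) \<in> lines" unfolding lines_def using assms by blast
  show "(0, 0) \<in> range (\<lambda>c. (c * x, c * y))" by (rule range_eqI[of _ _ 0]) simp
  show "x \<noteq> 0 \<Longrightarrow> (1, y / x) \<in> range (\<lambda>c. (c * x, c * y))" by (rule range_eqI[of _ _ "1 / x"]) simp
  show "y \<noteq> 0 \<Longrightarrow> (x / y, 1) \<in> range (\<lambda>c. (c * x, c * y))" by (rule range_eqI[of _ _ "1 / y"]) simp
qed

context cx_surface
begin

text \<open>The Jacobian matrices of the two transitions are inverse to each other, so their
  determinants have product 1.\<close>

lemma chart_change_derivative:
  assumes p: "hol_chart X A p" "x \<in> fst p" and c: "hol_chart X A c" "x \<in> fst c"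
  obtains \<alpha>1 \<beta>1 \<alpha>2 \<beta>2 where
    "((\<lambda>q. fst (snd c (inv_into (fst p) (snd p) q))) has_derivative (\<lambda>v. \<alpha>1 * fst v + \<beta>1 * snd v)) (at (snd p x))"
    "((\<lambda>q. snd (snd c (inv_into (fst p) (snd p) q))) has_derivative (\<lambda>v. \<alpha>2 * fst v + \<beta>2 * snd v)) (at (snd p x))"
    "\<alpha>1 * \<beta>2 - \<alpha>2 * \<beta>1 \<noteq> 0"
proof -
  note chp = hol_chart_chart_of[OF p(1)] and chc = hol_chart_chart_of[OF c(1)]
  let ?g = "\<lambda>q. snd c (inv_into (fst p) (snd p) q)" and ?h = "\<lambda>q. snd p (inv_into (fst c) (snd c) q)"
  have tr: "cholo2 ?g (snd p x)" "cholo2 ?h (snd c x)"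
    using hol_chart_tr[OF p(1) c(1) p(2) c(2)] hol_chart_tr[OF c(1) p(1) c(2) p(2)] unfolding tr_def by auto
  obtain \<alpha>1 \<beta>1 where 1: "((\<lambda>q. fst (?g q)) has_derivative (\<lambda>v. \<alpha>1 * fst v + \<beta>1 * snd v)) (at (snd p x))"
    using tr(1) unfolding cholo2_iff cdiff2_def by blast
  obtain \<alpha>2 \<beta>2 where 2: "((\<lambda>q. snd (?g q)) has_derivative (\<lambda>v. \<alpha>2 * fst v + \<beta>2 * snd v)) (at (snd p x))"
    using tr(1) unfolding cholo2_iff cdiff2_def by blast
  obtain a1 b1 where 3: "((\<lambda>q. fst (?h q)) has_derivative (\<lambda>v. a1 * fst v + b1 * snd v)) (at (snd c x))"
    using tr(2) unfolding cholo2_iff cdiff2_def by blast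
  obtain a2 b2 where 4: "((\<lambda>q. snd (?h q)) has_derivative (\<lambda>v. a2 * fst v + b2 * snd v)) (at (snd c x))"
    using tr(2) unfolding cholo2_iff cdiff2_def by blast
  have h: "(?h has_derivative (\<lambda>v. (a1 * fst v + b1 * snd v, a2 * fst v + b2 * snd v))) (at (snd c x))"
    using has_derivative_Pair[OF 3 4] by simp
  have hx: "?h (snd c x) = snd p x" using chart_ofD(7)[OF chc c(2)] by simp
  have gh1: "((\<lambda>q. fst (?g (?h q))) has_derivative
      (\<lambda>v. \<alpha>1 * (a1 * fst v + b1 * snd v) + \<beta>1 * (a2 * fst v + b2 * snd v))) (at (snd c x))"
    using has_derivative_compose[OF h, of "\<lambda>q. fst (?g q)" "\<lambda>v. \<alpha>1 * fst v + \<beta>1 * snd v"] 1 hx by simp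
  have gh2: "((\<lambda>q. snd (?g (?h q))) has_derivative
      (\<lambda>v. \<alpha>2 * (a1 * fst v + b1 * snd v) + \<beta>2 * (a2 * fst v + b2 * snd v))) (at (snd c x))"
    using has_derivative_compose[OF h, of "\<lambda>q. snd (?g q)" "\<lambda>v. \<alpha>2 * fst v + \<beta>2 * snd v"] 2 hx by simp
  have ev: "eventually (\<lambda>q. ?g (?h q) = q) (nhds (snd c x))"
    using chart_inv_in[OF chc c(2)] chart_inv_eventually[OF chc c(2) eventually_nhdsin_openin[OF chart_ofD(1)[OF chp] p(2)]]
    by eventually_elim (simp add: chart_ofD(7)[OF chp])
  have ev': "eventually (\<lambda>q. fst (?g (?h q)) = fst q) (at (snd c x))" "eventually (\<lambda>q. snd (?g (?h q)) = snd q) (at (snd c x))"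
    using ev by (auto simp: eventually_at_filter elim: eventually_mono)
  have gx: "?g (?h (snd c x)) = snd c x" using eventually_nhds_x_imp_x[OF ev] .
  have "(fst has_derivative (\<lambda>v. \<alpha>1 * (a1 * fst v + b1 * snd v) + \<beta>1 * (a2 * fst v + b2 * snd v))) (at (snd c x))"
    by (rule has_derivative_transform_eventually[OF gh1 ev'(1)]) (simp_all add: gx)
  moreover have "(fst has_derivative fst) (at (snd c x))" by (auto intro!: derivative_eq_intros)
  ultimately have e1: "(\<lambda>v. \<alpha>1 * (a1 * fst v + b1 * snd v) + \<beta>1 * (a2 * fst v + b2 * snd v)) = fst"
    by (rule has_derivative_unique)
  have "(snd has_derivative (\<lambda>v. \<alpha>2 * (a1 * fst v + b1 * snd v) + \<beta>2 * (a2 * fst v + b2 * snd v))) (at (snd c x))"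
    by (rule has_derivative_transform_eventually[OF gh2 ev'(2)]) (simp_all add: gx)
  moreover have "(snd has_derivative snd) (at (snd c x))" by (auto intro!: derivative_eq_intros)
  ultimately have e2: "(\<lambda>v. \<alpha>2 * (a1 * fst v + b1 * snd v) + \<beta>2 * (a2 * fst v + b2 * snd v)) = snd"
    by (rule has_derivative_unique)
  have eqs: "\<alpha>1 * a1 + \<beta>1 * a2 = 1" "\<alpha>1 * b1 + \<beta>1 * b2 = 0" "\<alpha>2 * a1 + \<beta>2 * a2 = 0" "\<alpha>2 * b1 + \<beta>2 * b2 = 1"
    using fun_cong[OF e1, of "(1, 0)"] fun_cong[OF e1, of "(0, 1)"]
      fun_cong[OF e2, of "(1, 0)"] fun_cong[OF e2, of "(0, 1)"] by simp_all
  have "(\<alpha>1 * \<beta>2 - \<alpha>2 * \<beta>1) * (a1 * b2 - a2 * b1) =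
      (\<alpha>1 * a1 + \<beta>1 * a2) * (\<alpha>2 * b1 + \<beta>2 * b2) - (\<alpha>1 * b1 + \<beta>1 * b2) * (\<alpha>2 * a1 + \<beta>2 * a2)"
    by (simp add: algebra_simps)
  then have "\<alpha>1 * \<beta>2 - \<alpha>2 * \<beta>1 \<noteq> 0" unfolding eqs by auto
  with 1 2 show thesis by (rule that)
qed

lemma derivative_swap_chart:
  assumes p: "hol_chart X A p" "x \<in> fst p"
    and der: "((\<lambda>q. h (inv_into (fst p) (snd p) q)) has_derivative (\<lambda>v. \<alpha> * fst v + \<beta> * snd v)) (at (snd p x))"
  shows "((\<lambda>q. h (inv_into (fst p) (\<lambda>y. prod.swap (snd p y)) q) :: complex) has_derivative
    (\<lambda>v. \<beta> * fst v + \<alpha> * snd v)) (at (prod.swap (snd p x)))"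
proof -
  note chp = hol_chart_chart_of[OF p(1)]
  let ?p = "(fst p, \<lambda>y. prod.swap (snd p y))"
  note chp' = hol_chart_chart_of[OF hol_chart_swap[OF p(1)]]
  have "(prod.swap has_derivative (\<lambda>v. (snd v, fst v))) (at (prod.swap (snd p x)))"
    unfolding prod.swap_def by (auto intro!: derivative_eq_intros)
  from has_derivative_compose[OF this, of "\<lambda>q. h (inv_into (fst p) (snd p) q)" "\<lambda>v. \<alpha> * fst v + \<beta> * snd v"] der
  have d: "((\<lambda>q. h (inv_into (fst p) (snd p) (prod.swap q))) has_derivative (\<lambda>v. \<beta> * fst v + \<alpha> * snd v))
      (at (prod.swap (snd p x)))" by (simp add: add.commute)
  have ev: "eventually (\<lambda>q. h (inv_into (fst p) (snd p) (prod.swap q)) = h (inv_into (fst p) (\<lambda>y. prod.swap (snd p y)) q))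
      (nhds (prod.swap (snd p x)))"
  proof (rule eventually_mono)
    show "eventually (\<lambda>q. inv_into (fst p) (\<lambda>y. prod.swap (snd p y)) q \<in> fst p \<and>
        prod.swap (snd p (inv_into (fst p) (\<lambda>y. prod.swap (snd p y)) q)) = q) (nhds (prod.swap (snd p x)))"
      using chart_inv_in[OF chp', of x] p(2) by simp
    fix q let ?y = "inv_into (fst p) (\<lambda>y. prod.swap (snd p y)) q"
    assume "?y \<in> fst p \<and> prod.swap (snd p ?y) = q"
    then have "?y \<in> fst p" "prod.swap q = prod.swap (prod.swap (snd p ?y))" by simp_all
    then have y: "?y \<in> fst p" "prod.swap q = snd p ?y" by simp_all
    show "h (inv_into (fst p) (snd p) (prod.swap q)) = h ?y"
      unfolding y(2) chart_ofD(7)[OF chp y(1)] ..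
  qed
  show ?thesis
    by (rule has_derivative_transform_eventually[OF d])
      (use ev eventually_nhds_x_imp_x[OF ev] in \<open>auto simp: eventually_at_filter elim: eventually_mono\<close>)
qed

end

section \<open>Affine charts of the blow-up and the exceptional curve\<close>

locale blown_up = X: cx_surface X A
  for X :: "'a topology" and A +
  fixes z :: 'a and X' :: "'b topology" and A' and \<pi> :: "'b \<Rightarrow> 'a"
  assumes blow_up: "blow_up X A z X' A' \<pi>"
begin

sublocale two_surfaces X A X' A' \<pi> z
  using blow_up unfolding blow_up_def
  by (intro two_surfaces.intro X.cx_surface_axioms) (simp add: cx_surface_def)

text \<open>The coordinates of \<open>d\<close> are \<open>(v, t)\<close> with \<open>t\<close> the
  slope in \<open>p\<close>. The affine chart with the inverse slope has the same shape over the
  swapped \<open>p\<close>, so that one notion serves both.\<close>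

definition affine_pair :: "'a chart \<Rightarrow> 'b chart \<Rightarrow> bool"
  where "affine_pair p d \<longleftrightarrow> hol_chart X A p \<and> z \<in> fst p \<and> snd p z = (0, 0) \<and> hol_chart X' A' d \<and>
    (\<forall>y\<in>fst d. \<pi> y \<in> fst p \<and> snd p (\<pi> y) = (fst (snd d y), fst (snd d y) * snd (snd d y)))"

text \<open>Unpacks the incidence variety. Every line has slope of modulus at most 1 in one of the
  two charts, which covers the exceptional curve by compact pieces; and every slope occurs because
  every line through the origin does.\<close>

lemma affine_charts:
  obtains p d1 d2 where "affine_pair p d1" "affine_pair (fst p, \<lambda>x. prod.swap (snd p x)) d2"
    "\<forall>y\<in>topspace X'. \<pi> y = z \<longrightarrow> (y \<in> fst d1 \<and> norm (snd (snd d1 y)) \<le> 1) \<or> (y \<in> fst d2 \<and> norm (snd (snd d2 y)) \<le> 1)"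
    "\<forall>t. \<exists>y\<in>fst d1. snd d1 y = (0, t)" "\<forall>t. \<exists>y\<in>fst d2. snd d2 y = (0, t)"
proof -
  obtain U \<psi> l where U: "hol_chart X A (U, \<psi>)" "z \<in> U" "\<psi> z = (0, 0)"
    and bij: "bij_betw (\<lambda>y. (\<psi> (\<pi> y), l y)) {y \<in> topspace X'. \<pi> y \<in> U} {(v, k). v \<in> \<psi> ` U \<and> k \<in> lines \<and> v \<in> k}"
    and 1: "hol_chart X' A' ({y \<in> topspace X'. \<pi> y \<in> U \<and> (\<exists>t. (1, t) \<in> l y)},
         \<lambda>y. (fst (\<psi> (\<pi> y)), THE t. (1, t) \<in> l y))"
    and 2: "hol_chart X' A' ({y \<in> topspace X'. \<pi> y \<in> U \<and> (\<exists>s. (s, 1) \<in> l y)},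
         \<lambda>y. (THE s. (s, 1) \<in> l y, snd (\<psi> (\<pi> y))))"
    using blow_up unfolding blow_up_def by blast
  have line: "l y \<in> lines" "\<psi> (\<pi> y) \<in> l y" if "y \<in> topspace X'" "\<pi> y \<in> U" for y
    using bij_betw_apply[OF bij, of y] that by auto
  let ?p = "(U, \<psi>)" and ?p' = "(fst (U, \<psi>), \<lambda>x. prod.swap (snd (U, \<psi>) x))"
  let ?d1 = "({y \<in> topspace X'. \<pi> y \<in> U \<and> (\<exists>t. (1, t) \<in> l y)}, \<lambda>y. (fst (\<psi> (\<pi> y)), THE t. (1, t) \<in> l y))"
  let ?d2' = "({y \<in> topspace X'. \<pi> y \<in> U \<and> (\<exists>s. (s, 1) \<in> l y)}, \<lambda>y. (THE s. (s, 1) \<in> l y, snd (\<psi> (\<pi> y))))"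
  let ?d2 = "(fst ?d2', \<lambda>y. prod.swap (snd ?d2' y))"
  have inj: "inj_on \<psi> U" using chart_ofD(3)[OF hol_chart_chart_of[OF U(1)]] by simp
  have pts: "\<exists>y. y \<in> topspace X' \<and> \<pi> y = z \<and> l y = k" if "k \<in> lines" "(0, 0) \<in> k" for k
  proof -
    have "((0, 0), k) \<in> {(v, k). v \<in> \<psi> ` U \<and> k \<in> lines \<and> v \<in> k}" using U that by force
    then have "((0, 0), k) \<in> (\<lambda>y. (\<psi> (\<pi> y), l y)) ` {y \<in> topspace X'. \<pi> y \<in> U}"
      using bij_betw_imp_surj_on[OF bij] by simp
    then obtain y where y: "y \<in> topspace X'" "\<pi> y \<in> U" "\<psi> (\<pi> y) = (0, 0)" "l y = k" by auto
    then have "\<pi> y = z" using inj_onD[OF inj _ y(2) U(2)] U(3) by simp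
    with y show ?thesis by blast
  qed
  show thesis
  proof (rule that[of ?p ?d1 ?d2])
    show "affine_pair ?p ?d1"
      unfolding affine_pair_def
    proof (intro conjI ballI)
      fix y assume y: "y \<in> fst ?d1"
      then obtain t where t: "(1, t) \<in> l y" by auto
      show "snd ?p (\<pi> y) = (fst (snd ?d1 y), fst (snd ?d1 y) * snd (snd ?d1 y))"
        using lines_slope[OF line(1) t] line(2) y by (simp add: prod_eq_iff)
    qed (use U 1 in auto)
    show "affine_pair ?p' ?d2"
      unfolding affine_pair_def
    proof (intro conjI ballI)
      show "hol_chart X A ?p'" using X.hol_chart_swap[OF U(1)] .
      show "hol_chart X' A' ?d2" using X'.hol_chart_swap[OF 2] .
      fix y assume y: "y \<in> fst ?d2"
      then obtain t where t: "(t, 1) \<in> l y" by auto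
      show "snd ?p' (\<pi> y) = (fst (snd ?d2 y), fst (snd ?d2 y) * snd (snd ?d2 y))"
        using lines_slope'[OF line(1) t] line(2) y by (simp add: prod_eq_iff)
    qed (use U in auto)
    show "\<forall>y\<in>topspace X'. \<pi> y = z \<longrightarrow> (y \<in> fst ?d1 \<and> norm (snd (snd ?d1 y)) \<le> 1) \<or> (y \<in> fst ?d2 \<and> norm (snd (snd ?d2 y)) \<le> 1)"
    proof (intro ballI impI)
      fix y assume y: "y \<in> topspace X'" "\<pi> y = z"
      then have ly: "l y \<in> lines" using line U(2) by simp
      from lines_cases[OF ly] show "(y \<in> fst ?d1 \<and> norm (snd (snd ?d1 y)) \<le> 1) \<or> (y \<in> fst ?d2 \<and> norm (snd (snd ?d2 y)) \<le> 1)"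
      proof cases
        case (1 t)
        then show ?thesis using lines_slope(1)[OF ly 1(1)] y U(2) by auto
      next
        case (2 t)
        then show ?thesis using lines_slope'(1)[OF ly 2(1)] y U(2) by auto
      qed
    qed
    show "\<forall>t. \<exists>y\<in>fst ?d1. snd ?d1 y = (0, t)"
    proof
      fix t
      note k = line_through[of 1 t, simplified]
      obtain y where y: "y \<in> topspace X'" "\<pi> y = z" "l y = range (\<lambda>c. (c, c * t))" using pts[OF k(1,2)] by blast
      have "(1, t) \<in> l y" "l y \<in> lines" using k y by auto
      then show "\<exists>y\<in>fst ?d1. snd ?d1 y = (0, t)"
        using lines_slope(1)[of "l y" t] y(1,2) U(2,3) by (intro bexI[of _ y]) auto
    qed
    show "\<forall>t. \<exists>y\<in>fst ?d2. snd ?d2 y = (0, t)"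
    proof
      fix t
      note k = line_through[of t 1, simplified]
      obtain y where y: "y \<in> topspace X'" "\<pi> y = z" "l y = range (\<lambda>c. (c * t, c))" using pts[OF k(1,2)] by blast
      have "(t, 1) \<in> l y" "l y \<in> lines" using k y by auto
      then show "\<exists>y\<in>fst ?d2. snd ?d2 y = (0, t)"
        using lines_slope'(1)[of "l y" t] y(1,2) U(2,3) by (intro bexI[of _ y]) auto
    qed
  qed
qed

lemma affine_pair_zero_iff:
  assumes "affine_pair p d" "y \<in> fst d"
  shows "\<pi> y = z \<longleftrightarrow> fst (snd d y) = 0"
proof -
  have p: "hol_chart X A p" "z \<in> fst p" "snd p z = (0, 0)" "\<pi> y \<in> fst p"
    "snd p (\<pi> y) = (fst (snd d y), fst (snd d y) * snd (snd d y))"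
    using assms unfolding affine_pair_def by auto
  have "\<pi> y = z \<longleftrightarrow> snd p (\<pi> y) = snd p z"
    using chart_ofD(3)[OF hol_chart_chart_of[OF p(1)]] p(2,4) by (auto dest: inj_onD)
  then show ?thesis unfolding p(3,5) by auto
qed

text \<open>The exceptional curve is a union of two discs of slopes of modulus at most 1, each
  compact in its affine chart and therefore closed.\<close>

lemma exceptional_closedin: "closedin X' {y \<in> topspace X'. \<pi> y = z}"
proof -
  obtain p d1 d2 where p: "affine_pair p d1" "affine_pair (fst p, \<lambda>x. prod.swap (snd p x)) d2"
    and cov: "\<forall>y\<in>topspace X'. \<pi> y = z \<longrightarrow> (y \<in> fst d1 \<and> norm (snd (snd d1 y)) \<le> 1) \<or> (y \<in> fst d2 \<and> norm (snd (snd d2 y)) \<le> 1)"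
    and sur: "\<forall>t. \<exists>y\<in>fst d1. snd d1 y = (0, t)" "\<forall>t. \<exists>y\<in>fst d2. snd d2 y = (0, t)"
    by (rule affine_charts)
  have d: "chart_of X' d1" "chart_of X' d2" using p hol_chart_chart_of unfolding affine_pair_def by blast+
  let ?K = "{0 :: complex} \<times> cball (0 :: complex) 1"
  have K: "compact ?K" by (intro compact_Times) auto
  have sub: "?K \<subseteq> snd d ` fst d" if sur_d: "\<forall>t. \<exists>y\<in>fst d. snd d y = (0, t)" for d :: "'b chart"
  proof
    fix q assume "q \<in> ?K"
    then have "q = (0, snd q)" by (auto simp: prod_eq_iff mem_Times_iff)
    moreover obtain y where "y \<in> fst d" "snd d y = (0, snd q)" using sur_d by blast
    ultimately show "q \<in> snd d ` fst d" by (metis imageI)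
  qed
  have "{y \<in> topspace X'. \<pi> y = z} = {y \<in> fst d1. snd d1 y \<in> ?K} \<union> {y \<in> fst d2. snd d2 y \<in> ?K}"
  proof (intro equalityI subsetI)
    fix y assume "y \<in> {y \<in> topspace X'. \<pi> y = z}"
    then have y: "y \<in> topspace X'" "\<pi> y = z" by auto
    from cov y have "(y \<in> fst d1 \<and> norm (snd (snd d1 y)) \<le> 1) \<or> (y \<in> fst d2 \<and> norm (snd (snd d2 y)) \<le> 1)" by blast
    then show "y \<in> {y \<in> fst d1. snd d1 y \<in> ?K} \<union> {y \<in> fst d2. snd d2 y \<in> ?K}"
      using affine_pair_zero_iff[OF p(1), of y] affine_pair_zero_iff[OF p(2), of y] y(2)
      by (auto simp: mem_Times_iff)
  next
    fix y assume "y \<in> {y \<in> fst d1. snd d1 y \<in> ?K} \<union> {y \<in> fst d2. snd d2 y \<in> ?K}"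
    then show "y \<in> {y \<in> topspace X'. \<pi> y = z}"
      using affine_pair_zero_iff[OF p(1), of y] affine_pair_zero_iff[OF p(2), of y]
        chart_ofD(6)[OF d(1), of y] chart_ofD(6)[OF d(2), of y]
      by (auto simp: mem_Times_iff)
  qed
  then show ?thesis
    using closedin_Un[OF X'.chart_compact_closedin[OF d(1) K sub[OF sur(1)]] X'.chart_compact_closedin[OF d(2) K sub[OF sur(2)]]] by simp
qed

definition "off_E = {y \<in> topspace X'. \<pi> y \<noteq> z}"

text \<open>Openness on both sides has to be supplied: the exceptional curve is closed by
  compactness, and \<open>{z}\<close> because the surface is Hausdorff. The inverse homeomorphism is
  identified with \<open>inv_into\<close>, for which \<open>blow_up\<close> states
  holomorphy.\<close>

lemma bih_off_E: "bih X' A' off_E X A (topspace X - {z}) \<pi> (inv_into off_E \<pi>)"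
proof -
  have bi: "homeomorphic_map (subtopology X' off_E) (subtopology X (topspace X - {z})) \<pi>"
    "\<forall>(U, \<phi>)\<in>A'. \<forall>(V, \<psi>)\<in>A.
       holomorphic2_on (\<psi> \<circ> \<pi> \<circ> inv_into U \<phi>) (\<phi> ` {x \<in> U \<inter> off_E. \<pi> x \<in> V}) \<and>
       holomorphic2_on (\<phi> \<circ> inv_into off_E \<pi> \<circ> inv_into V \<psi>) (\<psi> ` \<pi> ` {x \<in> U \<inter> off_E. \<pi> x \<in> V})"
    using blow_up unfolding blow_up_def biholomorphic_def off_E_def by blast+
  have "off_E = topspace X' - {y \<in> topspace X'. \<pi> y = z}" unfolding off_E_def by blast
  then have op': "openin X' off_E" using exceptional_closedin by (simp add: openin_diff)
  have "closedin X {z}"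
  proof -
    have "z \<in> topspace X"
    proof (rule affine_charts)
      fix p d1 d2 assume "affine_pair p d1"
      then have "hol_chart X A p" "z \<in> fst p" unfolding affine_pair_def by blast+
      then show "z \<in> topspace X" using chart_ofD(6)[OF hol_chart_chart_of[of X A p], of z] by simp
    qed
    then show ?thesis by (rule closedin_Hausdorff_singleton[OF X.Hausdorff])
  qed
  then have op: "openin X (topspace X - {z})" by (simp add: openin_diff)
  have top: "topspace (subtopology X' off_E) = off_E" "topspace (subtopology X (topspace X - {z})) = topspace X - {z}"
    by (auto simp: off_E_def)
  obtain g where g: "homeomorphic_maps (subtopology X' off_E) (subtopology X (topspace X - {z})) \<pi> g"
    using bi(1) unfolding homeomorphic_map_maps by blast
  have "homeomorphic_maps (subtopology X' off_E) (subtopology X (topspace X - {z})) \<pi> (inv_into off_E \<pi>)"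
  proof (rule homeomorphic_maps_eq[OF g])
    fix y assume y: "y \<in> topspace (subtopology X (topspace X - {z}))"
    have inj: "inj_on \<pi> off_E" using homeomorphic_imp_injective_map[OF bi(1)] top by simp
    have gy: "\<pi> (g y) = y" using g y unfolding homeomorphic_maps_def by simp
    have "g \<in> topspace (subtopology X (topspace X - {z})) \<rightarrow> topspace (subtopology X' off_E)"
      using g unfolding homeomorphic_maps_def continuous_map_def by simp
    then have "g y \<in> off_E" using y top by blast
    from inv_into_f_f[OF inj this] show "g y = inv_into off_E \<pi> y" unfolding gy by simp
  qed auto
  moreover have "cholo2 (\<lambda>q. snd d (\<pi> (inv_into (fst c) (snd c) q))) (snd c x) \<and>
      cholo2 (\<lambda>q. snd c (inv_into off_E \<pi> (inv_into (fst d) (snd d) q))) (snd d (\<pi> x))"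
    if "c \<in> A'" "d \<in> A" "x \<in> fst c \<inter> off_E" "\<pi> x \<in> fst d" for c d x
  proof -
    obtain U \<phi> V \<psi> where cd: "c = (U, \<phi>)" "d = (V, \<psi>)" by fastforce
    have "holomorphic2_on (\<psi> \<circ> \<pi> \<circ> inv_into U \<phi>) (\<phi> ` {x \<in> U \<inter> off_E. \<pi> x \<in> V})"
      "holomorphic2_on (\<phi> \<circ> inv_into off_E \<pi> \<circ> inv_into V \<psi>) (\<psi> ` \<pi> ` {x \<in> U \<inter> off_E. \<pi> x \<in> V})"
      using bspec[OF bspec[OF bi(2) that(1)[unfolded cd], unfolded prod.case] that(2)[unfolded cd], unfolded prod.case]
      by (rule conjunct1, rule conjunct2)
    moreover have "x \<in> {x \<in> U \<inter> off_E. \<pi> x \<in> V}" using that cd by simp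
    ultimately show ?thesis unfolding holomorphic2_on_iff cd comp_def by auto
  qed
  ultimately show ?thesis unfolding bih_def using op op' by blast
qed

text \<open>The coordinates of \<open>d\<close> are \<open>(w\<^sub>1, w\<^sub>2 / w\<^sub>1)\<close>. The definition of the blow-up provides such a
  \<open>d\<close> for one chart \<open>w\<close> centred at \<open>z\<close> only; here \<open>w\<close> is arbitrary.\<close>

definition slope_chart :: "'a chart \<Rightarrow> 'b chart \<Rightarrow> bool"
  where "slope_chart c d \<longleftrightarrow> hol_chart X' A' d \<and>
    (\<forall>y\<in>fst d. \<pi> y \<in> fst c \<and> snd c (\<pi> y) = (fst (snd d y), fst (snd d y) * snd (snd d y)))"

text \<open>The Jacobian matrix sends the direction \<open>(1, t0)\<close> to a nonzero vector. If
  its first entry is zero, the second is not, and the slope is finite in the swapped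
  coordinates.\<close>

lemma slope_chart_exists_at:
  assumes c: "hol_chart X A c" "z \<in> fst c" "snd c z = (0, 0)" and pd: "affine_pair p d"
    and y0: "y0 \<in> fst d" "snd d y0 = (0, t0)"
  obtains d' s where "slope_chart c d' \<or> slope_chart (fst c, \<lambda>x. prod.swap (snd c x)) d'"
    "y0 \<in> fst d'" "snd d' y0 = (0, s)"
proof -
  have p: "hol_chart X A p" "z \<in> fst p" "snd p z = (0, 0)" "hol_chart X' A' d"
    and proj: "\<forall>y\<in>fst d. \<pi> y \<in> fst p \<and> snd p (\<pi> y) = (fst (snd d y), fst (snd d y) * snd (snd d y))"
    using pd unfolding affine_pair_def by auto
  let ?c = "(fst c, \<lambda>x. prod.swap (snd c x))"
  have c': "hol_chart X A ?c" "z \<in> fst ?c" "snd ?c z = (0, 0)" using X.hol_chart_swap[OF c(1)] c by auto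
  obtain \<alpha>1 \<beta>1 \<alpha>2 \<beta>2 where
    der: "((\<lambda>q. fst (snd c (inv_into (fst p) (snd p) q))) has_derivative (\<lambda>v. \<alpha>1 * fst v + \<beta>1 * snd v)) (at (0, 0))"
    "((\<lambda>q. snd (snd c (inv_into (fst p) (snd p) q))) has_derivative (\<lambda>v. \<alpha>2 * fst v + \<beta>2 * snd v)) (at (0, 0))"
    and det: "\<alpha>1 * \<beta>2 - \<alpha>2 * \<beta>1 \<noteq> 0"
    using X.chart_change_derivative[OF p(1,2) c(1,2)] unfolding p(3) by blast
  show thesis
  proof (cases "\<alpha>1 + \<beta>1 * t0 = 0")
    case False
    obtain d' where "y0 \<in> fst d'" "fst d' \<subseteq> fst d" "hol_chart X' A' d'"
      "\<forall>y\<in>fst d'. \<pi> y \<in> fst c \<and> snd c (\<pi> y) = (fst (snd d' y), fst (snd d' y) * snd (snd d' y))"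
      "snd d' y0 = (0, (\<alpha>2 + \<beta>2 * t0) / (\<alpha>1 + \<beta>1 * t0))"
      by (rule blow_up_chart[OF p(1-3) c p(4) y0 proj der det False])
    then show thesis using that unfolding slope_chart_def by blast
  next
    case True
    have nz: "\<alpha>2 + \<beta>2 * t0 \<noteq> 0"
    proof
      assume "\<alpha>2 + \<beta>2 * t0 = 0"
      with True have "\<alpha>1 = - (\<beta>1 * t0)" "\<alpha>2 = - (\<beta>2 * t0)" by (simp_all add: eq_neg_iff_add_eq_0)
      with det show False by simp
    qed
    have der': "((\<lambda>q. fst (snd ?c (inv_into (fst p) (snd p) q))) has_derivative (\<lambda>v. \<alpha>2 * fst v + \<beta>2 * snd v)) (at (0, 0))"
      "((\<lambda>q. snd (snd ?c (inv_into (fst p) (snd p) q))) has_derivative (\<lambda>v. \<alpha>1 * fst v + \<beta>1 * snd v)) (at (0, 0))"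
      using der by simp_all
    have det': "\<alpha>2 * \<beta>1 - \<alpha>1 * \<beta>2 \<noteq> 0" using det by auto
    obtain d' where "y0 \<in> fst d'" "fst d' \<subseteq> fst d" "hol_chart X' A' d'"
      "\<forall>y\<in>fst d'. \<pi> y \<in> fst ?c \<and> snd ?c (\<pi> y) = (fst (snd d' y), fst (snd d' y) * snd (snd d' y))"
      "snd d' y0 = (0, (\<alpha>1 + \<beta>1 * t0) / (\<alpha>2 + \<beta>2 * t0))"
      by (rule blow_up_chart[OF p(1-3) c' p(4) y0 proj der' det' nz])
    then show thesis using that unfolding slope_chart_def by blast
  qed
qed

lemma slope_chart_covers:
  assumes c: "hol_chart X A c" "z \<in> fst c" "snd c z = (0, 0)" and y0: "y0 \<in> topspace X'" "\<pi> y0 = z"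
  obtains d s where "slope_chart c d \<or> slope_chart (fst c, \<lambda>x. prod.swap (snd c x)) d"
    "y0 \<in> fst d" "snd d y0 = (0, s)"
proof -
  obtain p d1 d2 where p: "affine_pair p d1" "affine_pair (fst p, \<lambda>x. prod.swap (snd p x)) d2"
    and cov: "\<forall>y\<in>topspace X'. \<pi> y = z \<longrightarrow> (y \<in> fst d1 \<and> norm (snd (snd d1 y)) \<le> 1) \<or> (y \<in> fst d2 \<and> norm (snd (snd d2 y)) \<le> 1)"
    and "\<forall>t. \<exists>y\<in>fst d1. snd d1 y = (0, t)" "\<forall>t. \<exists>y\<in>fst d2. snd d2 y = (0, t)"
    by (rule affine_charts)
  from cov y0 consider "y0 \<in> fst d1" | "y0 \<in> fst d2" by blast
  then show thesis
  proof cases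
    case 1
    have "snd d1 y0 = (0, snd (snd d1 y0))" using affine_pair_zero_iff[OF p(1) 1] y0(2) by (simp add: prod_eq_iff)
    from slope_chart_exists_at[OF c p(1) 1 this] show thesis using that by blast
  next
    case 2
    have "snd d2 y0 = (0, snd (snd d2 y0))" using affine_pair_zero_iff[OF p(2) 2] y0(2) by (simp add: prod_eq_iff)
    from slope_chart_exists_at[OF c p(2) 2 this] show thesis using that by blast
  qed
qed

text \<open>The direction of slope \<open>s\<close> is pulled back by the Jacobian matrix and looked
  up in the affine chart where its slope is finite.\<close>

lemma slope_chart_surj:
  assumes c: "hol_chart X A c" "z \<in> fst c" "snd c z = (0, 0)"
  obtains d y0 where "slope_chart c d" "y0 \<in> fst d" "snd d y0 = (0, s)"
proof -
  obtain p d1 d2 where p: "affine_pair p d1" "affine_pair (fst p, \<lambda>x. prod.swap (snd p x)) d2"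
    and cov: "\<forall>y\<in>topspace X'. \<pi> y = z \<longrightarrow> (y \<in> fst d1 \<and> norm (snd (snd d1 y)) \<le> 1) \<or> (y \<in> fst d2 \<and> norm (snd (snd d2 y)) \<le> 1)"
    and sur: "\<forall>t. \<exists>y\<in>fst d1. snd d1 y = (0, t)" "\<forall>t. \<exists>y\<in>fst d2. snd d2 y = (0, t)"
    by (rule affine_charts)
  let ?p = "(fst p, \<lambda>x. prod.swap (snd p x))"
  have p1: "hol_chart X A p" "z \<in> fst p" "snd p z = (0, 0)" "hol_chart X' A' d1"
    and proj1: "\<forall>y\<in>fst d1. \<pi> y \<in> fst p \<and> snd p (\<pi> y) = (fst (snd d1 y), fst (snd d1 y) * snd (snd d1 y))"
    using p(1) unfolding affine_pair_def by auto
  have p2: "hol_chart X A ?p" "z \<in> fst ?p" "snd ?p z = (0, 0)" "hol_chart X' A' d2"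
    and proj2: "\<forall>y\<in>fst d2. \<pi> y \<in> fst ?p \<and> snd ?p (\<pi> y) = (fst (snd d2 y), fst (snd d2 y) * snd (snd d2 y))"
    using p(2) unfolding affine_pair_def by auto
  obtain \<alpha>1 \<beta>1 \<alpha>2 \<beta>2 where
    der: "((\<lambda>q. fst (snd c (inv_into (fst p) (snd p) q))) has_derivative (\<lambda>v. \<alpha>1 * fst v + \<beta>1 * snd v)) (at (snd p z))"
    "((\<lambda>q. snd (snd c (inv_into (fst p) (snd p) q))) has_derivative (\<lambda>v. \<alpha>2 * fst v + \<beta>2 * snd v)) (at (snd p z))"
    and det: "\<alpha>1 * \<beta>2 - \<alpha>2 * \<beta>1 \<noteq> 0"
    using X.chart_change_derivative[OF p1(1,2) c(1,2)] by blast
  \<comment> \<open>\<open>(x, y)\<close> is the adjugate of the Jacobian matrix applied to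
    \<open>(1, s)\<close>, so the matrix sends it to the determinant times
    \<open>(1, s)\<close>.\<close>
  define x where "x = \<beta>2 - \<beta>1 * s"
  define y where "y = \<alpha>1 * s - \<alpha>2"
  have xy: "\<alpha>1 * x + \<beta>1 * y = \<alpha>1 * \<beta>2 - \<alpha>2 * \<beta>1" "\<alpha>2 * x + \<beta>2 * y = s * (\<alpha>1 * \<beta>2 - \<alpha>2 * \<beta>1)"
    by (simp_all add: x_def y_def algebra_simps)
  show thesis
  proof (cases "x = 0")
    case False
    obtain y0 where y0: "y0 \<in> fst d1" "snd d1 y0 = (0, y / x)" using sur(1) by blast
    have e: "\<alpha>1 + \<beta>1 * (y / x) = (\<alpha>1 * \<beta>2 - \<alpha>2 * \<beta>1) / x" "\<alpha>2 + \<beta>2 * (y / x) = s * (\<alpha>1 * \<beta>2 - \<alpha>2 * \<beta>1) / x"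
      using xy False by (simp_all add: field_simps)
    have nz: "\<alpha>1 + \<beta>1 * (y / x) \<noteq> 0" unfolding e using det False by simp
    have sl: "(\<alpha>2 + \<beta>2 * (y / x)) / (\<alpha>1 + \<beta>1 * (y / x)) = s" unfolding e using det False by simp
    obtain d' where "y0 \<in> fst d'" "fst d' \<subseteq> fst d1" "hol_chart X' A' d'"
      "\<forall>y\<in>fst d'. \<pi> y \<in> fst c \<and> snd c (\<pi> y) = (fst (snd d' y), fst (snd d' y) * snd (snd d' y))"
      "snd d' y0 = (0, s)"
      by (rule blow_up_chart[OF p1(1-3) c p1(4) y0 proj1 der[unfolded p1(3)] det nz, unfolded sl])
    then show thesis using that unfolding slope_chart_def by blast
  next
    case True
    have y: "y \<noteq> 0" using xy(1) det True by auto
    have der': "((\<lambda>q. fst (snd c (inv_into (fst ?p) (snd ?p) q))) has_derivative (\<lambda>v. \<beta>1 * fst v + \<alpha>1 * snd v)) (at (0, 0))"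
      "((\<lambda>q. snd (snd c (inv_into (fst ?p) (snd ?p) q))) has_derivative (\<lambda>v. \<beta>2 * fst v + \<alpha>2 * snd v)) (at (0, 0))"
      using X.derivative_swap_chart[OF p1(1,2) der(1)] X.derivative_swap_chart[OF p1(1,2) der(2)] p1(3) by simp_all
    have det': "\<beta>1 * \<alpha>2 - \<beta>2 * \<alpha>1 \<noteq> 0" using det by (auto simp: mult.commute)
    \<comment> \<open>\<open>x = 0\<close> is the vertical direction, which is the slope 0 of the
      second affine chart.\<close>
    obtain y0 where y0: "y0 \<in> fst d2" "snd d2 y0 = (0, 0)" using sur(2) by blast
    have e: "\<beta>1 * y = \<alpha>1 * \<beta>2 - \<alpha>2 * \<beta>1" "\<beta>2 * y = s * (\<alpha>1 * \<beta>2 - \<alpha>2 * \<beta>1)" using xy True by simp_all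
    have nz: "\<beta>1 + \<alpha>1 * 0 \<noteq> 0" using e(1) det by auto
    have "\<beta>2 * y = s * (\<beta>1 * y)" using e by simp
    then have "\<beta>2 = s * \<beta>1" using y by simp
    then have sl: "(\<beta>2 + \<alpha>2 * 0) / (\<beta>1 + \<alpha>1 * 0) = s" using nz by simp
    obtain d' where "y0 \<in> fst d'" "fst d' \<subseteq> fst d2" "hol_chart X' A' d'"
      "\<forall>y\<in>fst d'. \<pi> y \<in> fst c \<and> snd c (\<pi> y) = (fst (snd d' y), fst (snd d' y) * snd (snd d' y))"
      "snd d' y0 = (0, s)"
      by (rule blow_up_chart[OF p2(1-3) c p2(4) y0 proj2 der' det' nz, unfolded sl])
    then show thesis using that unfolding slope_chart_def by blast
  qed
qed

end

section \<open>The radial deformation of a corner\<close>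

text \<open>\<open>R\<close> is the radius at which the deformation stops. It stays strictly below
  the radius of the chart, which is \<open>R0\<close> in \<open>box_chart\<close>.\<close>

locale radial =
  fixes r R :: real
  assumes r: "0 < r" and rR: "r < R"
begin

text \<open>The amount added to the modulus \<open>a\<close> when the other modulus is
  \<open>b\<close>. The middle factor is \<open>1 - b / a\<close> for \<open>b \<le> a\<close> and
  depends on the quotient only; the last one is the cut-off. The truncations by \<open>max\<close>
  make one formula cover all cases, and at most one of \<open>shift a b\<close> and
  \<open>shift b a\<close> is nonzero.\<close>

definition shift :: "real \<Rightarrow> real \<Rightarrow> real"
  where "shift a b = r * (max 0 (a - b) / max a b) * max 0 (1 - a / R)"

text \<open>The slope of \<open>a + shift a 0 = r + slope_coeff * a\<close> for
  \<open>0 < a \<le> R\<close>, and the leading coefficient of the quadratic equation for the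
  inverse.\<close>

definition slope_coeff :: real where "slope_coeff = 1 - r / R"

text \<open>Confines \<open>u\<close> to the interval from \<open>b\<close> to \<open>R\<close>, on
  which the quadratic equation describes the inverse; if \<open>b > R\<close> the value is
  \<open>R\<close>.\<close>

definition clip :: "real \<Rightarrow> real \<Rightarrow> real"
  where "clip u b = max (min b R) (min u R)"

definition lin_coeff :: "real \<Rightarrow> real \<Rightarrow> real"
  where "lin_coeff c b = r + r * b / R - c"

text \<open>For \<open>b \<le> a \<le> R\<close> the equation \<open>a + shift a b = c\<close> is quadratic in \<open>a\<close>, and this is its
  nonnegative root.\<close>

definition root2 :: "real \<Rightarrow> real \<Rightarrow> real"
  where "root2 c b = (sqrt ((lin_coeff c b)\<^sup>2 + 4 * slope_coeff * (r * b)) - lin_coeff c b) / (2 * slope_coeff)"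

text \<open>At both ends of the interval of \<open>clip\<close> the root equals
  \<open>clip u b\<close>, so the correction vanishes beyond them and one continuous formula gives
  the inverse everywhere.\<close>

definition unshift :: "real \<Rightarrow> real \<Rightarrow> real"
  where "unshift u b = u + (root2 (clip u b) b - clip u b)"

text \<open>The quotient \<open>b / root2 c b\<close>, in a form that is continuous up to \<open>b = 0\<close>.\<close>

definition ratio :: "real \<Rightarrow> real \<Rightarrow> real"
  where "ratio u b = (slope_coeff * root2 (clip u b) b + lin_coeff (clip u b) b) / r"

section \<open>The quadratic equation and the inverse of the shift\<close>

lemma R_pos: "0 < R" and slope_coeff_pos: "0 < slope_coeff"
  using r rR by (simp_all add: slope_coeff_def)

lemma root2_eq:
  assumes "0 \<le> b"
  shows "slope_coeff * (root2 c b)\<^sup>2 + lin_coeff c b * root2 c b = r * b" "0 \<le> root2 c b"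
proof -
  let ?A = slope_coeff and ?B = "lin_coeff c b"
  let ?D = "?B\<^sup>2 + 4 * ?A * (r * b)"
  have A: "?A > 0" by (rule slope_coeff_pos)
  have D: "?D \<ge> ?B\<^sup>2" using assms r A by simp
  then have "0 \<le> ?D" using zero_le_power2[of ?B] by linarith
  then have s: "(sqrt ?D)\<^sup>2 = ?D" by simp
  have "2 * ?A * root2 c b = sqrt ?D - ?B" using A by (simp add: root2_def)
  then have e: "sqrt ?D = 2 * ?A * root2 c b + ?B" by simp
  have "4 * ?A * (?A * (root2 c b)\<^sup>2 + ?B * root2 c b) = (2 * ?A * root2 c b + ?B)\<^sup>2 - ?B\<^sup>2"
    by (simp add: power2_eq_square algebra_simps)
  also have "\<dots> = 4 * ?A * (r * b)" using s unfolding e by simp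
  finally show "?A * (root2 c b)\<^sup>2 + ?B * root2 c b = r * b" using A by simp
  have "sqrt ?D \<ge> \<bar>?B\<bar>" using D by (metis real_sqrt_abs real_sqrt_le_iff)
  then show "0 \<le> root2 c b" using A by (simp add: root2_def)
qed

lemma root2_pos:
  assumes "0 < b"
  shows "0 < root2 c b"
proof -
  have "root2 c b \<noteq> 0" using root2_eq(1)[of b c] assms r by auto
  then show ?thesis using root2_eq(2)[of b c] assms by simp
qed

text \<open>The difference of the two sides is \<open>y - root2 c b\<close> times a factor. The
  factor is positive because the root satisfies \<open>root2 c b * (slope_coeff * root2 c b +
  lin_coeff c b) = r * b\<close> with \<open>b > 0\<close>.\<close>

lemma root2_unique:
  assumes b: "0 < b" and y: "0 < y"
  shows "slope_coeff * y\<^sup>2 + lin_coeff c b * y \<le> r * b \<Longrightarrow> y \<le> root2 c b"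
    and "r * b \<le> slope_coeff * y\<^sup>2 + lin_coeff c b * y \<Longrightarrow> root2 c b \<le> y"
proof -
  let ?x = "root2 c b"
  have x: "0 < ?x" "slope_coeff * ?x\<^sup>2 + lin_coeff c b * ?x = r * b"
    using root2_pos[OF b] root2_eq[of b c] b by auto
  have "?x * (slope_coeff * ?x + lin_coeff c b) = r * b"
    using x(2) by (simp add: power2_eq_square algebra_simps)
  then have "0 < slope_coeff * ?x + lin_coeff c b" using x(1) b r by (metis mult_pos_pos zero_less_mult_pos)
  then have pos: "0 < slope_coeff * (y + ?x) + lin_coeff c b"
    using y slope_coeff_pos by (simp add: algebra_simps add_pos_pos)
  have diff: "slope_coeff * y\<^sup>2 + lin_coeff c b * y - r * b = (y - ?x) * (slope_coeff * (y + ?x) + lin_coeff c b)"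
    unfolding x(2)[symmetric] by (simp add: power2_eq_square algebra_simps)
  show "y \<le> ?x" if "slope_coeff * y\<^sup>2 + lin_coeff c b * y \<le> r * b"
  proof -
    have "(y - ?x) * (slope_coeff * (y + ?x) + lin_coeff c b) \<le> 0" using that unfolding diff[symmetric] by simp
    then show ?thesis using pos by (simp add: mult_le_0_iff)
  qed
  show "?x \<le> y" if "r * b \<le> slope_coeff * y\<^sup>2 + lin_coeff c b * y"
  proof -
    have "0 \<le> (y - ?x) * (slope_coeff * (y + ?x) + lin_coeff c b)" using that unfolding diff[symmetric] by simp
    then show ?thesis using pos by (simp add: zero_le_mult_iff)
  qed
qed

lemma root2_eqI:
  assumes "0 < b" "0 < y" "slope_coeff * y\<^sup>2 + lin_coeff c b * y = r * b"
  shows "root2 c b = y"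
  using root2_unique[OF assms(1,2), of c] assms(3) by simp

text \<open>The end \<open>b\<close> of the interval is fixed, as is the end \<open>R\<close> in
  \<open>root2_R\<close>; there the root is glued to the identity.\<close>

lemma root2_diag: "0 \<le> b \<Longrightarrow> root2 b b = b"
proof -
  assume b: "0 \<le> b"
  show ?thesis
  proof (cases "b = 0")
    case True
    then show ?thesis using r by (simp add: root2_def lin_coeff_def)
  next
    case False
    then show ?thesis
      using b R_pos by (intro root2_eqI) (auto simp: slope_coeff_def lin_coeff_def power2_eq_square field_simps)
  qed
qed

lemma root2_R: "0 < b \<Longrightarrow> root2 R b = R"
  using R_pos by (intro root2_eqI) (auto simp: slope_coeff_def lin_coeff_def power2_eq_square field_simps)

text \<open>At \<open>b\<close> and at \<open>c\<close> the quadratic minus \<open>r * b\<close>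
  takes the values \<open>b * (b - c)\<close> and \<open>r * (c - b) * (1 - c / R)\<close>, the
  first at most and the second at least 0, so the root lies between.\<close>

lemma root2_bounds:
  assumes "0 < b" "b \<le> c" "c \<le> R"
  shows "b \<le> root2 c b" "root2 c b \<le> c"
proof -
  have "slope_coeff * b\<^sup>2 + lin_coeff c b * b - r * b = b * (b - c)"
    using R_pos by (simp add: slope_coeff_def lin_coeff_def power2_eq_square field_simps)
  moreover have "b * (b - c) \<le> 0" using assms by (simp add: mult_le_0_iff)
  ultimately show "b \<le> root2 c b" using root2_unique(1)[OF assms(1,1)] by simp
  have "slope_coeff * c\<^sup>2 + lin_coeff c b * c - r * b = r * (c - b) * (1 - c / R)"
    using R_pos by (simp add: slope_coeff_def lin_coeff_def power2_eq_square field_simps)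
  moreover have "r * (c - b) * (1 - c / R) \<ge> 0" using assms r R_pos by simp
  ultimately show "root2 c b \<le> c" using root2_unique(2)[OF assms(1), of c c] assms by simp
qed

lemma shift_nonneg: "0 \<le> a \<Longrightarrow> 0 \<le> shift a b"
  using r by (simp add: shift_def)

lemma shift_eq_0: "a \<le> b \<or> R \<le> a \<Longrightarrow> shift a b = 0"
  using R_pos by (auto simp: shift_def max_def)

lemma shift_eq: "b \<le> a \<Longrightarrow> a \<le> R \<Longrightarrow> shift a b = r * ((a - b) / a) * (1 - a / R)"
  using R_pos by (auto simp: shift_def max_def)

text \<open>Multiplying by \<open>a\<close> clears the denominator of \<open>shift\<close>.\<close>

lemma shift_quadratic:
  assumes "0 < a" "b \<le> a" "a \<le> R"
  shows "a + shift a b = c \<longleftrightarrow> slope_coeff * a\<^sup>2 + lin_coeff c b * a = r * b"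
proof -
  have "a * (a + shift a b) - a * c = - (r * b - (slope_coeff * a\<^sup>2 + lin_coeff c b * a))"
    using assms R_pos by (simp add: shift_eq slope_coeff_def lin_coeff_def power2_eq_square field_simps)
  moreover have "a + shift a b = c \<longleftrightarrow> a * (a + shift a b) - a * c = 0" using assms(1) by simp
  ultimately show ?thesis by auto
qed

text \<open>For \<open>a \<le> R\<close> at most \<open>r * (1 - a / R)\<close> is added, and
  \<open>r < R\<close> makes this at most \<open>R - a\<close>. Hence the deformation does not leave
  a box of radius larger than \<open>R\<close>.\<close>

lemma shift_le:
  assumes "0 \<le> a" "0 \<le> b"
  shows "a + shift a b \<le> max a R"
proof (cases "a \<le> R \<and> b < a")
  case True
  then have "shift a b = r * ((a - b) / a) * (1 - a / R)" by (intro shift_eq) auto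
  also have "\<dots> \<le> r * 1 * (1 - a / R)"
    using True assms r R_pos by (intro mult_right_mono mult_left_mono) auto
  also have "\<dots> \<le> R * (1 - a / R)" using True rR R_pos by (simp add: mult_right_mono)
  also have "\<dots> = R - a" using R_pos by (simp add: field_simps)
  finally show ?thesis by simp
next
  case False
  then show ?thesis using shift_eq_0[of a b] by auto
qed

lemma unshift_id: "0 < b \<Longrightarrow> u \<le> b \<or> R \<le> u \<Longrightarrow> unshift u b = u"
  using root2_diag[of b] root2_R[of b] by (auto simp: unshift_def clip_def max_def min_def)

lemma unshift_eq: "b \<le> u \<Longrightarrow> u \<le> R \<Longrightarrow> unshift u b = root2 u b"
  by (simp add: unshift_def clip_def max_def min_def)

text \<open>Only the larger modulus changes, and it remains the larger one, so the inverse finds the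
  smaller one unchanged as its parameter.\<close>

lemma unshift_shift:
  assumes "0 < a" "0 < b"
  shows "unshift (a + shift a b) (b + shift b a) = a"
proof (cases "b \<le> a \<and> a \<le> R")
  case True
  let ?u = "a + shift a b"
  have u: "b \<le> ?u" "?u \<le> R" using True shift_nonneg[of a b] shift_le[of a b] assms by auto
  have "unshift ?u b = root2 ?u b" using u by (rule unshift_eq)
  also have "\<dots> = a" using shift_quadratic[of a b ?u] True assms by (intro root2_eqI) auto
  finally show ?thesis using True by (simp add: shift_eq_0)
next
  case False
  then have "shift a b = 0" by (intro shift_eq_0) auto
  moreover have "0 < b + shift b a" "b \<le> b + shift b a" using shift_nonneg[of b a] assms by auto
  ultimately show ?thesis using False by (auto intro!: unshift_id)
qed

lemma shift_unshift:
  assumes "0 < u" "0 < v"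
  shows "0 < unshift u v" "unshift u v + shift (unshift u v) (unshift v u) = u" "unshift u v \<le> u"
proof -
  have "0 < unshift u v \<and> unshift u v + shift (unshift u v) (unshift v u) = u \<and> unshift u v \<le> u"
  proof (cases "v \<le> u \<and> u \<le> R")
    case True
    have v: "unshift v u = v" using True assms by (intro unshift_id) auto
    have x: "unshift u v = root2 u v" using True by (intro unshift_eq) auto
    have b: "v \<le> root2 u v" "root2 u v \<le> u" using root2_bounds[of v u] True assms by auto
    have "root2 u v + shift (root2 u v) v = u"
      using shift_quadratic[of "root2 u v" v u] root2_eq(1)[of v u] root2_pos[of v u] b True assms by auto
    then show ?thesis using b root2_pos[of v u] assms unfolding x v by simp
  next
    case False
    have u: "unshift u v = u" using False assms by (intro unshift_id) auto
    have "shift u (unshift v u) = 0"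
    proof (cases "u \<le> v \<and> v \<le> R")
      case True
      then have "unshift v u = root2 v u" by (intro unshift_eq) auto
      then show ?thesis using root2_bounds(1)[of u v] True assms by (intro shift_eq_0) auto
    next
      case F: False
      then have "unshift v u = v" using assms by (intro unshift_id) auto
      then show ?thesis using False by (intro shift_eq_0) auto
    qed
    then show ?thesis using u assms by simp
  qed
  then show "0 < unshift u v" "unshift u v + shift (unshift u v) (unshift v u) = u" "unshift u v \<le> u" by auto
qed

section \<open>Continuity of the inverse, the axes, and the slope at the corner\<close>

lemma tendsto_root2_clip:
  assumes "(f \<longlongrightarrow> u) F" "(g \<longlongrightarrow> b) F"
  shows "((\<lambda>x. clip (f x) (g x)) \<longlongrightarrow> clip u b) F"
    and "((\<lambda>x. root2 (clip (f x) (g x)) (g x)) \<longlongrightarrow> root2 (clip u b) b) F"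
    and "((\<lambda>x. lin_coeff (clip (f x) (g x)) (g x)) \<longlongrightarrow> lin_coeff (clip u b) b) F"
proof -
  show c: "((\<lambda>x. clip (f x) (g x)) \<longlongrightarrow> clip u b) F"
    unfolding clip_def by (intro tendsto_max tendsto_min tendsto_const assms)
  show l: "((\<lambda>x. lin_coeff (clip (f x) (g x)) (g x)) \<longlongrightarrow> lin_coeff (clip u b) b) F"
    unfolding lin_coeff_def using R_pos by (intro tendsto_intros c assms) auto
  show "((\<lambda>x. root2 (clip (f x) (g x)) (g x)) \<longlongrightarrow> root2 (clip u b) b) F"
    unfolding root2_def using slope_coeff_pos by (intro tendsto_intros l assms) auto
qed

lemma tendsto_unshift:
  assumes "(f \<longlongrightarrow> u) F" "(g \<longlongrightarrow> b) F"
  shows "((\<lambda>x. unshift (f x) (g x)) \<longlongrightarrow> unshift u b) F"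
  unfolding unshift_def by (intro tendsto_intros tendsto_root2_clip assms)

lemma tendsto_ratio:
  assumes "(f \<longlongrightarrow> u) F" "(g \<longlongrightarrow> b) F"
  shows "((\<lambda>x. ratio (f x) (g x)) \<longlongrightarrow> ratio u b) F"
  unfolding ratio_def using r by (intro tendsto_intros tendsto_root2_clip assms) auto

text \<open>For \<open>b = 0\<close> the quadratic splits into the roots 0 and
  \<open>(c - r) / slope_coeff\<close>, and the larger one is taken: the segment from 0 to
  \<open>r\<close> collapses to the corner.\<close>

lemma root2_0: "root2 c 0 = max 0 ((c - r) / slope_coeff)"
  using slope_coeff_pos by (auto simp: root2_def lin_coeff_def max_def field_simps abs_if)

lemma unshift_0:
  assumes "0 \<le> u"
  shows "u \<le> r \<Longrightarrow> unshift u 0 = 0" "r < u \<Longrightarrow> 0 < unshift u 0"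
proof -
  have c: "clip u 0 = min u R" using assms R_pos by (simp add: clip_def)
  show "unshift u 0 = 0" if "u \<le> r"
    using that rR slope_coeff_pos by (simp add: unshift_def c root2_0 min_def max_def field_simps)
  show "0 < unshift u 0" if "r < u"
  proof (cases "u \<le> R")
    case True
    then show ?thesis using that slope_coeff_pos by (simp add: unshift_def c root2_0 min_def less_max_iff_disj)
  next
    case False
    have "(R - r) / slope_coeff = R" using R_pos slope_coeff_pos by (simp add: slope_coeff_def field_simps)
    then show ?thesis using False R_pos by (simp add: unshift_def c root2_0 min_def)
  qed
qed

lemma unshift_zero_fst: "0 \<le> b \<Longrightarrow> unshift 0 b = 0"
  using unshift_id[of b 0] unshift_0(1)[of 0] r by (cases "b = 0") auto

text \<open>Singles out the boundary points of \<open>Z\<close> that come from the exceptional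
  curve, since there the inverse has to be lifted by its slope.\<close>

lemma unshift_zeroD:
  assumes "0 \<le> u" "0 \<le> v" "unshift u v = 0" "unshift v u = 0"
  shows "(v = 0 \<and> u \<le> r) \<or> (u = 0 \<and> v \<le> r)"
proof -
  have "u = 0 \<or> v = 0" using shift_unshift(1)[of u v] assms by force
  then show ?thesis using unshift_0(2)[of u] unshift_0(2)[of v] assms by force
qed

lemma root2_mult_ratio: "0 \<le> b \<Longrightarrow> root2 (clip u b) b * ratio u b = b"
  using root2_eq(1)[of b "clip u b"] r by (simp add: ratio_def power2_eq_square field_simps)

lemma ratio_eq_1:
  assumes "0 \<le> u" "u \<le> b" "b \<le> R"
  shows "ratio u b = 1"
proof -
  have "clip u b = b" using assms by (simp add: clip_def max_def min_def)
  then show ?thesis using assms r R_pos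
    by (simp add: ratio_def root2_diag lin_coeff_def slope_coeff_def field_simps)
qed

lemma ratio_0:
  assumes "0 \<le> u" "u \<le> r"
  shows "ratio u 0 = (r - u) / r"
proof -
  have "clip u 0 = u" using assms R_pos rR by (simp add: clip_def max_def min_def)
  then show ?thesis using assms slope_coeff_pos
    by (simp add: ratio_def root2_0 lin_coeff_def max_def field_simps)
qed

text \<open>The ratio whose first argument is the smaller modulus is 1, and the other one accounts
  for the quotient by \<open>root2_mult_ratio\<close>. On the L-shaped set the left side degenerates
  to 0 over 0, while the right side is continuous there.\<close>

lemma unshift_divide:
  assumes "0 < u" "0 < v" "u \<le> R" "v \<le> R"
  shows "unshift v u / unshift u v = ratio u v / ratio v u"
proof -
  have *: "unshift v u / unshift u v = ratio u v \<and> ratio v u = 1" if "0 < v" "v \<le> u" "u \<le> R" for u v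
  proof -
    have "clip u v = u" using that by (simp add: clip_def max_def min_def)
    then have "root2 u v * ratio u v = v" using root2_mult_ratio[of v u] that by simp
    moreover have "unshift u v = root2 u v" using that by (intro unshift_eq) auto
    moreover have "unshift v u = v" using that by (intro unshift_id) auto
    ultimately show ?thesis using root2_pos[of v u] ratio_eq_1[of v u] that by (simp add: field_simps)
  qed
  show ?thesis
  proof (cases "v \<le> u")
    case True
    then show ?thesis using *[of v u] assms by simp
  next
    case False
    then have "unshift u v / unshift v u = ratio v u \<and> ratio u v = 1" using *[of u v] assms by simp
    then show ?thesis by (metis inverse_eq_divide inverse_divide)
  qed
qed

lemma tendsto_shift:
  assumes "(f \<longlongrightarrow> a) F" "(g \<longlongrightarrow> b) F" "0 < max a b"
  shows "((\<lambda>x. shift (f x) (g x)) \<longlongrightarrow> shift a b) F"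
  unfolding shift_def using assms(3) R_pos by (intro tendsto_intros tendsto_max assms) auto

text \<open>The limit of the shift of |w1| as w1 tends to 0 with the modulus of w2/w1 tending to
  \<open>s\<close>; \<open>edge'\<close> is the same for |w2|. Together they parametrise the
  L-shaped set.\<close>

definition edge :: "real \<Rightarrow> real" where "edge s = r * (max 0 (1 - s) / max 1 s)"

text \<open>Up to the cut-off \<open>shift\<close> is homogeneous of degree 0, so
  \<open>\<rho>\<close> enters through the cut-off only. A limit for \<rho> tending to 0 thus exists
  along each slope, although \<open>shift\<close> has none at the origin.\<close>

lemma shift_slope: "0 < \<rho> \<Longrightarrow> 0 \<le> s \<Longrightarrow> shift \<rho> (\<rho> * s) = edge s * max 0 (1 - \<rho> / R)"
proof -
  assume \<rho>: "0 < \<rho>" and s: "0 \<le> s"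
  have "max 0 (\<rho> - \<rho> * s) = \<rho> * max 0 (1 - s)" using \<rho> by (simp add: max_def algebra_simps)
  moreover have "max \<rho> (\<rho> * s) = \<rho> * max 1 s" using \<rho> by (simp add: max_def)
  ultimately show ?thesis using \<rho> by (simp add: shift_def edge_def)
qed

definition edge' :: "real \<Rightarrow> real" where "edge' s = r * (max 0 (s - 1) / max 1 s)"

lemma shift_slope': "0 < \<rho> \<Longrightarrow> 0 \<le> s \<Longrightarrow> shift (\<rho> * s) \<rho> = edge' s * max 0 (1 - \<rho> * s / R)"
proof -
  assume \<rho>: "0 < \<rho>" and s: "0 \<le> s"
  have "max 0 (\<rho> * s - \<rho>) = \<rho> * max 0 (s - 1)" using \<rho> by (simp add: max_def algebra_simps)
  moreover have "max (\<rho> * s) \<rho> = \<rho> * max 1 s" using \<rho> by (simp add: max_def)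
  ultimately show ?thesis using \<rho> by (simp add: shift_def edge'_def)
qed

lemma tendsto_edge:
  assumes "(f \<longlongrightarrow> s) F"
  shows "((\<lambda>x. edge (f x)) \<longlongrightarrow> edge s) F" "((\<lambda>x. edge' (f x)) \<longlongrightarrow> edge' s) F"
  unfolding edge_def edge'_def by (intro tendsto_intros tendsto_max assms; auto simp: max_def)+

text \<open>The bounds are not symmetric because \<open>s\<close> is finite: slope 0 reaches the end
  \<open>r\<close> of the first arm, whereas the end of the second arm belongs to infinite slope,
  which is seen in the swapped chart.\<close>

lemma edge_props:
  assumes "0 \<le> s"
  shows "0 \<le> edge s" "edge s \<le> r" "0 \<le> edge' s" "edge' s < r" "edge s = 0 \<or> edge' s = 0"
    "edge s = r \<longleftrightarrow> s = 0"
proof -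
  show "0 \<le> edge s" "0 \<le> edge' s" using r by (simp_all add: edge_def edge'_def)
  show "edge s = 0 \<or> edge' s = 0" by (simp add: edge_def edge'_def max_def)
  show "edge s \<le> r" using r assms by (simp add: edge_def max_def)
  show "edge s = r \<longleftrightarrow> s = 0" using r assms by (auto simp: edge_def max_def)
  have "max 0 (s - 1) / max 1 s < 1" using assms by (auto simp: max_def)
  then have "r * (max 0 (s - 1) / max 1 s) < r * 1" using r by (intro mult_strict_left_mono)
  then show "edge' s < r" unfolding edge'_def by (simp only: mult_1_right)
qed

end

section \<open>The deformation of C^2 off the axes\<close>

context radial
begin

definition radial_map :: "complex \<times> complex \<Rightarrow> complex \<times> complex"
  where "radial_map p = (of_real (norm (fst p) + shift (norm (fst p)) (norm (snd p))) * sgn (fst p),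
    of_real (norm (snd p) + shift (norm (snd p)) (norm (fst p))) * sgn (snd p))"

definition radial_inv :: "complex \<times> complex \<Rightarrow> complex \<times> complex"
  where "radial_inv p = (of_real (unshift (norm (fst p)) (norm (snd p))) * sgn (fst p),
    of_real (unshift (norm (snd p)) (norm (fst p))) * sgn (snd p))"

lemma norm_sgn_mult: "a \<noteq> 0 \<Longrightarrow> 0 < x \<Longrightarrow> norm (of_real x * sgn a) = x" for a :: complex
  by (simp add: norm_mult norm_sgn)

lemma sgn_sgn_mult: "a \<noteq> 0 \<Longrightarrow> 0 < x \<Longrightarrow> sgn (of_real x * sgn a) = sgn a" for a :: complex
  by (simp add: sgn_mult sgn_of_real)

lemma norm_mult_sgn: "of_real (norm a) * sgn a = a" for a :: complex
  by (simp add: sgn_eq)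

lemma radial_map_props:
  assumes "a \<noteq> 0" "b \<noteq> 0"
  shows "fst (radial_map (a, b)) \<noteq> 0" "snd (radial_map (a, b)) \<noteq> 0"
    "norm (fst (radial_map (a, b))) = norm a + shift (norm a) (norm b)"
    "norm (snd (radial_map (a, b))) = norm b + shift (norm b) (norm a)"
    "sgn (fst (radial_map (a, b))) = sgn a" "sgn (snd (radial_map (a, b))) = sgn b"
    "radial_inv (radial_map (a, b)) = (a, b)"
proof -
  have pos: "0 < norm a + shift (norm a) (norm b)" "0 < norm b + shift (norm b) (norm a)"
    using shift_nonneg[of "norm a" "norm b"] shift_nonneg[of "norm b" "norm a"] assms by (simp_all add: add_pos_nonneg)
  show n: "norm (fst (radial_map (a, b))) = norm a + shift (norm a) (norm b)"
    "norm (snd (radial_map (a, b))) = norm b + shift (norm b) (norm a)"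
    unfolding radial_map_def fst_conv snd_conv using norm_sgn_mult assms pos by blast+
  show s: "sgn (fst (radial_map (a, b))) = sgn a" "sgn (snd (radial_map (a, b))) = sgn b"
    unfolding radial_map_def fst_conv snd_conv using sgn_sgn_mult assms pos by blast+
  show "fst (radial_map (a, b)) \<noteq> 0" "snd (radial_map (a, b)) \<noteq> 0" using n pos by force+
  show "radial_inv (radial_map (a, b)) = (a, b)"
    unfolding radial_inv_def n s using unshift_shift[of "norm a" "norm b"] unshift_shift[of "norm b" "norm a"] assms
    by (simp add: norm_mult_sgn)
qed

lemma radial_inv_props:
  assumes "a \<noteq> 0" "b \<noteq> 0"
  shows "fst (radial_inv (a, b)) \<noteq> 0" "snd (radial_inv (a, b)) \<noteq> 0"
    "norm (fst (radial_inv (a, b))) = unshift (norm a) (norm b)"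
    "norm (snd (radial_inv (a, b))) = unshift (norm b) (norm a)"
    "sgn (fst (radial_inv (a, b))) = sgn a" "sgn (snd (radial_inv (a, b))) = sgn b"
    "radial_map (radial_inv (a, b)) = (a, b)"
proof -
  have pos: "0 < unshift (norm a) (norm b)" "0 < unshift (norm b) (norm a)"
    using shift_unshift(1) assms by auto
  show n: "norm (fst (radial_inv (a, b))) = unshift (norm a) (norm b)"
    "norm (snd (radial_inv (a, b))) = unshift (norm b) (norm a)"
    unfolding radial_inv_def fst_conv snd_conv using norm_sgn_mult assms pos by blast+
  show s: "sgn (fst (radial_inv (a, b))) = sgn a" "sgn (snd (radial_inv (a, b))) = sgn b"
    unfolding radial_inv_def fst_conv snd_conv using sgn_sgn_mult assms pos by blast+
  show "fst (radial_inv (a, b)) \<noteq> 0" "snd (radial_inv (a, b)) \<noteq> 0" using n pos by force+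
  show "radial_map (radial_inv (a, b)) = (a, b)"
    unfolding radial_map_def n s using shift_unshift(2)[of "norm a" "norm b"] shift_unshift(2)[of "norm b" "norm a"] assms
    by (simp add: norm_mult_sgn)
qed

lemma radial_id:
  assumes "a \<noteq> 0" "b \<noteq> 0" "R \<le> norm a \<or> R \<le> norm b"
  shows "radial_map (a, b) = (a, b)" "radial_inv (a, b) = (a, b)"
proof -
  have "shift (norm a) (norm b) = 0" "shift (norm b) (norm a) = 0"
    using assms(3) by (auto intro!: shift_eq_0)
  then show "radial_map (a, b) = (a, b)" unfolding radial_map_def by (simp add: norm_mult_sgn)
  have "unshift (norm a) (norm b) = norm a" "unshift (norm b) (norm a) = norm b"
    using assms by (auto intro!: unshift_id)
  then show "radial_inv (a, b) = (a, b)" unfolding radial_inv_def by (simp add: norm_mult_sgn)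
qed

definition kap :: "'a chart \<Rightarrow> 'a \<Rightarrow> 'a"
  where "kap c x = (if x \<in> fst c then inv_into (fst c) (snd c) (radial_map (snd c x)) else x)"

definition kap_inv :: "'a chart \<Rightarrow> 'a \<Rightarrow> 'a"
  where "kap_inv c x = (if x \<in> fst c then inv_into (fst c) (snd c) (radial_inv (snd c x)) else x)"

lemma inv_into_swap: "inv_into U (\<lambda>x. prod.swap (f x)) (prod.swap q) = inv_into U f q"
  unfolding inv_into_def by (metis swap_swap)

text \<open>The deformation treats both coordinates alike, so statements about one axis pass to the
  other by swapping the chart.\<close>

lemma kap_swap:
  fixes c :: "'a chart"
  shows "kap (fst c, \<lambda>x. prod.swap (snd c x)) = kap c" "kap_inv (fst c, \<lambda>x. prod.swap (snd c x)) = kap_inv c"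
proof -
  have "radial_map (prod.swap q) = prod.swap (radial_map q)" "radial_inv (prod.swap q) = prod.swap (radial_inv q)" for q
    by (simp_all add: radial_map_def radial_inv_def)
  then show "kap (fst c, \<lambda>x. prod.swap (snd c x)) = kap c" "kap_inv (fst c, \<lambda>x. prod.swap (snd c x)) = kap_inv c"
    unfolding kap_def kap_inv_def by (simp_all add: inv_into_swap fun_eq_iff)
qed

end

section \<open>The deformation on the surface and on trace filters\<close>

locale box_chart = cx_surface X A + radial r R
  for X :: "'a topology" and A and r R :: real +
  fixes D :: "'a set" and c :: "'a chart" and R0 :: real
  assumes adapted: "adapted_chart X A D c Crossing"
    and image: "snd c ` fst c = ball 0 R0 \<times> ball 0 R0" and R_less: "R < R0"
begin

lemma chc: "chart_of X c" and hc: "hol_chart X A c"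
  using adapted_hol[OF adapted] hol_chart_chart_of by blast+

lemma box_swap: "box_chart X A r R D (fst c, \<lambda>x. prod.swap (snd c x)) R0"
proof -
  have "(\<lambda>x. prod.swap (snd c x)) ` fst c = prod.swap ` (snd c ` fst c)" by (simp add: image_image)
  also have "\<dots> = ball 0 R0 \<times> ball 0 R0" unfolding image by (auto simp: image_iff)
  finally show ?thesis
    using adapted_swap[OF adapted] R_less by (intro box_chart.intro cx_surface_axioms radial_axioms box_chart_axioms.intro) auto
qed

lemma shift_less: "0 \<le> x \<Longrightarrow> x < R0 \<Longrightarrow> 0 \<le> y \<Longrightarrow> x + shift x y < R0"
  using shift_le[of x y] R_less by (auto simp: max_def split: if_splits)

lemma not_in_D: "x \<in> fst c \<Longrightarrow> x \<notin> D \<longleftrightarrow> fst (snd c x) \<noteq> 0 \<and> snd (snd c x) \<noteq> 0"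
  using adapted_in_D_iff[OF adapted, of x] by (cases "snd c x") auto

lemma kap:
  assumes "x \<in> fst c" "x \<notin> D"
  shows "kap c x \<in> fst c" "snd c (kap c x) = radial_map (snd c x)" "kap c x \<notin> D" "kap_inv c (kap c x) = x"
proof -
  obtain a b where ab: "snd c x = (a, b)" by fastforce
  have nz: "a \<noteq> 0" "b \<noteq> 0" using not_in_D assms ab by auto
  have "(a, b) \<in> snd c ` fst c" using assms ab by (metis imageI)
  then have "norm a < R0" "norm b < R0" unfolding image by (auto simp: dist_norm)
  then have "radial_map (a, b) \<in> ball 0 R0 \<times> ball 0 R0"
    using radial_map_props(3,4)[OF nz] shift_less[of "norm a" "norm b"] shift_less[of "norm b" "norm a"]
    by (simp add: mem_Times_iff)
  then have im: "radial_map (snd c x) \<in> snd c ` fst c" unfolding image ab .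
  have k: "kap c x = inv_into (fst c) (snd c) (radial_map (snd c x))" using assms by (simp add: kap_def)
  show 1: "kap c x \<in> fst c" unfolding k by (rule inv_into_into[OF im])
  show 2: "snd c (kap c x) = radial_map (snd c x)" unfolding k by (rule f_inv_into_f[OF im])
  show "kap c x \<notin> D" unfolding not_in_D[OF 1] 2 ab using radial_map_props(1,2)[OF nz] by simp
  show "kap_inv c (kap c x) = x"
    unfolding kap_inv_def using 1 2 ab radial_map_props(7)[OF nz] chart_ofD(7)[OF chc assms(1)] by simp
qed

lemma kap_inv:
  assumes "x \<in> fst c" "x \<notin> D"
  shows "kap_inv c x \<in> fst c" "snd c (kap_inv c x) = radial_inv (snd c x)" "kap_inv c x \<notin> D" "kap c (kap_inv c x) = x"
proof -
  obtain a b where ab: "snd c x = (a, b)" by fastforce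
  have nz: "a \<noteq> 0" "b \<noteq> 0" using not_in_D assms ab by auto
  have "(a, b) \<in> snd c ` fst c" using assms ab by (metis imageI)
  then have "norm a < R0" "norm b < R0" unfolding image by (auto simp: dist_norm)
  then have "radial_inv (a, b) \<in> ball 0 R0 \<times> ball 0 R0"
    using radial_inv_props(3,4)[OF nz] shift_unshift(3)[of "norm a" "norm b"] shift_unshift(3)[of "norm b" "norm a"] nz
    by (simp add: mem_Times_iff)
  then have im: "radial_inv (snd c x) \<in> snd c ` fst c" unfolding image ab .
  have k: "kap_inv c x = inv_into (fst c) (snd c) (radial_inv (snd c x))" using assms by (simp add: kap_inv_def)
  show 1: "kap_inv c x \<in> fst c" unfolding k by (rule inv_into_into[OF im])
  show 2: "snd c (kap_inv c x) = radial_inv (snd c x)" unfolding k by (rule f_inv_into_f[OF im])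
  show "kap_inv c x \<notin> D" unfolding not_in_D[OF 1] 2 ab using radial_inv_props(1,2)[OF nz] by simp
  show "kap c (kap_inv c x) = x"
    unfolding kap_def using 1 2 ab radial_inv_props(7)[OF nz] chart_ofD(7)[OF chc assms(1)] by simp
qed

lemma kap_outside:
  assumes "x \<notin> D" "x \<notin> {y \<in> fst c. snd c y \<in> cball 0 R \<times> cball 0 R}"
  shows "kap c x = x" "kap_inv c x = x"
proof -
  have "kap c x = x \<and> kap_inv c x = x"
  proof (cases "x \<in> fst c")
    case True
    obtain a b where ab: "snd c x = (a, b)" by fastforce
    have nz: "a \<noteq> 0" "b \<noteq> 0" using not_in_D True assms(1) ab by auto
    have "R \<le> norm a \<or> R \<le> norm b" using assms(2) True ab by auto
    from radial_id[OF nz this] show ?thesis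
      using True ab chart_ofD(7)[OF chc True] by (simp add: kap_def kap_inv_def)
  qed (simp add: kap_def kap_inv_def)
  then show "kap c x = x" "kap_inv c x = x" by auto
qed

lemma kap_not_D: "x \<notin> D \<Longrightarrow> kap c x \<notin> D" "x \<notin> D \<Longrightarrow> kap_inv c x \<notin> D"
  "x \<notin> D \<Longrightarrow> kap_inv c (kap c x) = x" "x \<notin> D \<Longrightarrow> kap c (kap_inv c x) = x"
  using kap[of x] kap_inv[of x] by (cases "x \<in> fst c"; simp add: kap_def kap_inv_def)+

lemma kap_topspace: "x \<in> topspace X \<Longrightarrow> x \<notin> D \<Longrightarrow> kap c x \<in> topspace X"
  "x \<in> topspace X \<Longrightarrow> x \<notin> D \<Longrightarrow> kap_inv c x \<in> topspace X"
  using kap(1)[of x] kap_inv(1)[of x] chart_ofD(6)[OF chc] by (cases "x \<in> fst c"; simp add: kap_def kap_inv_def)+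

lemma filtermap_eq_self:
  assumes "eventually (\<lambda>x. h x = x) F"
  shows "filtermap h F = F"
  using filtermap_inverse[of h "\<lambda>x. x" F] assms by (simp add: filtermap_ident)

text \<open>The closed box of radius \<open>R\<close> is compact in the chart image and hence closed
  in \<open>X\<close>; its complement is a neighbourhood of the foot on which both maps are the
  identity off \<open>D\<close>.\<close>

lemma filtermap_kap_outside:
  assumes F: "F \<in> prime_ends X A D" and out: "foot X F \<notin> fst c"
  shows "filtermap (kap c) F = F" "filtermap (kap_inv c) F = F"
proof -
  note b = prime_ends_basic[OF F]
  let ?K = "{y \<in> fst c. snd c y \<in> cball 0 R \<times> cball 0 R}"
  have "cball 0 R \<times> cball 0 R \<subseteq> snd c ` fst c" unfolding image using R_less by auto
  then have "closedin X ?K" by (intro chart_compact_closedin[OF chc] compact_Times compact_cball)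
  then have "openin X (topspace X - ?K)" by (simp add: openin_diff)
  then have "eventually (\<lambda>x. x \<in> topspace X - ?K) F"
    using filter_leD[OF b(2) eventually_nhdsin_openin] b(3) out by blast
  with b(4) have ev: "eventually (\<lambda>x. x \<notin> D \<and> x \<notin> ?K) F" by eventually_elim simp
  have "eventually (\<lambda>x. kap c x = x) F" "eventually (\<lambda>x. kap_inv c x = x) F"
    using ev by (auto elim!: eventually_mono intro!: kap_outside)
  then show "filtermap (kap c) F = F" "filtermap (kap_inv c) F = F"
    by (simp_all only: filtermap_eq_self)
qed

text \<open>The relation between coordinates and angles is inherited from the limits by
  \<open>ang_tendsto\<close>, so only the position of the limit in the chart image is asked
  for.\<close>

lemma le_crossing_prime_end:
  assumes F: "F \<noteq> bot" "eventually (\<lambda>y. h y \<in> fst c \<and> h y \<notin> D) F"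
    and lim: "((\<lambda>y. snd c (h y)) \<longlongrightarrow> (a, b)) F" "(a, b) \<in> snd c ` fst c"
    and s: "((\<lambda>y. sgn (fst (snd c (h y)))) \<longlongrightarrow> s) F" and t: "((\<lambda>y. sgn (snd (snd c (h y)))) \<longlongrightarrow> t) F"
  shows "((a, b), (s, t)) \<in> polar_model D c Crossing"
    "filtermap h F \<le> prime_end D c Crossing ((a, b), (s, t))"
proof -
  have ne: "eventually (\<lambda>y. fst (snd c (h y)) \<noteq> 0) F" "eventually (\<lambda>y. snd (snd c (h y)) \<noteq> 0) F"
    using F(2) by (auto elim!: eventually_mono simp: not_in_D)
  have "ang True a s" "ang True b t"
    using ang_tendsto[OF F(1) _ s ne(1)] ang_tendsto[OF F(1) _ t ne(2)]
      tendsto_fst[OF lim(1)] tendsto_snd[OF lim(1)] by simp_all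
  then show "((a, b), (s, t)) \<in> polar_model D c Crossing"
    unfolding polar_model_iff[OF adapted] using lim(2) by simp
  show "filtermap h F \<le> prime_end D c Crossing ((a, b), (s, t))"
    unfolding le_prime_end_iff filterlim_filtermap eventually_filtermap polar_eq
    using lim(1) s t F(2) by (auto intro!: tendsto_Pair elim: eventually_mono)
qed

lemma model_facts:
  assumes "((a, b), (s, t)) \<in> polar_model D c Crossing"
  shows "norm s = 1" "norm t = 1" "a = of_real (norm a) * s" "b = of_real (norm b) * t" "norm a < R0" "norm b < R0"
  using assms unfolding polar_model_iff[OF adapted] image
  by (auto dest: ang_True_norm ang_True_eq)

lemma modelI:
  assumes "norm s = 1" "norm t = 1" "0 \<le> x" "x < R0" "0 \<le> y" "y < R0"
  shows "((of_real x * s, of_real y * t), (s, t)) \<in> polar_model D c Crossing"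
  unfolding polar_model_iff[OF adapted] image using assms by (simp add: ang_def norm_mult)

text \<open>\<open>shift\<close> is continuous away from the origin, and the angles do not change.
  At the corner \<open>a = b = 0\<close>, excluded by \<open>nz\<close>, the limit depends on the
  slope, which is what the exceptional curve records.\<close>

lemma kap_prime_end:
  assumes m: "((a, b), (s, t)) \<in> polar_model D c Crossing" and nz: "a \<noteq> 0 \<or> b \<noteq> 0"
  defines "m' \<equiv> ((of_real (norm a + shift (norm a) (norm b)) * s, of_real (norm b + shift (norm b) (norm a)) * t), (s, t))"
  shows "m' \<in> polar_model D c Crossing" "filtermap (kap c) (prime_end D c Crossing ((a, b), (s, t))) \<le> prime_end D c Crossing m'"
proof -
  let ?F = "prime_end D c Crossing ((a, b), (s, t))"
  note mf = model_facts[OF m]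
  note lim = prime_end_tendsto_components[where F = ?F, OF order_refl, simplified]
  have ev: "eventually (\<lambda>y. y \<in> fst c \<and> y \<notin> D) ?F"
    using prime_end_eventually[of c D Crossing] by simp
  have n: "((\<lambda>y. norm (fst (snd c y))) \<longlongrightarrow> norm a) ?F" "((\<lambda>y. norm (snd (snd c y))) \<longlongrightarrow> norm b) ?F"
    using tendsto_norm[OF tendsto_fst[OF lim(1)]] tendsto_norm[OF tendsto_snd[OF lim(1)]] by simp_all
  have mx: "0 < max (norm a) (norm b)" "0 < max (norm b) (norm a)" using nz by (auto simp: less_max_iff_disj)
  have l: "((\<lambda>y. radial_map (snd c y)) \<longlongrightarrow> (of_real (norm a + shift (norm a) (norm b)) * s, of_real (norm b + shift (norm b) (norm a)) * t)) ?F"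
    unfolding radial_map_def
    by (intro tendsto_Pair tendsto_mult tendsto_of_real tendsto_add tendsto_shift n mx lim(2,3))
  have "(of_real (norm a + shift (norm a) (norm b)) * s, of_real (norm b + shift (norm b) (norm a)) * t) \<in> snd c ` fst c"
    unfolding image using shift_less[of "norm a" "norm b"] shift_less[of "norm b" "norm a"] mf
      shift_nonneg[of "norm a" "norm b"] shift_nonneg[of "norm b" "norm a"]
    by (simp add: norm_mult del: of_real_add)
  moreover have "eventually (\<lambda>y. kap c y \<in> fst c \<and> kap c y \<notin> D) ?F"
    using ev by (rule eventually_mono) (simp add: kap)
  moreover have "((\<lambda>y. snd c (kap c y)) \<longlongrightarrow> (of_real (norm a + shift (norm a) (norm b)) * s, of_real (norm b + shift (norm b) (norm a)) * t)) ?F"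
    by (rule Lim_transform_eventually[OF l], rule eventually_mono[OF ev]) (simp add: kap)
  moreover have "((\<lambda>y. sgn (fst (snd c (kap c y)))) \<longlongrightarrow> s) ?F"
  proof (rule Lim_transform_eventually[OF lim(2)], rule eventually_mono[OF ev])
    fix y assume y: "y \<in> fst c \<and> y \<notin> D"
    then show "sgn (fst (snd c y)) = sgn (fst (snd c (kap c y)))"
      using radial_map_props(5)[of "fst (snd c y)" "snd (snd c y)"] not_in_D[of y] by (simp add: kap)
  qed
  moreover have "((\<lambda>y. sgn (snd (snd c (kap c y)))) \<longlongrightarrow> t) ?F"
  proof (rule Lim_transform_eventually[OF lim(3)], rule eventually_mono[OF ev])
    fix y assume y: "y \<in> fst c \<and> y \<notin> D"
    then show "sgn (snd (snd c y)) = sgn (snd (snd c (kap c y)))"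
      using radial_map_props(6)[of "fst (snd c y)" "snd (snd c y)"] not_in_D[of y] by (simp add: kap)
  qed
  ultimately show "m' \<in> polar_model D c Crossing" "filtermap (kap c) ?F \<le> prime_end D c Crossing m'"
    unfolding m'_def using le_crossing_prime_end[OF prime_end_not_bot[OF m]] by blast+
qed

text \<open>\<open>unshift\<close> is continuous at the corner too, so every boundary point is
  allowed. The limits are listed separately because the lift to the exceptional curve needs the
  functions themselves: a trace filter over the corner does not fix the slope.\<close>

lemma kap_inv_prime_end:
  assumes m: "((a, b), (s, t)) \<in> polar_model D c Crossing"
  defines "m' \<equiv> ((of_real (unshift (norm a) (norm b)) * s, of_real (unshift (norm b) (norm a)) * t), (s, t))"
  shows "m' \<in> polar_model D c Crossing" "filtermap (kap_inv c) (prime_end D c Crossing ((a, b), (s, t))) \<le> prime_end D c Crossing m'"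
    "((\<lambda>y. snd c (kap_inv c y)) \<longlongrightarrow> fst m') (prime_end D c Crossing ((a, b), (s, t)))"
    "((\<lambda>y. sgn (fst (snd c (kap_inv c y)))) \<longlongrightarrow> s) (prime_end D c Crossing ((a, b), (s, t)))"
    "((\<lambda>y. sgn (snd (snd c (kap_inv c y)))) \<longlongrightarrow> t) (prime_end D c Crossing ((a, b), (s, t)))"
proof -
  let ?F = "prime_end D c Crossing ((a, b), (s, t))"
  note mf = model_facts[OF m]
  note lim = prime_end_tendsto_components[where F = ?F, OF order_refl, simplified]
  have ev: "eventually (\<lambda>y. y \<in> fst c \<and> y \<notin> D) ?F"
    using prime_end_eventually[of c D Crossing] by simp
  have n: "((\<lambda>y. norm (fst (snd c y))) \<longlongrightarrow> norm a) ?F" "((\<lambda>y. norm (snd (snd c y))) \<longlongrightarrow> norm b) ?F"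
    using tendsto_norm[OF tendsto_fst[OF lim(1)]] tendsto_norm[OF tendsto_snd[OF lim(1)]] by simp_all
  have l: "((\<lambda>y. radial_inv (snd c y)) \<longlongrightarrow> fst m') ?F"
    unfolding radial_inv_def m'_def fst_conv
    by (intro tendsto_Pair tendsto_mult tendsto_of_real tendsto_unshift n lim(2,3))
  \<comment> \<open>\<open>shift_unshift\<close> concerns positive moduli; the axes, over which the
    boundary lies, are treated separately.\<close>
  have bound: "0 \<le> unshift x y \<and> unshift x y \<le> x" if xy: "0 \<le> x" "0 \<le> y" for x y
  proof -
    consider "x = 0" | "y = 0" "x \<le> r" | "y = 0" "r < x" | "0 < x" "0 < y" using xy by linarith
    then show ?thesis
    proof cases
      case 3
      have "x + root2 (clip x 0) 0 - clip x 0 \<le> x"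
        using xy 3 R_pos r rR slope_coeff_pos
        by (auto simp: clip_def root2_0 max_def min_def slope_coeff_def field_simps)
      then show ?thesis using unshift_0(2)[of x] 3 xy by (simp add: unshift_def)
    qed (use xy unshift_zero_fst unshift_0(1) shift_unshift(1,3) less_imp_le in \<open>auto intro: less_imp_le\<close>)
  qed
  have im: "fst m' \<in> snd c ` fst c"
    unfolding image m'_def using bound[of "norm a" "norm b"] bound[of "norm b" "norm a"] mf by (simp add: norm_mult)
  have e: "eventually (\<lambda>y. kap_inv c y \<in> fst c \<and> kap_inv c y \<notin> D) ?F"
    using ev by (rule eventually_mono) (simp add: kap_inv)
  show l': "((\<lambda>y. snd c (kap_inv c y)) \<longlongrightarrow> fst m') ?F"
    by (rule Lim_transform_eventually[OF l], rule eventually_mono[OF ev]) (simp add: kap_inv)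
  show s: "((\<lambda>y. sgn (fst (snd c (kap_inv c y)))) \<longlongrightarrow> s) ?F"
  proof (rule Lim_transform_eventually[OF lim(2)], rule eventually_mono[OF ev])
    fix y assume y: "y \<in> fst c \<and> y \<notin> D"
    then show "sgn (fst (snd c y)) = sgn (fst (snd c (kap_inv c y)))"
      using radial_inv_props(5)[of "fst (snd c y)" "snd (snd c y)"] not_in_D[of y] by (simp add: kap_inv)
  qed
  show t: "((\<lambda>y. sgn (snd (snd c (kap_inv c y)))) \<longlongrightarrow> t) ?F"
  proof (rule Lim_transform_eventually[OF lim(3)], rule eventually_mono[OF ev])
    fix y assume y: "y \<in> fst c \<and> y \<notin> D"
    then show "sgn (snd (snd c y)) = sgn (snd (snd c (kap_inv c y)))"
      using radial_inv_props(6)[of "fst (snd c y)" "snd (snd c y)"] not_in_D[of y] by (simp add: kap_inv)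
  qed
  show "m' \<in> polar_model D c Crossing" "filtermap (kap_inv c) ?F \<le> prime_end D c Crossing m'"
    using le_crossing_prime_end[OF prime_end_not_bot[OF m] e l'[unfolded m'_def fst_conv] im[unfolded m'_def fst_conv] s t]
    unfolding m'_def by auto
qed

text \<open>In a fixed chart the trace filter determines its polar coordinates, so the definite
  description is unambiguous. The rotated point is in the model because rotations preserve the
  box.\<close>

lemma crossing_rotation_eq:
  assumes m: "((a, b), (s, t)) \<in> polar_model D c Crossing"
  shows "((cis \<Theta> * a, cis \<Theta> * b), (cis \<Theta> * s, cis \<Theta> * t)) \<in> polar_model D c Crossing"
    "crossing_rotation D c \<Theta> (prime_end D c Crossing ((a, b), (s, t))) =
      prime_end D c Crossing ((cis \<Theta> * a, cis \<Theta> * b), (cis \<Theta> * s, cis \<Theta> * t))"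
proof -
  note mf = model_facts[OF m]
  have "norm (cis \<Theta> * s) = 1" "norm (cis \<Theta> * t) = 1" using mf by (simp_all add: norm_mult)
  from modelI[OF this, of "norm a" "norm b"] mf
  have "((of_real (norm a) * (cis \<Theta> * s), of_real (norm b) * (cis \<Theta> * t)), (cis \<Theta> * s, cis \<Theta> * t)) \<in> polar_model D c Crossing"
    by simp
  moreover have "of_real (norm a) * (cis \<Theta> * s) = cis \<Theta> * a" "of_real (norm b) * (cis \<Theta> * t) = cis \<Theta> * b"
    using mf(3,4) by (metis mult.left_commute)+
  ultimately show "((cis \<Theta> * a, cis \<Theta> * b), (cis \<Theta> * s, cis \<Theta> * t)) \<in> polar_model D c Crossing" by simp
  show "crossing_rotation D c \<Theta> (prime_end D c Crossing ((a, b), (s, t))) =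
      prime_end D c Crossing ((cis \<Theta> * a, cis \<Theta> * b), (cis \<Theta> * s, cis \<Theta> * t))"
    unfolding crossing_rotation_def
  proof (rule the_equality)
    show "\<exists>w1 w2 s1 s2. ((w1, w2), s1, s2) \<in> polar_model D c Crossing \<and>
       prime_end D c Crossing ((a, b), s, t) = prime_end D c Crossing ((w1, w2), s1, s2) \<and>
       prime_end D c Crossing ((cis \<Theta> * a, cis \<Theta> * b), cis \<Theta> * s, cis \<Theta> * t) =
       prime_end D c Crossing ((cis \<Theta> * w1, cis \<Theta> * w2), cis \<Theta> * s1, cis \<Theta> * s2)"
      using m by blast
    fix G assume "\<exists>w1 w2 s1 s2. ((w1, w2), s1, s2) \<in> polar_model D c Crossing \<and>
       prime_end D c Crossing ((a, b), s, t) = prime_end D c Crossing ((w1, w2), s1, s2) \<and>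
       G = prime_end D c Crossing ((cis \<Theta> * w1, cis \<Theta> * w2), cis \<Theta> * s1, cis \<Theta> * s2)"
    then obtain w1 w2 s1 s2 where w: "((w1, w2), s1, s2) \<in> polar_model D c Crossing"
      "prime_end D c Crossing ((a, b), s, t) = prime_end D c Crossing ((w1, w2), s1, s2)"
      "G = prime_end D c Crossing ((cis \<Theta> * w1, cis \<Theta> * w2), cis \<Theta> * s1, cis \<Theta> * s2)"
      by blast
    have "((a, b), s, t) = ((w1, w2), s1, s2)"
      by (rule prime_end_unique[OF prime_end_not_bot[OF m] order_refl]) (simp add: w(2))
    then show "G = prime_end D c Crossing ((cis \<Theta> * a, cis \<Theta> * b), cis \<Theta> * s, cis \<Theta> * t)"
      using w(3) by simp
  qed
qed

end

section \<open>The homeomorphism of the real blow-ups\<close>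

context blown_up
begin

abbreviation "\<pi>_inv \<equiv> inv_into off_E \<pi>"

lemma push: "bih_surfaces X' A' X A off_E (topspace X - {z}) \<pi> \<pi>_inv"
  by (intro bih_surfaces.intro bih_surfaces_axioms.intro X.cx_surface_axioms X'.cx_surface_axioms bih_off_E)

lemma pull: "bih_surfaces X A X' A' (topspace X - {z}) off_E \<pi>_inv \<pi>"
  by (intro bih_surfaces.intro bih_surfaces_axioms.intro X.cx_surface_axioms X'.cx_surface_axioms bih_sym[OF bih_off_E])

lemmas off_maps = bih_maps[OF bih_off_E]

end

section \<open>The map of the complements and its inverse\<close>

locale blown_up_box = blown_up X A z X' A' \<pi> + box_chart X A r R D c R0
  for X :: "'a topology" and A z and X' :: "'b topology" and A' \<pi> r R D c R0 +
  fixes D' :: "'b set"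
  assumes z: "z \<in> fst c" "snd c z = (0, 0)"
    and D': "D' = {y \<in> topspace X'. \<pi> y \<in> D}"
begin

text \<open>Every statement about slope charts of w2/w1 becomes one about w1/w2 through this
  instance; by \<open>\<eta>_swapped\<close> it concerns the same maps.\<close>

lemma swapped: "blown_up_box X A z X' A' \<pi> r R D (fst c, \<lambda>x. prod.swap (snd c x)) R0 D'"
  using z D' by (intro blown_up_box.intro blown_up_box_axioms.intro blown_up_axioms box_swap) auto

definition \<eta> :: "'b \<Rightarrow> 'a" where "\<eta> y = kap c (\<pi> y)"
definition \<eta>_inv :: "'a \<Rightarrow> 'b" where "\<eta>_inv x = \<pi>_inv (kap_inv c x)"

lemma \<eta>_swapped:
  "blown_up_box.\<eta> \<pi> r R (fst c, \<lambda>x. prod.swap (snd c x)) = \<eta>"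
  "blown_up_box.\<eta>_inv z X' \<pi> r R (fst c, \<lambda>x. prod.swap (snd c x)) = \<eta>_inv"
  unfolding blown_up_box.\<eta>_def[OF swapped, abs_def] blown_up_box.\<eta>_inv_def[OF swapped, abs_def]
    \<eta>_def[abs_def] \<eta>_inv_def[abs_def] kap_swap by (rule refl)+

lemma z_in_D: "z \<in> D"
  using X.adapted_in_D_iff[OF adapted z(1)] z(2) by simp

lemma in_D'_iff: "y \<in> topspace X' \<Longrightarrow> y \<in> D' \<longleftrightarrow> \<pi> y \<in> D"
  using D' by simp

lemma off_topspace: "y \<in> off_E \<Longrightarrow> y \<in> topspace X'"
  by (simp add: off_E_def)

lemma DE: "y \<in> off_E \<Longrightarrow> y \<in> D' \<longleftrightarrow> \<pi> y \<in> D"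
  using in_D'_iff off_topspace by blast

lemma ED: "x \<in> topspace X - {z} \<Longrightarrow> x \<in> D \<longleftrightarrow> \<pi>_inv x \<in> D'"
  using DE[of "\<pi>_inv x"] off_maps(2,4)[of x] by simp

lemma \<eta>_inverse:
  assumes "y \<in> topspace X' - D'"
  shows "\<eta>_inv (\<eta> y) = y"
proof -
  have "\<pi> y \<notin> D" using assms in_D'_iff by blast
  moreover from this have "y \<in> off_E" using assms z_in_D by (auto simp: off_E_def)
  ultimately show ?thesis unfolding \<eta>_def \<eta>_inv_def using kap_not_D(3) off_maps(3) by simp
qed

lemma \<eta>_inverse':
  assumes "x \<in> topspace X - D"
  shows "\<eta> (\<eta>_inv x) = x"
proof -
  have "kap_inv c x \<in> topspace X - {z}" using kap_topspace(2)[of x] kap_not_D(2)[of x] assms z_in_D by auto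
  then show ?thesis unfolding \<eta>_def \<eta>_inv_def using kap_not_D(4)[of x] off_maps(4) assms by simp
qed

lemma prime_ends_off:
  assumes "F \<in> prime_ends X' A' D'" "foot X' F \<in> off_E"
  shows "filtermap \<pi> F \<in> prime_ends X A D" "foot X (filtermap \<pi> F) = \<pi> (foot X' F)"
  using bih_surfaces.push_prime_ends[OF push DE assms] by auto

lemma prime_ends_pull:
  assumes "G \<in> prime_ends X A D" "foot X G \<noteq> z"
  shows "filtermap \<pi>_inv G \<in> prime_ends X' A' D'"
proof -
  have "foot X G \<in> topspace X - {z}" using X.prime_ends_basic(3)[OF assms(1)] assms(2) by simp
  then show ?thesis using bih_surfaces.push_prime_ends(1)[OF pull ED assms(1)] by blast
qed

lemma filtermap_\<eta>: "filtermap \<eta> F = filtermap (kap c) (filtermap \<pi> F)"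
  unfolding filtermap_filtermap \<eta>_def[abs_def] by (rule refl)

lemma filtermap_\<eta>_inv: "filtermap \<eta>_inv G = filtermap \<pi>_inv (filtermap (kap_inv c) G)"
  unfolding filtermap_filtermap \<eta>_inv_def[abs_def] by (rule refl)

lemma foot_crossing:
  assumes "((a, b), (s, t)) \<in> polar_model D c Crossing"
  shows "foot X (prime_end D c Crossing ((a, b), (s, t))) \<in> fst c"
    "snd c (foot X (prime_end D c Crossing ((a, b), (s, t)))) = (a, b)"
  using X.model_foot[OF adapted assms] by auto

lemma slope_adapted:
  assumes "slope_chart c d"
  shows "adapted_chart X' A' D' d Crossing"
proof -
  have d: "hol_chart X' A' d" "\<forall>y\<in>fst d. \<pi> y \<in> fst c \<and> snd c (\<pi> y) = (fst (snd d y), fst (snd d y) * snd (snd d y))"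
    using assms unfolding slope_chart_def by auto
  show ?thesis
    unfolding X'.adapted_iff
  proof (intro conjI ballI d(1))
    fix y assume y: "y \<in> fst d"
    have "y \<in> topspace X'" using chart_ofD(6)[OF hol_chart_chart_of[OF d(1)] y] .
    then have "y \<in> D' \<longleftrightarrow> snd c (\<pi> y) \<in> local_divisor Crossing"
      using in_D'_iff X.adapted_in_D_iff[OF adapted] d(2) y by blast
    also have "\<dots> \<longleftrightarrow> snd d y \<in> local_divisor Crossing"
      using bspec[OF d(2) y] by (cases "snd d y") auto
    finally show "y \<in> D' \<longleftrightarrow> snd d y \<in> local_divisor Crossing" .
  qed
qed

text \<open>In a slope chart the coordinates below are \<open>v\<close> and \<open>v * t\<close>, so
  their angles tend to \<open>\<sigma>\<close> and \<open>\<sigma> * \<tau>\<close>, and by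
  \<open>shift_slope\<close> the new moduli tend to \<open>edge\<close> and \<open>edge'\<close> of
  \<open>norm s0\<close>.\<close>

lemma \<eta>_exceptional:
  assumes d: "slope_chart c d" and m: "((0, s0), (\<sigma>, \<tau>)) \<in> polar_model D' d Crossing"
  defines "m' \<equiv> ((of_real (edge (norm s0)) * \<sigma>, of_real (edge' (norm s0)) * (\<sigma> * \<tau>)), (\<sigma>, \<sigma> * \<tau>))"
  shows "m' \<in> polar_model D c Crossing"
    "filtermap \<eta> (prime_end D' d Crossing ((0, s0), (\<sigma>, \<tau>))) \<le> prime_end D c Crossing m'"
proof -
  let ?F = "prime_end D' d Crossing ((0, s0), (\<sigma>, \<tau>))"
  note ad = slope_adapted[OF d]
  have dd: "\<And>y. y \<in> fst d \<Longrightarrow> \<pi> y \<in> fst c \<and> snd c (\<pi> y) = (fst (snd d y), fst (snd d y) * snd (snd d y))"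
    using d unfolding slope_chart_def by blast
  have top: "\<And>y. y \<in> fst d \<Longrightarrow> y \<in> topspace X'"
    using chart_ofD(6)[OF hol_chart_chart_of[OF X'.adapted_hol[OF ad]]] .
  note lim = prime_end_tendsto_components[where F = ?F, OF order_refl, simplified]
  have n: "norm \<sigma> = 1" "norm \<tau> = 1"
    using m unfolding X'.polar_model_iff[OF ad] by (auto dest: ang_True_norm)
  have ev: "eventually (\<lambda>y. y \<in> fst d \<and> \<pi> y \<in> fst c \<and> \<pi> y \<notin> D \<and> fst (snd d y) \<noteq> 0 \<and> snd (snd d y) \<noteq> 0) ?F"
    using prime_end_eventually[of d D' Crossing]
  proof (rule eventually_mono)
    fix y assume y: "y \<in> fst d - D'"
    then have yD: "\<pi> y \<notin> D" using in_D'_iff top by blast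
    then show "y \<in> fst d \<and> \<pi> y \<in> fst c \<and> \<pi> y \<notin> D \<and> fst (snd d y) \<noteq> 0 \<and> snd (snd d y) \<noteq> 0"
      using dd[of y] not_in_D[of "\<pi> y"] y by auto
  qed
  have nv: "((\<lambda>y. norm (fst (snd d y))) \<longlongrightarrow> 0) ?F" "((\<lambda>y. norm (snd (snd d y))) \<longlongrightarrow> norm s0) ?F"
    using tendsto_norm[OF tendsto_fst[OF lim(1)]] tendsto_norm[OF tendsto_snd[OF lim(1)]] by simp_all
  let ?v = "\<lambda>y. fst (snd d y)" and ?s = "\<lambda>y. snd (snd d y)"
  \<comment> \<open>The coordinates of \<open>\<eta> y\<close> in terms of the slope chart, written
    so that every term has a limit as \<open>v\<close> tends to 0.\<close>
  let ?f = "\<lambda>y. (of_real (norm (?v y) + edge (norm (?s y)) * max 0 (1 - norm (?v y) / R)) * sgn (?v y),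
      of_real (norm (?v y) * norm (?s y) + edge' (norm (?s y)) * max 0 (1 - norm (?v y) * norm (?s y) / R)) * (sgn (?v y) * sgn (?s y)))
      :: complex \<times> complex"
  have "(?f \<longlongrightarrow> (of_real (0 + edge (norm s0) * max 0 (1 - 0 / R)) * \<sigma>,
      of_real (0 * norm s0 + edge' (norm s0) * max 0 (1 - 0 * norm s0 / R)) * (\<sigma> * \<tau>))) ?F"
    using R_pos by (intro tendsto_Pair tendsto_mult tendsto_of_real tendsto_add tendsto_max tendsto_diff tendsto_divide
        tendsto_const tendsto_edge nv lim(2,3)) auto
  then have l: "(?f \<longlongrightarrow> fst m') ?F" by (simp add: m'_def)
  have eq: "eventually (\<lambda>y. \<eta> y \<in> fst c \<and> \<eta> y \<notin> D \<and> snd c (\<eta> y) = ?f y \<and>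
      sgn (fst (snd c (\<eta> y))) = sgn (?v y) \<and> sgn (snd (snd c (\<eta> y))) = sgn (?v y) * sgn (?s y)) ?F"
    using ev
  proof (rule eventually_mono)
    fix y assume y: "y \<in> fst d \<and> \<pi> y \<in> fst c \<and> \<pi> y \<notin> D \<and> ?v y \<noteq> 0 \<and> ?s y \<noteq> 0"
    then have w: "snd c (\<pi> y) = (?v y, ?v y * ?s y)" and nz: "?v y \<noteq> 0" "?v y * ?s y \<noteq> 0" using dd by auto
    have k: "kap c (\<pi> y) \<in> fst c" "kap c (\<pi> y) \<notin> D" "snd c (kap c (\<pi> y)) = radial_map (?v y, ?v y * ?s y)"
      using kap[of "\<pi> y"] y w by auto
    have "radial_map (?v y, ?v y * ?s y) = ?f y"
      unfolding radial_map_def using y shift_slope[of "norm (?v y)" "norm (?s y)"] shift_slope'[of "norm (?v y)" "norm (?s y)"]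
      by (simp add: norm_mult sgn_mult)
    then show "\<eta> y \<in> fst c \<and> \<eta> y \<notin> D \<and> snd c (\<eta> y) = ?f y \<and>
      sgn (fst (snd c (\<eta> y))) = sgn (?v y) \<and> sgn (snd (snd c (\<eta> y))) = sgn (?v y) * sgn (?s y)"
      unfolding \<eta>_def using k radial_map_props(5,6)[OF nz] by (simp add: sgn_mult)
  qed
  have im: "fst m' \<in> snd c ` fst c"
    unfolding image m'_def using edge_props[of "norm s0"] rR R_less n by (simp add: norm_mult)
  have c1: "eventually (\<lambda>y. \<eta> y \<in> fst c \<and> \<eta> y \<notin> D) ?F" using eq by (rule eventually_mono) blast
  have c2: "((\<lambda>y. snd c (\<eta> y)) \<longlongrightarrow> fst m') ?F"
    by (rule Lim_transform_eventually[OF l], rule eventually_mono[OF eq]) simp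
  have c3: "((\<lambda>y. sgn (fst (snd c (\<eta> y)))) \<longlongrightarrow> \<sigma>) ?F"
    by (rule Lim_transform_eventually[OF lim(2)], rule eventually_mono[OF eq]) (elim conjE, rule sym, assumption)
  have c4: "((\<lambda>y. sgn (snd (snd c (\<eta> y)))) \<longlongrightarrow> \<sigma> * \<tau>) ?F"
    by (rule Lim_transform_eventually[OF tendsto_mult[OF lim(2,3)]], rule eventually_mono[OF eq]) (elim conjE, rule sym, assumption)
  show "m' \<in> polar_model D c Crossing" "filtermap \<eta> ?F \<le> prime_end D c Crossing m'"
    using le_crossing_prime_end[OF prime_end_not_bot[OF m] c1 c2[unfolded m'_def fst_conv] im[unfolded m'_def fst_conv] c3 c4]
    unfolding m'_def by auto
qed

text \<open>Both coordinates of \<open>kap_inv\<close> tend to 0, but by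
  \<open>unshift_divide\<close> their quotient has the limit \<open>s0\<close>. The rest carries
  this limit into a slope chart around \<open>s0\<close>.\<close>

lemma \<eta>_inv_exceptional:
  assumes m: "((a, 0), (s, t)) \<in> polar_model D c Crossing" and a: "norm a \<le> r"
  shows "\<exists>F\<in>prime_ends X' A' D'. filtermap \<eta>_inv (prime_end D c Crossing ((a, 0), (s, t))) \<le> F"
proof -
  let ?G = "prime_end D c Crossing ((a, 0), (s, t))"
  \<comment> \<open>The modulus inverts \<open>edge\<close>, as
    \<open>r * (1 - (r - norm a) / r) = norm a\<close>; the direction is the quotient of the two
    angles.\<close>
  define s0 where "s0 = of_real ((r - norm a) / r) * (t / s)"
  obtain d y0 where d: "slope_chart c d" "y0 \<in> fst d" "snd d y0 = (0, s0)"
    using slope_chart_surj[OF hc z] by blast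
  note ad = slope_adapted[OF d(1)]
  have hd: "chart_of X' d" using hol_chart_chart_of[OF X'.adapted_hol[OF ad]] .
  have dd: "\<And>y. y \<in> fst d \<Longrightarrow> \<pi> y \<in> fst c \<and> snd c (\<pi> y) = (fst (snd d y), fst (snd d y) * snd (snd d y))"
    using d unfolding slope_chart_def by blast
  note mf = model_facts[OF m]
  have s_nz: "s \<noteq> 0" using mf(1) by auto
  have nb: "?G \<noteq> bot" by (rule prime_end_not_bot[OF m])
  note lim = prime_end_tendsto_components[where F = ?G, OF order_refl, simplified]
  note ki = kap_inv_prime_end[OF m]
  have u0: "unshift (norm a) (norm (0 :: complex)) = 0" "unshift (norm (0 :: complex)) (norm a) = 0"
    using unshift_0(1)[of "norm a"] unshift_zero_fst[of "norm a"] a by simp_all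
  let ?w = "\<lambda>y. snd c (kap_inv c y)"
  have w0: "(?w \<longlongrightarrow> (0, 0)) ?G" using ki(3) unfolding u0 by simp
  have n: "((\<lambda>y. norm (fst (snd c y))) \<longlongrightarrow> norm a) ?G" "((\<lambda>y. norm (snd (snd c y))) \<longlongrightarrow> 0) ?G"
    using tendsto_norm[OF tendsto_fst[OF lim(1)]] tendsto_norm[OF tendsto_snd[OF lim(1)]] by simp_all
  have aR: "norm a < R" using a rR by simp
  have small: "eventually (\<lambda>y. norm (fst (snd c y)) < R) ?G" "eventually (\<lambda>y. norm (snd (snd c y)) < R) ?G"
    using order_tendstoD(2)[OF n(1) aR] order_tendstoD(2)[OF n(2) R_pos] .
  have ev: "eventually (\<lambda>y. y \<in> fst c \<and> y \<notin> D \<and> norm (fst (snd c y)) < R \<and> norm (snd (snd c y)) < R) ?G"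
    using prime_end_eventually[of c D Crossing "((a, 0), (s, t))"] small by eventually_elim simp
  let ?g = "\<lambda>y. of_real (ratio (norm (fst (snd c y))) (norm (snd (snd c y))) / ratio (norm (snd (snd c y))) (norm (fst (snd c y)))) *
      (sgn (snd (snd c y)) / sgn (fst (snd c y))) :: complex"
  \<comment> \<open>The denominator tends to 1, so the quotient of the ratios converges.\<close>
  have r0: "ratio 0 (norm a) = 1" "ratio (norm a) 0 = (r - norm a) / r"
    using ratio_eq_1[of 0 "norm a"] ratio_0[of "norm a"] a aR by simp_all
  have "(?g \<longlongrightarrow> of_real (ratio (norm a) 0 / ratio 0 (norm a)) * (t / s)) ?G"
    using r0 s_nz by (intro tendsto_mult tendsto_of_real tendsto_divide tendsto_ratio n lim(2,3)) auto
  then have g: "(?g \<longlongrightarrow> s0) ?G" unfolding r0 s0_def by simp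
  have sl: "eventually (\<lambda>y. snd (?w y) / fst (?w y) = ?g y \<and> fst (?w y) \<noteq> 0 \<and> snd (?w y) \<noteq> 0 \<and>
      kap_inv c y \<in> fst c \<and> kap_inv c y \<notin> D) ?G"
    using ev
  proof (rule eventually_mono)
    fix y assume y: "y \<in> fst c \<and> y \<notin> D \<and> norm (fst (snd c y)) < R \<and> norm (snd (snd c y)) < R"
    let ?a = "fst (snd c y)" and ?b = "snd (snd c y)"
    have nz: "?a \<noteq> 0" "?b \<noteq> 0" using y not_in_D[of y] by auto
    have w: "?w y = radial_inv (?a, ?b)" using kap_inv(2)[of y] y by simp
    have "unshift (norm ?b) (norm ?a) / unshift (norm ?a) (norm ?b) =
        ratio (norm ?a) (norm ?b) / ratio (norm ?b) (norm ?a)"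
      using unshift_divide[of "norm ?a" "norm ?b"] y nz by simp
    then have "complex_of_real (unshift (norm ?b) (norm ?a)) / of_real (unshift (norm ?a) (norm ?b)) =
        of_real (ratio (norm ?a) (norm ?b) / ratio (norm ?b) (norm ?a))"
      unfolding of_real_divide[symmetric] by (rule arg_cong)
    then have "snd (?w y) / fst (?w y) = ?g y"
      unfolding w radial_inv_def fst_conv snd_conv times_divide_times_eq[symmetric] by (rule arg_cong)
    then show "snd (?w y) / fst (?w y) = ?g y \<and> fst (?w y) \<noteq> 0 \<and> snd (?w y) \<noteq> 0 \<and> kap_inv c y \<in> fst c \<and> kap_inv c y \<notin> D"
      using radial_inv_props(1,2)[OF nz] w kap_inv[of y] y by simp
  qed
  have slope: "((\<lambda>y. snd (?w y) / fst (?w y)) \<longlongrightarrow> s0) ?G"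
    by (rule Lim_transform_eventually[OF g], rule eventually_mono[OF sl]) simp
  have pt: "((\<lambda>y. (fst (?w y), snd (?w y) / fst (?w y))) \<longlongrightarrow> (0, s0)) ?G"
    using tendsto_fst[OF w0] slope by (intro tendsto_Pair) simp_all
  have "(0, s0) \<in> snd d ` fst d" using d(2,3) by (metis imageI)
  from topological_tendstoD[OF pt chart_ofD(2)[OF hd] this]
  have in_d: "eventually (\<lambda>y. (fst (?w y), snd (?w y) / fst (?w y)) \<in> snd d ` fst d) ?G" .
  \<comment> \<open>The point \<open>\<eta>_inv y\<close> is located by uniqueness: the point
    \<open>y'\<close> of \<open>d\<close> with these coordinates projects to
    \<open>kap_inv c y\<close>, and \<open>\<pi>\<close> is injective off the exceptional
    curve.\<close>
  have pre: "eventually (\<lambda>y. \<eta>_inv y \<in> fst d \<and> \<eta>_inv y \<notin> D' \<and>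
      snd d (\<eta>_inv y) = (fst (?w y), snd (?w y) / fst (?w y))) ?G"
    using in_d sl
  proof eventually_elim
    case (elim y)
    obtain y' where y': "y' \<in> fst d" "snd d y' = (fst (?w y), snd (?w y) / fst (?w y))"
      using elim(1) by auto
    have nz: "fst (?w y) \<noteq> 0" using elim(2) by blast
    have "snd c (\<pi> y') = ?w y" using dd[OF y'(1)] y'(2) nz by (simp add: prod_eq_iff)
    moreover have "\<pi> y' \<in> fst c" using dd[OF y'(1)] by blast
    ultimately have py: "\<pi> y' = kap_inv c y"
      using inj_onD[OF chart_ofD(3)[OF chc]] elim(2) by blast
    have top: "y' \<in> topspace X'" using chart_ofD(6)[OF hd y'(1)] .
    have nD: "\<pi> y' \<notin> D" using py elim(2) by simp
    then have "y' \<in> off_E" using top z_in_D by (auto simp: off_E_def)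
    then have "\<eta>_inv y = y'" unfolding \<eta>_inv_def py[symmetric] by (rule off_maps(3))
    then show ?case using y' in_D'_iff[OF top] nD by simp
  qed
  have "filtermap \<eta>_inv ?G \<noteq> bot" using nb by (simp add: filtermap_bot_iff)
  moreover have "filtermap \<eta>_inv ?G \<le> nhdsin X' y0"
  proof -
    have "((\<lambda>y. snd d (\<eta>_inv y)) \<longlongrightarrow> snd d y0) ?G"
      unfolding d(3) by (rule Lim_transform_eventually[OF pt], rule eventually_mono[OF pre]) simp
    from filterlim_compose[OF chart_ofD(5)[OF hd d(2)] this]
    have inv: "filterlim (\<lambda>y. inv_into (fst d) (snd d) (snd d (\<eta>_inv y))) (nhdsin X' y0) ?G" .
    have eq: "eventually (\<lambda>y. inv_into (fst d) (snd d) (snd d (\<eta>_inv y)) = \<eta>_inv y) ?G"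
      using pre by (rule eventually_mono) (rule chart_ofD(7)[OF hd], elim conjE, assumption)
    have "filterlim \<eta>_inv (nhdsin X' y0) ?G"
      by (rule iffD1[OF filterlim_cong[OF refl refl eq] inv])
    then show ?thesis unfolding filterlim_def .
  qed
  moreover have "eventually (\<lambda>y. y \<notin> D') (filtermap \<eta>_inv ?G)"
    unfolding eventually_filtermap using pre by (rule eventually_mono) blast
  moreover have "((\<lambda>y. sgn (fst (snd d y))) \<longlongrightarrow> s) (filtermap \<eta>_inv ?G)"
    unfolding filterlim_filtermap
    by (rule Lim_transform_eventually[OF ki(4)], rule eventually_mono[OF pre]) simp
  moreover have "((\<lambda>y. sgn (snd (snd d y))) \<longlongrightarrow> t / s) (filtermap \<eta>_inv ?G)"
    unfolding filterlim_filtermap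
  proof (rule Lim_transform_eventually[OF tendsto_divide[OF ki(5,4) s_nz]])
    show "eventually (\<lambda>y. sgn (snd (?w y)) / sgn (fst (?w y)) = sgn (snd (snd d (\<eta>_inv y)))) ?G"
      using pre by (rule eventually_mono) (simp add: sgn_divide)
  qed
  ultimately have "((snd d y0, (s, t / s)) \<in> polar_model D' d Crossing \<and>
      filtermap \<eta>_inv ?G \<le> prime_end D' d Crossing (snd d y0, (s, t / s)))"
    using X'.le_prime_endI[of "filtermap \<eta>_inv ?G" y0 D' d Crossing s "t / s"] ad d(2) by simp
  then show ?thesis by (elim conjE) (rule bexI[OF _ X'.prime_end_in_prime_ends[OF ad]])
qed

lemma exceptional_cases:
  assumes F: "F \<in> prime_ends X' A' D'" and e: "foot X' F \<notin> off_E"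
  obtains d s0 \<sigma> \<tau> where "slope_chart c d \<or> slope_chart (fst c, \<lambda>x. prod.swap (snd c x)) d"
    "((0, s0), (\<sigma>, \<tau>)) \<in> polar_model D' d Crossing" "F = prime_end D' d Crossing ((0, s0), (\<sigma>, \<tau>))"
proof -
  have y0: "foot X' F \<in> topspace X'" "\<pi> (foot X' F) = z"
    using X'.prime_ends_basic(3)[OF F] e unfolding off_E_def by auto
  obtain d s0 where d: "slope_chart c d \<or> slope_chart (fst c, \<lambda>x. prod.swap (snd c x)) d"
    "foot X' F \<in> fst d" "snd d (foot X' F) = (0, s0)"
    by (rule slope_chart_covers[OF hc z y0])
  have ad: "adapted_chart X' A' D' d Crossing"
    using d(1) slope_adapted blown_up_box.slope_adapted[OF swapped] by blast
  obtain m where m: "m \<in> polar_model D' d Crossing" "F = prime_end D' d Crossing m" "fst m = snd d (foot X' F)"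
    by (rule X'.prime_ends_in_chart[OF F ad d(2)])
  obtain \<sigma> \<tau> where "m = ((0, s0), (\<sigma>, \<tau>))" using m(3) d(3) by (metis prod.collapse)
  then show thesis using that[OF d(1)] m by simp
qed

lemma swap_in_prime_ends:
  assumes "m \<in> polar_model D (fst c, \<lambda>x. prod.swap (snd c x)) Crossing"
  shows "prime_end D (fst c, \<lambda>x. prod.swap (snd c x)) Crossing m \<in> prime_ends X A D"
  by (rule X.prime_end_in_prime_ends[OF X.adapted_swap[OF adapted] assms])

lemma \<eta>_le:
  assumes F: "F \<in> prime_ends X' A' D'"
  shows "\<exists>G\<in>prime_ends X A D. filtermap \<eta> F \<le> G"
proof (cases "foot X' F \<in> off_E")
  case True
  note p = prime_ends_off[OF F True]
  have nz: "foot X (filtermap \<pi> F) \<noteq> z" unfolding p(2) using True by (simp add: off_E_def)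
  show ?thesis
  proof (cases "foot X (filtermap \<pi> F) \<in> fst c")
    case False
    then show ?thesis unfolding filtermap_\<eta> using filtermap_kap_outside(1)[OF p(1)] p(1) by auto
  next
    case in_c: True
    obtain m where m: "m \<in> polar_model D c Crossing" "filtermap \<pi> F = prime_end D c Crossing m"
      "fst m = snd c (foot X (filtermap \<pi> F))"
      by (rule X.prime_ends_in_chart[OF p(1) adapted in_c])
    obtain a b s t where m': "m = ((a, b), (s, t))" by (metis prod.collapse)
    have "(a, b) \<noteq> (0, 0)"
      using m(3) m' nz z inj_onD[OF chart_ofD(3)[OF chc] _ in_c z(1)] by auto
    then have "a \<noteq> 0 \<or> b \<noteq> 0" by auto
    from kap_prime_end[OF m(1)[unfolded m'] this] show ?thesis
      unfolding filtermap_\<eta> m(2) m' using X.prime_end_in_prime_ends[OF adapted] by blast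
  qed
next
  case False
  obtain d s0 \<sigma> \<tau> where d: "slope_chart c d \<or> slope_chart (fst c, \<lambda>x. prod.swap (snd c x)) d"
    "((0, s0), (\<sigma>, \<tau>)) \<in> polar_model D' d Crossing" "F = prime_end D' d Crossing ((0, s0), (\<sigma>, \<tau>))"
    by (rule exceptional_cases[OF F False])
  from d(1) show ?thesis
  proof
    assume "slope_chart c d"
    from \<eta>_exceptional[OF this d(2)] show ?thesis
      unfolding d(3) using X.prime_end_in_prime_ends[OF adapted] by blast
  next
    assume "slope_chart (fst c, \<lambda>x. prod.swap (snd c x)) d"
    from blown_up_box.\<eta>_exceptional[OF swapped this d(2)] show ?thesis
      unfolding d(3) \<eta>_swapped using swap_in_prime_ends by blast
  qed
qed

lemma \<eta>_inv_le:
  assumes G: "G \<in> prime_ends X A D"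
  shows "\<exists>F\<in>prime_ends X' A' D'. filtermap \<eta>_inv G \<le> F"
proof (cases "foot X G \<in> fst c")
  case False
  then have "foot X G \<noteq> z" using z by auto
  then show ?thesis
    unfolding filtermap_\<eta>_inv filtermap_kap_outside(2)[OF G False] using prime_ends_pull[OF G] by blast
next
  case True
  obtain m where m: "m \<in> polar_model D c Crossing" "G = prime_end D c Crossing m"
    by (rule X.prime_ends_in_chart[OF G adapted True])
  obtain a b s t where m': "m = ((a, b), (s, t))" by (metis prod.collapse)
  note m1 = m(1)[unfolded m']
  show ?thesis
  proof (cases "unshift (norm a) (norm b) = 0 \<and> unshift (norm b) (norm a) = 0")
    case True
    \<comment> \<open>Both values vanish only on the L-shaped set; its second arm is treated in the
      swapped chart.\<close>
    then consider "b = 0" "norm a \<le> r" | "a = 0" "norm b \<le> r"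
      using unshift_zeroD[of "norm a" "norm b"] by auto
    then show ?thesis
    proof cases
      case 1
      then show ?thesis using \<eta>_inv_exceptional[of a s t] m1 m(2) m' by simp
    next
      case 2
      have "((b, 0), (t, s)) \<in> polar_model D (fst c, \<lambda>x. prod.swap (snd c x)) Crossing"
        using m1 2 unfolding X.polar_model_swap[OF adapted] by simp
      from blown_up_box.\<eta>_inv_exceptional[OF swapped this 2(2)] show ?thesis
        unfolding \<eta>_swapped X.prime_end_swap using m(2) m' 2 by simp
    qed
  next
    case False
    note ki = kap_inv_prime_end(1,2)[OF m1]
    let ?m = "((of_real (unshift (norm a) (norm b)) * s, of_real (unshift (norm b) (norm a)) * t), (s, t))"
    note fc = foot_crossing[OF ki(1)]
    have "s \<noteq> 0" "t \<noteq> 0" using model_facts(1,2)[OF m1] by auto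
    then have "snd c (foot X (prime_end D c Crossing ?m)) \<noteq> (0, 0)" unfolding fc(2) using False by auto
    then have "foot X (prime_end D c Crossing ?m) \<noteq> z" using z(2) by auto
    from prime_ends_pull[OF X.prime_end_in_prime_ends[OF adapted ki(1)] this]
    show ?thesis
      unfolding filtermap_\<eta>_inv m(2) m'
      by (rule bexI[rotated]) (rule filtermap_mono[OF ki(2)])
  qed
qed

theorem \<eta>_homeomorphic:
  "homeomorphic_map (real_blow_up X' A' D') (real_blow_up X A D) (filtermap \<eta>)"
  "\<And>F. F \<in> prime_ends X' A' D' \<Longrightarrow> filtermap \<eta> F \<in> prime_ends X A D"
  "filtermap \<eta> ` prime_ends X' A' D' = prime_ends X A D"
proof -
  have gf: "eventually (\<lambda>y. \<eta>_inv (\<eta> y) = y) F" if "F \<in> prime_ends X' A' D'" for F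
  proof (rule eventually_mono[OF X'.prime_ends_basic(4)[OF that]])
  qed (rule \<eta>_inverse)
  have fg: "eventually (\<lambda>x. \<eta> (\<eta>_inv x) = x) G" if "G \<in> prime_ends X A D" for G
  proof (rule eventually_mono[OF X.prime_ends_basic(4)[OF that]])
  qed (rule \<eta>_inverse')
  note * = filtermap_homeomorphic_map[where f = \<eta> and g = \<eta>_inv,
      OF X'.cx_surface_axioms X.cx_surface_axioms gf fg \<eta>_le \<eta>_inv_le]
  show "homeomorphic_map (real_blow_up X' A' D') (real_blow_up X A D) (filtermap \<eta>)" by (rule *(1))
  show "\<And>F. F \<in> prime_ends X' A' D' \<Longrightarrow> filtermap \<eta> F \<in> prime_ends X A D" by (rule *(2))
  show "filtermap \<eta> ` prime_ends X' A' D' = prime_ends X A D" by (rule *(3))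
qed

end

section \<open>Circle actions\<close>

lemma axes_part_eq:
  "axes_part c r = {x \<in> fst c. (cmod (fst (snd c x)) \<le> r \<and> snd (snd c x) = 0) \<or>
    (fst (snd c x) = 0 \<and> cmod (snd (snd c x)) \<le> r)}"
  by (cases c) simp

lemma axes_circles_eq:
  "axes_circles c r = {x \<in> fst c. (cmod (fst (snd c x)) = r \<and> snd (snd c x) = 0) \<or>
    (fst (snd c x) = 0 \<and> cmod (snd (snd c x)) = r)}"
  by (cases c) simp

lemma axes_swap:
  "axes_part (fst c, \<lambda>x. prod.swap (snd c x)) r = axes_part c r"
  "axes_circles (fst c, \<lambda>x. prod.swap (snd c x)) r = axes_circles c r"
  unfolding axes_part_eq axes_circles_eq by auto

text \<open>Up to \<open>R\<close> the deformation of an axis is affine with value \<open>r\<close>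
  at 0, so the strict transform of \<open>D\<close> is pushed beyond the part of the axes where the
  action is modified.\<close>

lemma (in radial) less_add_shift:
  assumes "0 < a"
  shows "r < a + shift a 0"
proof (cases "a \<le> R")
  case True
  have "a + shift a 0 = r + a * (1 - r / R)" using True assms by (simp add: shift_eq algebra_simps)
  then show ?thesis using assms slope_coeff_pos by (simp add: slope_coeff_def)
next
  case False
  then show ?thesis using shift_eq_0[of a 0] rR by simp
qed

lemma (in cx_surface) crossing_ordinary_point:
  assumes c: "adapted_chart X A D c Crossing" "x \<in> fst c" and x: "x \<in> D" "snd c x \<noteq> (0, 0)"
  shows "ordinary_point X A D x"
proof -
  obtain a b where ab: "snd c x = (a, b)" by fastforce
  have "a * b = 0" using adapted_in_D_iff[OF c] x(1) ab by simp
  then consider "a \<noteq> 0" "b = 0" | "a = 0" "b \<noteq> 0" using x(2) ab by auto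
  then show ?thesis
  proof cases
    case 1
    obtain c' where "adapted_chart X A D c' Smooth" "x \<in> fst c'"
      by (rule crossing_ordinary[OF c _ 1(1)]) (simp_all add: ab 1)
    then show ?thesis unfolding ordinary_point_iff using x(1) by blast
  next
    case 2
    obtain c' where "adapted_chart X A D c' Smooth" "x \<in> fst c'"
      by (rule crossing_ordinary[OF adapted_swap[OF c(1)] _ _ 2(2), of x]) (simp_all add: ab 2 c(2))
    then show ?thesis unfolding ordinary_point_iff using x(1) by blast
  qed
qed

section \<open>Comparison of the circle actions\<close>

context blown_up_box
begin

abbreviation "h \<equiv> filtermap \<eta>"
abbreviation "ord' F \<equiv> ordinary_point X' A' D' (foot X' F)"
abbreviation "rot' \<equiv> canonical_rotation X' A' D'"

lemma h_eq:
  assumes "F \<in> prime_ends X' A' D'" "h F \<le> G" "G \<in> prime_ends X A D"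
  shows "h F = G"
  using X.prime_ends_unique[OF X.prime_ends_basic(1) order_refl assms(2) _ assms(3)] \<eta>_homeomorphic(2)[OF assms(1)] by blast

text \<open>The exceptional curve is where the first coordinate of \<open>d\<close> vanishes, so the
  canonical rotation turns \<open>\<sigma>\<close> and keeps \<open>\<tau>\<close>; hence
  \<open>\<sigma>\<close> and \<open>\<sigma> * \<tau>\<close> turn together. A double point of
  \<open>D'\<close> in this chart has \<open>s0 = 0\<close>, that is,
  \<open>edge (norm s0) = r\<close>, the circle that carries two actions. Quantifying over the polar
  coordinates of the image lets the statement pass to the swapped chart.\<close>

lemma h_slope_chart:
  assumes d: "slope_chart c d" and m: "((0, s0), (\<sigma>, \<tau>)) \<in> polar_model D' d Crossing"
  defines "F \<equiv> prime_end D' d Crossing ((0, s0), (\<sigma>, \<tau>))"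
  shows "\<exists>a b s t. ((a, b), (s, t)) \<in> polar_model D c Crossing \<and> a * b = 0 \<and> norm a \<le> r \<and> norm b \<le> r \<and>
    h F = prime_end D c Crossing ((a, b), (s, t)) \<and> foot X' F \<in> D' \<and> (ord' F \<longleftrightarrow> norm a \<noteq> r \<and> norm b \<noteq> r) \<and>
    (ord' F \<longrightarrow> (\<forall>\<Theta>. h (rot' \<Theta> F) = prime_end D c Crossing ((cis \<Theta> * a, cis \<Theta> * b), (cis \<Theta> * s, cis \<Theta> * t))))"
proof -
  note ad = slope_adapted[OF d]
  define e1 where "e1 = edge (norm s0)"
  define e2 where "e2 = edge' (norm s0)"
  note e = edge_props[of "norm s0", folded e1_def e2_def, simplified]
  \<comment> \<open>For every first angle \<open>\<sigma>'\<close>, since the rotated filter needs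
    the same formula.\<close>
  have hF: "((of_real e1 * \<sigma>', of_real e2 * (\<sigma>' * \<tau>)), (\<sigma>', \<sigma>' * \<tau>)) \<in> polar_model D c Crossing \<and>
      h (prime_end D' d Crossing ((0, s0), (\<sigma>', \<tau>))) = prime_end D c Crossing ((of_real e1 * \<sigma>', of_real e2 * (\<sigma>' * \<tau>)), (\<sigma>', \<sigma>' * \<tau>))"
    if "((0, s0), (\<sigma>', \<tau>)) \<in> polar_model D' d Crossing" for \<sigma>'
    using \<eta>_exceptional[OF d that, folded e1_def e2_def]
      h_eq[OF X'.prime_end_in_prime_ends[OF ad that]] X.prime_end_in_prime_ends[OF adapted] by blast
  obtain y where y: "y \<in> fst d" "snd d y = (0, s0)" "foot X' F = y"
    using X'.model_foot[OF ad m] unfolding F_def by auto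
  have yD: "y \<in> D'" using X'.adapted_in_D_iff[OF ad y(1)] y(2) by simp
  have ord: "ord' F \<longleftrightarrow> s0 \<noteq> 0"
    using X'.crossing_not_ordinary[OF ad y(1)] X'.crossing_ordinary_point[OF ad y(1) yD] y(2,3) by auto
  have n: "norm \<sigma> = 1" "norm (\<sigma> * \<tau>) = 1"
    using m unfolding X'.polar_model_iff[OF ad] by (auto dest: ang_True_norm simp: norm_mult)
  have norms: "norm (of_real e1 * \<sigma>) = e1" "norm (of_real e2 * (\<sigma> * \<tau>)) = e2"
    unfolding norm_mult[of "of_real e1"] norm_mult[of "of_real e2"] n using e by simp_all
  show ?thesis
  proof (intro exI conjI)
    show "((of_real e1 * \<sigma>, of_real e2 * (\<sigma> * \<tau>)), (\<sigma>, \<sigma> * \<tau>)) \<in> polar_model D c Crossing"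
      "h F = prime_end D c Crossing ((of_real e1 * \<sigma>, of_real e2 * (\<sigma> * \<tau>)), (\<sigma>, \<sigma> * \<tau>))"
      using hF[OF m] unfolding F_def by auto
    show "of_real e1 * \<sigma> * (of_real e2 * (\<sigma> * \<tau>)) = 0" using e by auto
    show "norm (of_real e1 * \<sigma>) \<le> r" "norm (of_real e2 * (\<sigma> * \<tau>)) \<le> r" unfolding norms using e by auto
    show "foot X' F \<in> D'" using y(3) yD by simp
    show "ord' F \<longleftrightarrow> norm (of_real e1 * \<sigma>) \<noteq> r \<and> norm (of_real e2 * (\<sigma> * \<tau>)) \<noteq> r"
      unfolding norms ord using e by auto
    show "ord' F \<longrightarrow> (\<forall>\<Theta>. h (rot' \<Theta> F) = prime_end D c Crossing
        ((cis \<Theta> * (of_real e1 * \<sigma>), cis \<Theta> * (of_real e2 * (\<sigma> * \<tau>))), (cis \<Theta> * \<sigma>, cis \<Theta> * (\<sigma> * \<tau>))))"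
    proof (intro impI allI)
      fix \<Theta> assume "ord' F"
      then have s0: "s0 \<noteq> 0" using ord by simp
      have m2: "((0, s0), (cis \<Theta> * \<sigma>, \<tau>)) \<in> polar_model D' d Crossing"
        using m unfolding X'.polar_model_iff[OF ad] by (auto simp: norm_mult)
      have "rot' \<Theta> F = prime_end D' d Crossing ((0, s0), (cis \<Theta> * \<sigma>, \<tau>))"
        unfolding F_def by (rule X'.canonical_rotation_crossing_snd[OF ad m s0])
      then show "h (rot' \<Theta> F) = prime_end D c Crossing
        ((cis \<Theta> * (of_real e1 * \<sigma>), cis \<Theta> * (of_real e2 * (\<sigma> * \<tau>))), (cis \<Theta> * \<sigma>, cis \<Theta> * (\<sigma> * \<tau>)))"
        using hF[OF m2] by (simp add: mult.assoc mult.left_commute)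
    qed
  qed
qed

lemma h_exceptional:
  assumes F: "F \<in> prime_ends X' A' D'" "foot X' F \<notin> off_E"
  shows "\<exists>a b s t. ((a, b), (s, t)) \<in> polar_model D c Crossing \<and> a * b = 0 \<and> norm a \<le> r \<and> norm b \<le> r \<and>
    h F = prime_end D c Crossing ((a, b), (s, t)) \<and> foot X' F \<in> D' \<and> (ord' F \<longleftrightarrow> norm a \<noteq> r \<and> norm b \<noteq> r) \<and>
    (ord' F \<longrightarrow> (\<forall>\<Theta>. h (rot' \<Theta> F) = prime_end D c Crossing ((cis \<Theta> * a, cis \<Theta> * b), (cis \<Theta> * s, cis \<Theta> * t))))"
proof -
  obtain d s0 \<sigma> \<tau> where d: "slope_chart c d \<or> slope_chart (fst c, \<lambda>x. prod.swap (snd c x)) d"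
    "((0, s0), (\<sigma>, \<tau>)) \<in> polar_model D' d Crossing" "F = prime_end D' d Crossing ((0, s0), (\<sigma>, \<tau>))"
    by (rule exceptional_cases[OF F])
  from d(1) show ?thesis
  proof
    assume "slope_chart c d"
    from h_slope_chart[OF this d(2)] show ?thesis unfolding d(3) .
  next
    assume "slope_chart (fst c, \<lambda>x. prod.swap (snd c x)) d"
    from blown_up_box.h_slope_chart[OF swapped this d(2)]
    obtain a b s t where 1: "((a, b), (s, t)) \<in> polar_model D (fst c, \<lambda>x. prod.swap (snd c x)) Crossing"
      "a * b = 0" "norm a \<le> r" "norm b \<le> r" "foot X' F \<in> D'" "ord' F \<longleftrightarrow> norm a \<noteq> r \<and> norm b \<noteq> r"
      "h F = prime_end D (fst c, \<lambda>x. prod.swap (snd c x)) Crossing ((a, b), (s, t))"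
      "ord' F \<longrightarrow> (\<forall>\<Theta>. h (rot' \<Theta> F) =
        prime_end D (fst c, \<lambda>x. prod.swap (snd c x)) Crossing ((cis \<Theta> * a, cis \<Theta> * b), (cis \<Theta> * s, cis \<Theta> * t)))"
      unfolding d(3) \<eta>_swapped by blast
    then show ?thesis
      unfolding X.prime_end_swap X.polar_model_swap[OF adapted]
      by (intro exI[of _ b] exI[of _ a] exI[of _ t] exI[of _ s]) (simp add: mult.commute conj_commute)
  qed
qed

text \<open>\<open>push_ordinary\<close> is a single implication, so it is applied to
  \<open>\<pi>\<close> and to its inverse.\<close>

lemma ord_off:
  assumes F: "F \<in> prime_ends X' A' D'" "foot X' F \<in> off_E"
  shows "ord' F \<longleftrightarrow> ordinary_point X A D (foot X (filtermap \<pi> F))"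
proof -
  let ?y = "foot X' F"
  have "\<pi>_inv (\<pi> ?y) = ?y" "\<pi> ?y \<in> topspace X - {z}" using off_maps(1,3)[OF F(2)] by auto
  then show ?thesis
    unfolding prime_ends_off(2)[OF F]
    using bih_surfaces.push_ordinary[OF push DE F(2)] bih_surfaces.push_ordinary[OF pull ED, of "\<pi> ?y"] by auto
qed

lemma rot_off:
  assumes F: "F \<in> prime_ends X' A' D'" "foot X' F \<in> off_E" and o: "ord' F"
  shows "rot' \<Theta> F \<in> prime_ends X' A' D'" "foot X' (rot' \<Theta> F) = foot X' F"
    "filtermap \<pi> (rot' \<Theta> F) = canonical_rotation X A D \<Theta> (filtermap \<pi> F)"
  using bih_surfaces.push_canonical_rotation[OF push DE F o] by auto

text \<open>On the strict transform both actions are the canonical one. The deformation moves the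
  foot along the axis beyond modulus \<open>r\<close> and keeps the angle \<open>t\<close>, which is
  the one that rotates.\<close>

lemma h_axis:
  assumes F: "F \<in> prime_ends X' A' D'" "foot X' F \<in> off_E" and in_c: "foot X (filtermap \<pi> F) \<in> fst c"
    and axis: "snd (snd c (foot X (filtermap \<pi> F))) = 0"
  shows "ord' F \<and> ordinary_point X A D (foot X (h F)) \<and> foot X (h F) \<notin> axes_part c r \<and>
    foot X (h F) \<notin> axes_circles c r \<and> foot X' F \<in> D' \<and> foot X (h F) \<in> D \<and>
    (\<forall>\<Theta>. h (rot' \<Theta> F) = canonical_rotation X A D \<Theta> (h F))"
proof -
  note p = prime_ends_off[OF F]
  have nz: "foot X (filtermap \<pi> F) \<noteq> z" unfolding p(2) using F(2) by (simp add: off_E_def)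
  obtain m where m: "m \<in> polar_model D c Crossing" "filtermap \<pi> F = prime_end D c Crossing m"
    "fst m = snd c (foot X (filtermap \<pi> F))"
    by (rule X.prime_ends_in_chart[OF p(1) adapted in_c])
  obtain a s t where m': "m = ((a, 0), (s, t))" using m(3) axis by (metis prod.collapse)
  have a: "a \<noteq> 0"
    using m(3) m' nz z inj_onD[OF chart_ofD(3)[OF chc] _ in_c z(1)] by auto
  define a' where "a' = of_real (norm a + shift (norm a) 0) * s"
  have sh0: "shift 0 (norm a) = 0" by (rule shift_eq_0) simp
  have k: "((a', 0), (s, t')) \<in> polar_model D c Crossing \<and>
      filtermap (kap c) (prime_end D c Crossing ((a, 0), (s, t'))) \<le> prime_end D c Crossing ((a', 0), (s, t'))"
    if "((a, 0), (s, t')) \<in> polar_model D c Crossing" for t'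
    using kap_prime_end[OF that] a by (simp add: a'_def sh0)
  note m1 = m(1)[unfolded m']
  have hF: "h F = prime_end D c Crossing ((a', 0), (s, t))"
    using h_eq[OF F(1)] k[OF m1] X.prime_end_in_prime_ends[OF adapted] unfolding filtermap_\<eta> m(2) m' by blast
  have na: "r < norm a'"
    using less_add_shift[of "norm a"] a model_facts(1)[OF m1] r unfolding a'_def norm_mult norm_of_real by simp
  then have a'0: "a' \<noteq> 0" using r by auto
  let ?x = "foot X (h F)"
  have x: "?x \<in> fst c" "snd c ?x = (a', 0)" unfolding hF using foot_crossing k[OF m1] by auto
  have xD: "?x \<in> D" using X.adapted_in_D_iff[OF adapted x(1)] x(2) by simp
  have o: "ordinary_point X A D ?x"
    using X.crossing_ordinary_point[OF adapted x(1) xD] x(2) a'0 by simp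
  have yD: "foot X (filtermap \<pi> F) \<in> D" using X.adapted_in_D_iff[OF adapted in_c] axis by (simp add: case_prod_beta)
  have o': "ord' F"
    unfolding ord_off[OF F]
    by (rule X.crossing_ordinary_point[OF adapted in_c yD]) (use m(3)[symmetric] m' a in simp)
  have "foot X' F \<in> D'" using DE[OF F(2)] yD p(2) by simp
  moreover have "?x \<notin> axes_part c r" "?x \<notin> axes_circles c r"
    unfolding axes_part_eq axes_circles_eq using x na a'0 by auto
  moreover have "h (rot' \<Theta> F) = canonical_rotation X A D \<Theta> (h F)" for \<Theta>
  proof -
    note ro = rot_off[OF F o', of \<Theta>]
    have "canonical_rotation X A D \<Theta> (filtermap \<pi> F) = prime_end D c Crossing ((a, 0), (s, cis \<Theta> * t))"
      unfolding m(2) m' by (rule X.canonical_rotation_crossing_fst[OF adapted m1 a])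
    moreover have "((a, 0), (s, cis \<Theta> * t)) \<in> polar_model D c Crossing"
      using m1 unfolding X.polar_model_iff[OF adapted] by (auto simp: norm_mult)
    ultimately have "h (rot' \<Theta> F) \<le> prime_end D c Crossing ((a', 0), (s, cis \<Theta> * t))"
      "prime_end D c Crossing ((a', 0), (s, cis \<Theta> * t)) \<in> prime_ends X A D"
      using k X.prime_end_in_prime_ends[OF adapted] unfolding filtermap_\<eta> ro(3) by auto
    then have "h (rot' \<Theta> F) = prime_end D c Crossing ((a', 0), (s, cis \<Theta> * t))" by (rule h_eq[OF ro(1)])
    also have "\<dots> = canonical_rotation X A D \<Theta> (h F)"
      unfolding hF using X.canonical_rotation_crossing_fst[OF adapted _ a'0] k[OF m1] by simp
    finally show ?thesis .
  qed
  ultimately show ?thesis using o o' xD by blast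
qed

lemma h_off_axes:
  assumes F: "F \<in> prime_ends X' A' D'" "foot X' F \<in> off_E" and in_c: "foot X (filtermap \<pi> F) \<in> fst c"
    and off: "foot X' F \<notin> D'"
  shows "foot X (h F) \<notin> D"
proof -
  note p = prime_ends_off[OF F]
  have nD: "foot X (filtermap \<pi> F) \<notin> D" using DE[OF F(2)] off p(2) by simp
  obtain m where m: "m \<in> polar_model D c Crossing" "filtermap \<pi> F = prime_end D c Crossing m"
    "fst m = snd c (foot X (filtermap \<pi> F))"
    by (rule X.prime_ends_in_chart[OF p(1) adapted in_c])
  obtain a b s t where m': "m = ((a, b), (s, t))" by (metis prod.collapse)
  have nz: "a \<noteq> 0" "b \<noteq> 0" using not_in_D[OF in_c] nD m(3) m' by (metis fst_conv snd_conv)+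
  note m1 = m(1)[unfolded m']
  note k = kap_prime_end[OF m1, OF disjI1[OF nz(1)]]
  have hF: "h F = prime_end D c Crossing ((of_real (norm a + shift (norm a) (norm b)) * s,
      of_real (norm b + shift (norm b) (norm a)) * t), (s, t))"
    using h_eq[OF F(1)] k X.prime_end_in_prime_ends[OF adapted] unfolding filtermap_\<eta> m(2) m' by blast
  have pos: "norm a + shift (norm a) (norm b) \<noteq> 0" "norm b + shift (norm b) (norm a) \<noteq> 0"
    using shift_nonneg[of "norm a" "norm b"] shift_nonneg[of "norm b" "norm a"] nz
    by (metis add_pos_nonneg less_irrefl norm_ge_zero zero_less_norm_iff)+
  have st: "s \<noteq> 0" "t \<noteq> 0" using model_facts(1,2)[OF m1] by auto
  note fc = foot_crossing[OF k(1), folded hF]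
  show ?thesis
    unfolding not_in_D[OF fc(1)] fc(2) using pos st by (simp del: of_real_add)
qed

text \<open>Stated as equivalences for every trace filter, so that surjectivity of \<open>h\<close>
  turns them into equalities of images.\<close>

lemma h_cases:
  assumes F: "F \<in> prime_ends X' A' D'"
  shows "(foot X' F \<in> D' \<longleftrightarrow> foot X (h F) \<in> D) \<and>
    (F \<in> ordinary_boundary X' A' D' \<longleftrightarrow> h F \<in> Z_regular_boundary X A D c r) \<and>
    (F \<in> ordinary_boundary X' A' D' \<longrightarrow> (\<forall>\<Theta>. h (rot' \<Theta> F) = Z_rotation X A D c r \<Theta> (h F)))"
proof -
  note hP = \<eta>_homeomorphic(2)[OF F]
  have ob: "F \<in> ordinary_boundary X' A' D' \<longleftrightarrow> foot X' F \<in> D' \<and> ord' F"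
    using F unfolding ordinary_boundary_def blow_up_boundary_def by blast
  have zb: "h F \<in> Z_regular_boundary X A D c r \<longleftrightarrow> foot X (h F) \<in> D \<and> foot X (h F) \<notin> axes_circles c r \<and>
      (foot X (h F) \<in> axes_part c r \<or> ordinary_point X A D (foot X (h F)))"
    using hP unfolding Z_regular_boundary_def blow_up_boundary_def by blast
  show ?thesis
  proof (cases "foot X' F \<in> off_E")
    case False
    obtain a b s t where 1: "((a, b), (s, t)) \<in> polar_model D c Crossing" "a * b = 0" "norm a \<le> r" "norm b \<le> r"
      "h F = prime_end D c Crossing ((a, b), (s, t))" "foot X' F \<in> D'" "ord' F \<longleftrightarrow> norm a \<noteq> r \<and> norm b \<noteq> r"
      "ord' F \<longrightarrow> (\<forall>\<Theta>. h (rot' \<Theta> F) = prime_end D c Crossing ((cis \<Theta> * a, cis \<Theta> * b), (cis \<Theta> * s, cis \<Theta> * t)))"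
      using h_exceptional[OF F False] by blast
    note fc = foot_crossing[OF 1(1), folded 1(5)]
    have D: "foot X (h F) \<in> D" using X.adapted_in_D_iff[OF adapted fc(1)] fc(2) 1(2) by simp
    have part: "foot X (h F) \<in> axes_part c r" unfolding axes_part_eq using fc 1(2-4) by auto
    have circ: "foot X (h F) \<in> axes_circles c r \<longleftrightarrow> norm a = r \<or> norm b = r"
      unfolding axes_circles_eq using fc 1(2) r by auto
    have "Z_rotation X A D c r \<Theta> (h F) = prime_end D c Crossing ((cis \<Theta> * a, cis \<Theta> * b), (cis \<Theta> * s, cis \<Theta> * t))" for \<Theta>
      unfolding Z_rotation_def using part crossing_rotation_eq(2)[OF 1(1)] 1(5) by simp
    then show ?thesis unfolding ob zb using D part circ 1(6-8) by auto
  next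
    case True
    note p = prime_ends_off[OF F True]
    show ?thesis
    proof (cases "foot X (filtermap \<pi> F) \<in> fst c")
      case False
      have hF: "h F = filtermap \<pi> F" unfolding filtermap_\<eta> by (rule filtermap_kap_outside(1)[OF p(1) False])
      have fD: "foot X' F \<in> D' \<longleftrightarrow> foot X (h F) \<in> D" unfolding hF p(2) by (rule DE[OF True])
      have out: "foot X (h F) \<notin> axes_part c r" "foot X (h F) \<notin> axes_circles c r"
        unfolding axes_part_eq axes_circles_eq hF using False by auto
      have "h (rot' \<Theta> F) = canonical_rotation X A D \<Theta> (h F)" if o: "ord' F" for \<Theta>
      proof -
        note ro = rot_off[OF F True o, of \<Theta>]
        have off: "foot X' (rot' \<Theta> F) \<in> off_E" using ro(2) True by simp
        note p' = prime_ends_off[OF ro(1) off]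
        have "foot X (filtermap \<pi> (rot' \<Theta> F)) \<notin> fst c" using False unfolding p'(2) ro(2) p(2) .
        from filtermap_kap_outside(1)[OF p'(1) this] show ?thesis unfolding filtermap_\<eta>[of "rot' \<Theta> F"] hF ro(3) .
      qed
      then show ?thesis unfolding ob zb Z_rotation_def using fD out ord_off[OF F True] hF by auto
    next
      case in_c: True
      show ?thesis
      proof (cases "foot X' F \<in> D'")
        case False
        then show ?thesis unfolding ob zb using h_off_axes[OF F True in_c False] by blast
      next
        case inD: True
        let ?q = "snd c (foot X (filtermap \<pi> F))"
        have "foot X (filtermap \<pi> F) \<in> D" using DE[OF True] inD p(2) by simp
        then consider "snd ?q = 0" | "fst ?q = 0" using not_in_D[OF in_c] by blast
        then have "ord' F \<and> ordinary_point X A D (foot X (h F)) \<and> foot X (h F) \<notin> axes_part c r \<and>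
            foot X (h F) \<notin> axes_circles c r \<and> foot X' F \<in> D' \<and> foot X (h F) \<in> D \<and>
            (\<forall>\<Theta>. h (rot' \<Theta> F) = canonical_rotation X A D \<Theta> (h F))"
        proof cases
          case 1
          then show ?thesis by (rule h_axis[OF F True in_c])
        next
          case 2
          then show ?thesis
            using blown_up_box.h_axis[OF swapped F True] in_c unfolding \<eta>_swapped axes_swap by simp
        qed
        then show ?thesis unfolding ob zb Z_rotation_def by simp
      qed
    qed
  qed
qed

theorem respects: "respects_circle_actions X' A' D' X A D c r h"
proof -
  note cases = h_cases[THEN conjunct1] h_cases[THEN conjunct2, THEN conjunct1]
    h_cases[THEN conjunct2, THEN conjunct2, rule_format]
  have onto: "h ` S = T" if S: "S \<subseteq> prime_ends X' A' D'" and T: "T \<subseteq> prime_ends X A D"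
    and iff: "\<And>F. F \<in> prime_ends X' A' D' \<Longrightarrow> F \<in> S \<longleftrightarrow> h F \<in> T" for S T
  proof (intro equalityI subsetI)
    show "G \<in> T" if "G \<in> h ` S" for G using that S iff by auto
  next
    fix G assume G: "G \<in> T"
    then have "G \<in> h ` prime_ends X' A' D'" using T unfolding \<eta>_homeomorphic(3) by auto
    then show "G \<in> h ` S" using G iff by auto
  qed
  have sub: "blow_up_boundary X A D \<subseteq> prime_ends X A D" "blow_up_boundary X' A' D' \<subseteq> prime_ends X' A' D'"
    "ordinary_boundary X' A' D' \<subseteq> prime_ends X' A' D'" "Z_regular_boundary X A D c r \<subseteq> prime_ends X A D"
    unfolding ordinary_boundary_def Z_regular_boundary_def blow_up_boundary_def by auto
  show ?thesis
    unfolding respects_circle_actions_def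
  proof (intro conjI ballI allI)
    show "h ` blow_up_boundary X' A' D' = blow_up_boundary X A D"
    proof (rule onto[OF sub(2,1)])
      fix F assume F: "F \<in> prime_ends X' A' D'"
      then show "F \<in> blow_up_boundary X' A' D' \<longleftrightarrow> h F \<in> blow_up_boundary X A D"
        using cases(1)[OF F] \<eta>_homeomorphic(2)[OF F] unfolding blow_up_boundary_def by simp
    qed
    show "h ` ordinary_boundary X' A' D' = Z_regular_boundary X A D c r"
      by (rule onto[OF sub(3,4) cases(2)])
    show "h (rot' \<Theta> F) = Z_rotation X A D c r \<Theta> (h F)" if "F \<in> ordinary_boundary X' A' D'" for F \<Theta>
      using cases(3)[OF _ that] sub(3) that by auto
  qed
qed

end

theorem mainTheorem3:
  fixes X :: "'a topology" and A :: "'a chart set" and D :: "'a set" and z :: 'a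
    and X' :: "'b topology" and A' :: "'b chart set" and D' :: "'b set" and \<pi> :: "'b \<Rightarrow> 'a"
    and W :: "'a set" and w :: "'a \<Rightarrow> complex \<times> complex" and R r :: real
  assumes "complex_surface X A"
    and "nc_divisor X A D"
    and "double_point X A D z"
    and "blow_up X A z X' A' \<pi>"
    and "D' = {y \<in> topspace X'. \<pi> y \<in> D}"
    and "hol_chart X A (W, w)" and "z \<in> W" and "w z = (0, 0)"
    and "w ` W = ball 0 R \<times> ball 0 R"
    and "w ` (D \<inter> W) = {(w1, w2) \<in> w ` W. w1 * w2 = 0}"
    and "0 < r" and "r < R"
  shows "\<exists>h. homeomorphic_map (real_blow_up X' A' D') (real_blow_up X A D) h \<and>
             respects_circle_actions X' A' D' X A D (W, w) r h"
proof -
  \<comment> \<open>The midpoint serves as the radius at which the deformation ends, with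
    \<open>r < ?R < R\<close>.\<close>
  let ?R = "(r + R) / 2" and ?c = "(W, w)"
  have X: "cx_surface X A" using assms(1) by (rule cx_surface.intro)
  have "adapted_chart X A D ?c Crossing"
    unfolding adapted_chart_def using assms(6,10) by auto
  then have box: "box_chart X A r ?R D ?c R"
    using assms(9,11,12) by (intro box_chart.intro box_chart_axioms.intro X radial.intro) auto
  have "blown_up_box X A z X' A' \<pi> r ?R D ?c R D'"
    using assms(5,7,8)
    by (intro blown_up_box.intro blown_up_box_axioms.intro blown_up.intro blown_up_axioms.intro X assms(4) box) auto
  then interpret blown_up_box X A z X' A' \<pi> r ?R D ?c R D' .
  show ?thesis using \<eta>_homeomorphic(1) respects by auto
qed

end
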